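(* For each $n$ let $A\in\mathbb{R}^{n\times n}$ be symmetric with eigenvalues $\lambda_1\ge\dots\ge\lambda_n$ satisfying $\lambda_r>\lambda_{r+1}$ ($1\le r<n$), and eigen-decomposition $A=V_1\Lambda_1V_1^T+V_2\Lambda_2V_2^T$, where $\Lambda_1=\mathrm{diag}(\lambda_1,\dots,\lambda_r)$, $\Lambda_2=\mathrm{diag}(\lambda_{r+1},\dots,\lambda_n)$, and $V_1\in\mathbb{R}^{n\times r}$, $V_2\in\mathbb{R}^{n\times(n-r)}$ have orthonormal columns that are the associated eigenvectors. Suppose that $$\mathsf{gap}=\min\{\mathsf{sep}_2(\Lambda_1,\Lambda_2),\ \mathsf{sep}_{(2,\infty),V_2}(\Lambda_1,V_2\Lambda_2V_2^T)\}$$ is independent of $n$ and that $\|V_1\|_{2,\infty}\lesssim 1/\sqrt n$. Let $E=\sigma Z$, where $Z\in\mathbb{R}^{n\times n}$ is a random symmetric matrix whose entries $Z_{i,j}$ are i.i.d. $\mathcal{N}(0,1)$ random variables up to the symmetry constraint (that is, $\{Z_{i,j}\}_{i\le j}$ are i.i.d. $\mathcal N(0,1)$), and $\sigma=\sigma_n>0$ satisfies $\sigma\lesssim 1/\sqrt n$. Put $\widehat A=A+E$. Then with probability $1-o(1)$ as $n\to\infty$, $$\|\widehat V_1\widetilde U-V_1\|_{2,\infty}\lesssim \sigma^2\sqrt n+\sigma\sqrt{\log n}+(\sigma\sqrt n)^3,$$ where $\widehat V_1\in\mathbb{R}^{n\times r}$ is any matrix with orthonormal columns whose range is the dominant $r$-dimensional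 invariant subspace of $\widehat A$, and $\widetilde U$ solves the orthogonal Procrustes problem $\min\{\|\widehat V_1U-V_1\|_F:U\in\mathbf{O}^r\}$.
   Context: $a\lesssim b$ means $a\le Cb$ for a constant $C>0$ not depending on $n$. $\mathbf{O}^r$ is the set of $r\times r$ orthogonal matrices. The dominant $r$-dimensional invariant subspace of a symmetric matrix is the one associated with its $r$ algebraically largest eigenvalues. $\|\cdot\|_2$ is the spectral norm, $\|\cdot\|_F$ the Frobenius norm, and $\|B\|_{2,\infty}=\max_i\|B_{i,:}\|_2$ is the maximum Euclidean norm of the rows of $B$. For $B\in\mathbb{R}^{\ell\times\ell}$, $C\in\mathbb{R}^{m\times m}$ and a norm $\|\cdot\|_*$ on $\mathbb{R}^{m\times\ell}$, $\mathsf{sep}_*(B,C)=\inf\{\|ZB-CZ\|_*: Z\in\mathbb{R}^{m\times\ell},\ \|Z\|_*=1\}$. For a matrix $W$ with $m$ rows and orthonormal columns, $\mathsf{sep}_{*,W}(B,C)=\inf\{\|ZB-CZ\|_*: Z\in\mathbb{R}^{m\times\ell},\ \text{every column of } Z \text{ lies in } \mathrm{ran}\,W,\ \|Z\|_*=1\}$. The subscripts $2$ and $(2,\infty)$ refer to the norms $\|\cdot\|_2$ and $\|\cdot\|_{2,\infty}$. *)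

theory Defs
  imports "HOL-Probability.Probability" "Jordan_Normal_Form.Char_Poly"
begin

subsection \<open>Norms\<close>

definition vec_norm2 :: "real vec \<Rightarrow> real" where
  "vec_norm2 v = L2_set (vec_index v) {..<dim_vec v}"

definition spectral_norm :: "real mat \<Rightarrow> real" where
  "spectral_norm B =
     Sup {vec_norm2 (B *\<^sub>v x) | x. x \<in> carrier_vec (dim_col B) \<and> vec_norm2 x = 1}"

definition frobenius_norm :: "real mat \<Rightarrow> real" where
  "frobenius_norm B = L2_set (\<lambda>ij. B $$ ij) ({..<dim_row B} \<times> {..<dim_col B})"

definition two_inf_norm :: "real mat \<Rightarrow> real" where
  "two_inf_norm B = Max ((\<lambda>i. vec_norm2 (Matrix.row B i)) ` {..<dim_row B})"

subsection \<open>Ranges and orthonormal columns\<close>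

definition mat_ran :: "real mat \<Rightarrow> real vec set" where
  "mat_ran W = {W *\<^sub>v x | x. x \<in> carrier_vec (dim_col W)}"

definition orthonormal_columns :: "real mat \<Rightarrow> bool" where
  "orthonormal_columns W \<longleftrightarrow> transpose_mat W * W = 1\<^sub>m (dim_col W)"

definition orthogonal_mats :: "nat \<Rightarrow> real mat set" where
  "orthogonal_mats r =
     {U \<in> carrier_mat r r. transpose_mat U * U = 1\<^sub>m r \<and> U * transpose_mat U = 1\<^sub>m r}"

subsection \<open>Separation of matrices\<close>

text \<open>The matrices \<open>Z\<close> have \<open>m = dim_row C\<close> rows and \<open>l = dim_row B\<close> columns, for square
  \<open>B\<close> and \<open>C\<close>.\<close>

definition sep :: "(real mat \<Rightarrow> real) \<Rightarrow> real mat \<Rightarrow> real mat \<Rightarrow> real" where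
  "sep nrm B C =
     Inf {nrm (Z * B - C * Z) | Z. Z \<in> carrier_mat (dim_row C) (dim_row B) \<and> nrm Z = 1}"

definition sep_on :: "(real mat \<Rightarrow> real) \<Rightarrow> real mat \<Rightarrow> real mat \<Rightarrow> real mat \<Rightarrow> real" where
  "sep_on nrm W B C =
     Inf {nrm (Z * B - C * Z) | Z. Z \<in> carrier_mat (dim_row C) (dim_row B) \<and>
            (\<forall>j < dim_col Z. Matrix.col Z j \<in> mat_ran W) \<and> nrm Z = 1}"

subsection \<open>Eigenvalues and dominant invariant subspaces\<close>

text \<open>\<open>lam 1 \<ge> \<dots> \<ge> lam n\<close> are the eigenvalues with multiplicity (indexed from 1, whereas
  matrix columns are indexed from 0).\<close>

definition ordered_eigenvalues :: "real mat \<Rightarrow> (nat \<Rightarrow> real) \<Rightarrow> bool" where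
  "ordered_eigenvalues A lam \<longleftrightarrow>
     (\<forall>i \<in> {1..<dim_row A}. lam (i + 1) \<le> lam i) \<and>
     char_poly A = (\<Prod>i = 1..dim_row A. [:- lam i, 1:])"

text \<open>For symmetric \<open>A\<close>. If the \<open>r\<close>-th and \<open>(r+1)\<close>-st eigenvalues coincide, the subspace is not
  unique, and every choice of orthonormal eigenvectors for the \<open>r\<close> largest eigenvalues qualifies.\<close>

definition dominant_invariant_subspace :: "nat \<Rightarrow> real mat \<Rightarrow> real vec set \<Rightarrow> bool" where
  "dominant_invariant_subspace r A S \<longleftrightarrow>
     (\<exists>lam V. ordered_eigenvalues A lam \<and>
        V \<in> carrier_mat (dim_row A) r \<and> orthonormal_columns V \<and>
        (\<forall>j<r. eigenvector A (Matrix.col V j) (lam (j + 1))) \<and>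
        S = mat_ran V)"

definition solves_procrustes :: "nat \<Rightarrow> real mat \<Rightarrow> real mat \<Rightarrow> real mat \<Rightarrow> bool" where
  "solves_procrustes r Vh V U \<longleftrightarrow>
     is_arg_min (\<lambda>U. frobenius_norm (Vh * U - V)) (\<lambda>U. U \<in> orthogonal_mats r) U"

subsection \<open>Probability\<close>

definition gaussian_symmetric :: "'a measure \<Rightarrow> nat \<Rightarrow> ('a \<Rightarrow> real mat) \<Rightarrow> bool" where
  "gaussian_symmetric M n Z \<longleftrightarrow>
     (\<forall>\<omega> \<in> space M. Z \<omega> \<in> carrier_mat n n \<and> transpose_mat (Z \<omega>) = Z \<omega>) \<and>
     (\<forall>i j. i \<le> j \<and> j < n \<longrightarrow> distributed M lborel (\<lambda>\<omega>. Z \<omega> $$ (i, j)) std_normal_density) \<and>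
     prob_space.indep_vars M (\<lambda>_. borel) (\<lambda>ij \<omega>. Z \<omega> $$ ij) {(i, j). i \<le> j \<and> j < n}"

text \<open>\<open>P n\<close> holds with probability \<open>1 - o(1)\<close>. As \<open>P n\<close> may quantify over uncountably many objects,
  it is only required to contain an event whose probability tends to 1.\<close>

definition with_high_probability :: "(nat \<Rightarrow> 'a measure) \<Rightarrow> (nat \<Rightarrow> 'a \<Rightarrow> bool) \<Rightarrow> bool" where
  "with_high_probability M P \<longleftrightarrow>
     (\<exists>G. (\<forall>n. G n \<in> sets (M n)) \<and> (\<forall>n. \<forall>\<omega> \<in> G n. P n \<omega>) \<and>
          (\<lambda>n. measure (M n) (G n)) \<longlonglongrightarrow> 1)"

end

theory Submission
  imports Defs "Jordan_Normal_Form.Schur_Decomposition" "HOL-Real_Asymp.Real_Asymp"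
begin

text \<open>
  If \<open>\<sigma> \<surd>n\<close> is bounded below the claim is trivial, so let it be small. Write the perturbed subspace as
  a graph over \<open>ran V\<^sub>1\<close>, with columns \<open>v\<^sub>j + f\<^sub>j\<close> and \<open>f\<^sub>j \<bottom> ran V\<^sub>1\<close>. Then \<open>F = (f\<^sub>j)\<close> solves a Riccati
  equation \<open>F \<Lambda>\<^sub>1 - A F = P\<^sub>2 E (V\<^sub>1 + F) - F V\<^sub>1\<^sup>T E (V\<^sub>1 + F)\<close>, in which the possibly unbounded \<open>\<Lambda>\<^sub>1\<close> occurs
  only on the left. The \<open>(2,\<infinity>)\<close>-separation reduces the claim to bounding the rows of the right-hand
  side. There \<open>E F\<close> is replaced by \<open>E W\<close> with the first-order term \<open>w\<^sub>j = R\<^sub>j E v\<^sub>j\<close>, at the cost of the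
  cubic error; the rows of \<open>E V\<^sub>1\<close> are Gaussian, and those of \<open>E W\<close> are Gaussian conditionally on the
  minor of \<open>E\<close> that omits the row, up to controlled remainders. The component of the error
  inside \<open>ran V\<^sub>1\<close> is quadratic, since the Procrustes solution makes \<open>V\<^sub>1\<^sup>T (Vh U)\<close> symmetric
  and positive semidefinite. Since the rank is bounded by incoherence, no dimension factors are lost.
\<close>

text \<open>Two obstacles shape the proof. No estimate may contain the norm of the matrix itself, so
  everything passes through inverses of Sylvester operators: the eigengap bounds them one column at
  a time in Euclidean norm, and the separation on ran V2 bounds them once, for all columns of
  \<open>F\<close> jointly, in the row norm. Second, \<open>F\<close> depends on the very row of
  \<open>E\<close> that multiplies it. The crude bound ||E|| ||F|| is of order (\<sigma> sqrt n)^2,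
  which can exceed the rate, and the dependence of \<open>F\<close> on a single row is not explicit.
  \<open>W\<close> is linear in \<open>E\<close>, so deleting row and column i changes it by an
  explicit remainder, while \<open>F - W\<close> is already of second order in \<sigma> sqrt n and
  one more factor \<open>E\<close> makes it cubic. For the same reason V1^T E V1 is bounded by
  Gaussian concentration instead of the operator norm. The logarithm comes from a union bound over
  the entries of E V1, V1^T E V1 and the leading part of E W, fewer than n^2 of each kind once n
  exceeds the rank.\<close>

definition inner_n :: "nat \<Rightarrow> (nat \<Rightarrow> real) \<Rightarrow> (nat \<Rightarrow> real) \<Rightarrow> real" where
  "inner_n n x y = (\<Sum>i<n. x i * y i)"

definition norm_n :: "nat \<Rightarrow> (nat \<Rightarrow> real) \<Rightarrow> real" where
  "norm_n n x = L2_set x {..<n}"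

text \<open>Vectors and matrices are total functions of which only the entries at indices below
  \<open>n\<close> count, so no carrier conditions arise. The row index of the product is
  unrestricted, which makes \<open>mul_n_cong\<close> an equality of functions.\<close>

definition mul_n :: "nat \<Rightarrow> (nat \<Rightarrow> nat \<Rightarrow> real) \<Rightarrow> (nat \<Rightarrow> real) \<Rightarrow> nat \<Rightarrow> real" where
  "mul_n n A x = (\<lambda>i. \<Sum>k<n. A i k * x k)"

lemma inner_n_commute: "inner_n n x y = inner_n n y x"
  by (simp add: inner_n_def mult.commute)

lemma inner_n_cong:
  "(\<And>i. i < n \<Longrightarrow> x i = x' i) \<Longrightarrow> (\<And>i. i < n \<Longrightarrow> y i = y' i) \<Longrightarrow> inner_n n x y = inner_n n x' y'"
  by (auto simp: inner_n_def intro!: sum.cong)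

lemma inner_n_add_left: "inner_n n (\<lambda>i. x i + y i) z = inner_n n x z + inner_n n y z"
  and inner_n_add_right: "inner_n n z (\<lambda>i. x i + y i) = inner_n n z x + inner_n n z y"
  and inner_n_diff_left: "inner_n n (\<lambda>i. x i - y i) z = inner_n n x z - inner_n n y z"
  and inner_n_diff_right: "inner_n n z (\<lambda>i. x i - y i) = inner_n n z x - inner_n n z y"
  by (simp_all add: inner_n_def algebra_simps sum.distrib sum_subtractf)

lemma inner_n_scale_left: "inner_n n (\<lambda>i. c * x i) z = c * inner_n n x z"
  and inner_n_scale_right: "inner_n n z (\<lambda>i. c * x i) = c * inner_n n z x"
  by (simp_all add: inner_n_def sum_distrib_left algebra_simps)

lemma inner_n_sum_left: "inner_n n (\<lambda>i. \<Sum>j\<in>J. f j i) z = (\<Sum>j\<in>J. inner_n n (f j) z)"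
  unfolding inner_n_def sum_distrib_right by (rule sum.swap)

lemma inner_n_sum_right: "inner_n n z (\<lambda>i. \<Sum>j\<in>J. f j i) = (\<Sum>j\<in>J. inner_n n z (f j))"
  using inner_n_sum_left[of n f J z] by (simp add: inner_n_commute)

lemmas inner_n_linear = inner_n_add_left inner_n_add_right inner_n_diff_left inner_n_diff_right
  inner_n_scale_left inner_n_scale_right inner_n_sum_left inner_n_sum_right

lemma norm_n_nonneg [simp]: "0 \<le> norm_n n x"
  by (simp add: norm_n_def)

lemma norm_n_sq: "(norm_n n x)\<^sup>2 = inner_n n x x"
  by (simp add: norm_n_def L2_set_def inner_n_def sum_nonneg power2_eq_square)

lemma inner_n_self_nonneg: "0 \<le> inner_n n x x"
  by (metis norm_n_sq zero_le_power2)

lemma norm_n_cong: "(\<And>i. i < n \<Longrightarrow> x i = y i) \<Longrightarrow> norm_n n x = norm_n n y"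
  by (auto simp: norm_n_def intro!: L2_set_cong)

lemma inner_n_le: "\<bar>inner_n n x y\<bar> \<le> norm_n n x * norm_n n y"
proof -
  have "\<bar>inner_n n x y\<bar> \<le> (\<Sum>i<n. \<bar>x i\<bar> * \<bar>y i\<bar>)"
    unfolding inner_n_def by (rule order_trans[OF sum_abs]) (simp add: abs_mult)
  also have "\<dots> \<le> norm_n n x * norm_n n y"
    unfolding norm_n_def by (rule L2_set_mult_ineq)
  finally show ?thesis .
qed

lemma norm_n_add: "norm_n n (\<lambda>i. x i + y i) \<le> norm_n n x + norm_n n y"
  unfolding norm_n_def by (rule L2_set_triangle_ineq)

lemma norm_n_scale: "norm_n n (\<lambda>i. c * x i) = \<bar>c\<bar> * norm_n n x"
proof (rule power2_eq_imp_eq)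
  show "(norm_n n (\<lambda>i. c * x i))\<^sup>2 = (\<bar>c\<bar> * norm_n n x)\<^sup>2"
    unfolding power_mult_distrib norm_n_sq inner_n_linear by (simp add: power2_eq_square)
qed auto

lemma norm_n_diff: "norm_n n (\<lambda>i. x i - y i) \<le> norm_n n x + norm_n n y"
  using norm_n_add[of n x "\<lambda>i. -1 * y i"] norm_n_scale[of n "-1" y] by simp

lemma norm_n_sum: "norm_n n (\<lambda>i. \<Sum>j\<in>J. f j i) \<le> (\<Sum>j\<in>J. norm_n n (f j))"
proof (induction J rule: infinite_finite_induct)
  case (insert j J)
  then show ?case using norm_n_add[of n "f j" "\<lambda>i. \<Sum>j\<in>J. f j i"] by simp
qed (simp_all add: norm_n_def L2_set_def)

lemma norm_n_component: "i < n \<Longrightarrow> \<bar>x i\<bar> \<le> norm_n n x"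
proof (rule power2_le_imp_le)
  assume "i < n"
  then show "\<bar>x i\<bar>\<^sup>2 \<le> (norm_n n x)\<^sup>2"
    unfolding norm_n_sq inner_n_def by (simp add: power2_eq_square member_le_sum[of i "{..<n}" "\<lambda>i. x i * x i"])
qed simp

lemma norm_n_le_sqrt_bound:
  assumes "\<And>i. i < n \<Longrightarrow> \<bar>x i\<bar> \<le> b" "0 \<le> b"
  shows "norm_n n x \<le> sqrt (real n) * b"
proof (rule power2_le_imp_le)
  have "x i * x i \<le> b * b" if "i < n" for i
    using mult_mono[OF assms(1)[OF that] assms(1)[OF that] assms(2)] by simp
  then have "inner_n n x x \<le> (\<Sum>i<n. b * b)"
    unfolding inner_n_def by (intro sum_mono) auto
  then show "(norm_n n x)\<^sup>2 \<le> (sqrt (real n) * b)\<^sup>2"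
    by (simp add: norm_n_sq power_mult_distrib) (simp add: power2_eq_square)
qed (use assms in auto)

lemma norm_n_eq_0: "norm_n n x = 0 \<longleftrightarrow> (\<forall>i<n. x i = 0)"
  by (auto simp: norm_n_def L2_set_eq_0_iff)

text \<open>Cancels one factor of the norm, with the zero vector included. Several quadratic-form
  estimates below end with it.\<close>

lemma norm_n_le_of_inner:
  assumes "inner_n n x x \<le> c * norm_n n x" "0 \<le> c"
  shows "norm_n n x \<le> c"
proof (cases "norm_n n x = 0")
  case False
  then have "norm_n n x > 0" using norm_n_nonneg[of n x] by linarith
  moreover have "norm_n n x * norm_n n x \<le> c * norm_n n x"
    using assms(1) by (simp add: norm_n_sq[symmetric] power2_eq_square)
  ultimately show ?thesis by simp
qed (use assms in auto)

lemma mul_n_add: "mul_n n A (\<lambda>i. x i + y i) i = mul_n n A x i + mul_n n A y i"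
  and mul_n_diff: "mul_n n A (\<lambda>i. x i - y i) i = mul_n n A x i - mul_n n A y i"
  and mul_n_scale: "mul_n n A (\<lambda>i. c * x i) i = c * mul_n n A x i"
  by (simp_all add: mul_n_def sum_distrib_left algebra_simps sum.distrib sum_subtractf)

lemma mul_n_sum: "mul_n n A (\<lambda>i. \<Sum>j\<in>J. f j i) i = (\<Sum>j\<in>J. mul_n n A (f j) i)"
  unfolding mul_n_def sum_distrib_left by (rule sum.swap)

lemma mul_n_cong: "(\<And>i. i < n \<Longrightarrow> x i = y i) \<Longrightarrow> mul_n n A x = mul_n n A y"
  by (auto simp: mul_n_def intro!: sum.cong)

lemma mul_n_inner: "mul_n n A x i = inner_n n (A i) x"
  by (simp add: mul_n_def inner_n_def)

lemma mul_n_adjoint: "inner_n n x (mul_n n A y) = inner_n n (mul_n n (\<lambda>i k. A k i) x) y"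
  unfolding inner_n_def mul_n_def sum_distrib_left sum_distrib_right
  by (subst sum.swap) (simp add: ac_simps)

lemma mul_n_symmetric:
  assumes "\<And>i k. i < n \<Longrightarrow> k < n \<Longrightarrow> A i k = A k i"
  shows "inner_n n x (mul_n n A y) = inner_n n (mul_n n A x) y"
  unfolding mul_n_adjoint
  by (rule inner_n_cong) (use assms in \<open>auto simp: mul_n_def intro!: sum.cong\<close>)

subsection \<open>Orthonormal systems and the spectral theorem\<close>

definition orthonormal_n :: "nat \<Rightarrow> nat \<Rightarrow> (nat \<Rightarrow> nat \<Rightarrow> real) \<Rightarrow> bool" where
  "orthonormal_n n r v \<longleftrightarrow> (\<forall>j<r. \<forall>k<r. inner_n n (v j) (v k) = of_bool (j = k))"

lemma orthonormal_nD: "orthonormal_n n r v \<Longrightarrow> j < r \<Longrightarrow> k < r \<Longrightarrow> inner_n n (v j) (v k) = of_bool (j = k)"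
  by (auto simp: orthonormal_n_def)

lemma sum_of_bool_mult:
  fixes k r :: nat
  assumes "k < r"
  shows "(\<Sum>j<r. c j * of_bool (j = k)) = (c k :: real)"
    and "(\<Sum>j<r. c j * of_bool (k = j)) = (c k :: real)"
    and "(\<Sum>j<r. of_bool (j = k) * c j) = (c k :: real)"
    and "(\<Sum>j<r. of_bool (k = j) * c j) = (c k :: real)"
  using assms by (simp_all add: of_bool_def if_distrib[of "\<lambda>x. _ * x"] if_distrib[of "\<lambda>x. x * _"] cong: if_cong)

lemma orthonormal_n_norm: "orthonormal_n n r v \<Longrightarrow> j < r \<Longrightarrow> norm_n n (v j) = 1"
  using norm_n_sq[of n "v j"] norm_n_nonneg[of n "v j"] by (simp add: orthonormal_n_def power2_eq_1_iff)

lemma orthonormal_n_coeff: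
  assumes "orthonormal_n n r v" "k < r"
  shows "inner_n n (v k) (\<lambda>i. \<Sum>j<r. c j * v j i) = c k"
proof -
  have "inner_n n (v k) (\<lambda>i. \<Sum>j<r. c j * v j i) = (\<Sum>j<r. c j * of_bool (k = j))"
    unfolding inner_n_linear using assms by (intro sum.cong) (auto simp: orthonormal_n_def)
  then show ?thesis using assms by (simp add: sum_of_bool_mult)
qed

lemma orthonormal_n_combination:
  assumes "orthonormal_n n r v"
  shows "norm_n n (\<lambda>i. \<Sum>j<r. c j * v j i) = norm_n r c"
proof (rule power2_eq_imp_eq)
  have "inner_n n (\<lambda>i. \<Sum>j<r. c j * v j i) (\<lambda>i. \<Sum>j<r. c j * v j i) = (\<Sum>k<r. c k * c k)"
    unfolding inner_n_sum_left inner_n_scale_left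
    by (intro sum.cong refl) (simp add: orthonormal_n_coeff[OF assms])
  then show "(norm_n n (\<lambda>i. \<Sum>j<r. c j * v j i))\<^sup>2 = (norm_n r c)\<^sup>2"
    by (simp add: norm_n_sq inner_n_def)
qed auto

text \<open>A one-sided inverse of a square matrix is two-sided. With \<open>P\<close> orthonormal
  and \<open>Q\<close> its transpose, this turns orthonormality into completeness in
  \<open>orthonormal_n_basis\<close>.\<close>

lemma left_inverse_right_inverse:
  fixes P Q :: "nat \<Rightarrow> nat \<Rightarrow> real"
  assumes "\<And>i j. i < n \<Longrightarrow> j < n \<Longrightarrow> (\<Sum>k<n. P i k * Q k j) = of_bool (i = j)"
    and "i < n" "j < n"
  shows "(\<Sum>k<n. Q i k * P k j) = of_bool (i = j)"
proof -
  let ?P = "mat n n (\<lambda>(i, j). P i j)" and ?Q = "mat n n (\<lambda>(i, j). Q i j)"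
  have "?P * ?Q = 1\<^sub>m n"
    by (rule eq_matI) (use assms(1) in \<open>auto simp: scalar_prod_def atLeast0LessThan\<close>)
  then have "?Q * ?P = 1\<^sub>m n"
    by (intro mat_mult_left_right_inverse[of ?P n ?Q]) auto
  then have "(?Q * ?P) $$ (i, j) = (1\<^sub>m n :: real mat) $$ (i, j)" by simp
  then show ?thesis using assms(2,3) by (simp add: scalar_prod_def atLeast0LessThan)
qed

lemma orthonormal_n_basis:
  assumes "orthonormal_n n n v" "i < n"
  shows "(\<Sum>j<n. inner_n n (v j) x * v j i) = x i"
proof -
  have *: "(\<Sum>j<n. v j i * v j k) = of_bool (i = k)" if "k < n" for k
    using left_inverse_right_inverse[of n v "\<lambda>i j. v j i" i k] assms that
    by (auto simp: orthonormal_n_def inner_n_def)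
  have "(\<Sum>j<n. inner_n n (v j) x * v j i) = (\<Sum>k<n. (\<Sum>j<n. v j i * v j k) * x k)"
    unfolding inner_n_def sum_distrib_right by (subst sum.swap) (simp add: ac_simps)
  also have "\<dots> = (\<Sum>k<n. of_bool (i = k) * x k)" by (simp add: *)
  finally show ?thesis using assms by (simp add: sum_of_bool_mult)
qed

lemma orthonormal_n_parseval:
  assumes "orthonormal_n n n v"
  shows "inner_n n x y = (\<Sum>j<n. inner_n n (v j) x * inner_n n (v j) y)"
proof -
  have "inner_n n x y = inner_n n (\<lambda>i. \<Sum>j<n. inner_n n (v j) x * v j i) y"
    by (rule inner_n_cong) (simp_all add: orthonormal_n_basis[OF assms])
  then show ?thesis by (simp add: inner_n_linear)
qed

text \<open>A zero row appended to the equations gives a square matrix that is singular because its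
  transpose annihilates the last unit vector. This is the dimension count behind Gram-Schmidt in
  \<open>symmetric_eigenbasis\<close> and behind the intersection of subspaces in
  \<open>eigenvalue_lower_bound\<close>.\<close>

lemma nontrivial_solution:
  fixes c :: "nat \<Rightarrow> nat \<Rightarrow> real"
  shows "\<exists>x. (\<exists>j<Suc k. x j \<noteq> 0) \<and> (\<forall>l<k. (\<Sum>j<Suc k. c l j * x j) = 0)"
proof -
  let ?C = "mat (Suc k) (Suc k) (\<lambda>(l, j). if l < k then c l j else 0)"
  have C: "?C \<in> carrier_mat (Suc k) (Suc k)" by simp
  have "transpose_mat ?C *\<^sub>v unit_vec (Suc k) k = 0\<^sub>v (Suc k)"
    by (rule eq_vecI) (auto simp: scalar_prod_def intro!: sum.neutral)
  then have "det (transpose_mat ?C) = 0"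
    by (subst det_0_iff_vec_prod_zero_field[of _ "Suc k"])
      (auto intro!: exI[of _ "unit_vec (Suc k) k"] simp: unit_vec_nonzero)
  then have "det ?C = 0" by (simp add: det_transpose[OF C])
  then obtain v where v: "v \<in> carrier_vec (Suc k)" "v \<noteq> 0\<^sub>v (Suc k)" "?C *\<^sub>v v = 0\<^sub>v (Suc k)"
    using det_0_iff_vec_prod_zero_field[OF C] by auto
  have "\<exists>j<Suc k. v $ j \<noteq> 0"
    using v(1,2) by (metis carrier_vecD eq_vecI index_zero_vec(1) index_zero_vec(2))
  moreover have "(\<Sum>j<Suc k. c l j * v $ j) = 0" if "l < k" for l
  proof -
    have "(?C *\<^sub>v v) $ l = 0" using v(3) that by simp
    then show ?thesis using that v(1) by (simp add: scalar_prod_def atLeast0LessThan)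
  qed
  ultimately show ?thesis by blast
qed

text \<open>From the Schur form only a similarity is taken: its columns \<open>p\<close> span an
  invariant flag. Orthonormalising along the flag gives \<open>u\<close>. The residual of
  \<open>u k\<close> in the eigenvalue equation lies in the span of the earlier columns and, by
  symmetry, is orthogonal to them, hence vanishes. The order of \<open>es\<close> is
  preserved.\<close>

lemma symmetric_eigenbasis:
  fixes A :: "real mat"
  assumes A: "A \<in> carrier_mat n n" and sym: "transpose_mat A = A"
    and cp: "char_poly A = (\<Prod>e\<leftarrow>es. [:- e, 1:])"
  obtains u where "orthonormal_n n n u"
    "\<And>j i. j < n \<Longrightarrow> i < n \<Longrightarrow> mul_n n (\<lambda>i k. A $$ (i, k)) (u j) i = es ! j * u j i"
proof -
  obtain B P Q where "schur_decomposition A es = (B, P, Q)" by (metis prod_cases3)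
  from schur_decomposition[OF A cp this]
  have wit: "similar_mat_wit A B P Q" and ut: "upper_triangular B" and diag: "diag_mat B = es" by auto
  from similar_mat_witD2[OF A wit]
  have PQ: "P * Q = 1\<^sub>m n" "Q * P = 1\<^sub>m n" and APBQ: "A = P * B * Q"
    and B: "B \<in> carrier_mat n n" and P: "P \<in> carrier_mat n n" and Q: "Q \<in> carrier_mat n n" by auto
  have AP: "A * P = P * B"
  proof -
    have "A * P = (P * B) * (Q * P)"
      unfolding APBQ using B P Q by (intro assoc_mult_mat[of _ n n _ n _ n]) auto
    then show ?thesis using PQ B P by (simp add: right_mult_one_mat[of _ n n])
  qed
  define a where "a = (\<lambda>i k. A $$ (i, k))"
  define p where "p j i = P $$ (i, j)" for j i
  have asym: "a i k = a k i" if "i < n" "k < n" for i k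
    using sym A that unfolding a_def by (metis carrier_matD index_transpose_mat(1))
  have es: "es ! j = B $$ (j, j)" if "j < n" for j
    using that B unfolding diag[symmetric] by (simp add: diag_mat_def)
  have ap: "mul_n n a (p j) i = (\<Sum>l<Suc k. B $$ (l, j) * p l i)" if "j \<le> k" "k < n" "i < n" for i j k
  proof -
    have "(A * P) $$ (i, j) = (P * B) $$ (i, j)" by (simp add: AP)
    then have "mul_n n a (p j) i = (\<Sum>l<n. B $$ (l, j) * p l i)"
      using A B P that by (simp add: mul_n_def a_def p_def scalar_prod_def atLeast0LessThan mult.commute)
    also have "\<dots> = (\<Sum>l<Suc k. B $$ (l, j) * p l i)"
    proof (rule sum.mono_neutral_right)
      show "\<forall>l\<in>{..<n} - {..<Suc k}. B $$ (l, j) * p l i = 0"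
        using ut B that by (auto simp: upper_triangular_def)
    qed (use that in auto)
    finally show ?thesis .
  qed
  have indep: "c j = 0" if "\<And>i. i < n \<Longrightarrow> (\<Sum>j<Suc k. c j * p j i) = 0" "k < n" "j < Suc k" for c k j
  proof -
    have "(\<Sum>i<n. Q $$ (j, i) * (\<Sum>l<Suc k. c l * p l i)) = (\<Sum>l<Suc k. c l * (\<Sum>i<n. Q $$ (j, i) * P $$ (i, l)))"
      unfolding sum_distrib_left p_def by (subst sum.swap) (simp add: ac_simps)
    also have "\<dots> = (\<Sum>l<Suc k. c l * of_bool (j = l))"
    proof (intro sum.cong refl)
      fix l assume l: "l \<in> {..<Suc k}"
      have "(Q * P) $$ (j, l) = (1\<^sub>m n :: real mat) $$ (j, l)" by (simp add: PQ)
      then show "c l * (\<Sum>i<n. Q $$ (j, i) * P $$ (i, l)) = c l * of_bool (j = l)"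
        using P Q that l by (simp add: scalar_prod_def atLeast0LessThan)
    qed
    also have "\<dots> = c j" using that by (intro sum_of_bool_mult) auto
    finally show ?thesis using that by simp
  qed
  \<comment> \<open>There is one more coefficient than there are orthogonality conditions;
    \<open>indep\<close> ensures that the combination found is not zero and can be
    normalised.\<close>
  have "\<exists>c. norm_n n (\<lambda>i. \<Sum>j<Suc k. c j * p j i) = 1 \<and>
            (\<forall>l<k. inner_n n (p l) (\<lambda>i. \<Sum>j<Suc k. c j * p j i) = 0)" if k: "k < n" for k
  proof -
    obtain c where c: "\<exists>j<Suc k. c j \<noteq> 0"
      "\<forall>l<k. (\<Sum>j<Suc k. inner_n n (p l) (p j) * c j) = 0"
      using nontrivial_solution[of k "\<lambda>l j. inner_n n (p l) (p j)"] by blast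
    define x where "x = (\<lambda>i. \<Sum>j<Suc k. c j * p j i)"
    define m where "m = norm_n n x"
    have m: "m \<noteq> 0"
      using indep[where c = c and k = k] c(1) k unfolding m_def norm_n_eq_0 x_def by blast
    have o: "inner_n n (p l) x = 0" if "l < k" for l
      using c(2) that unfolding x_def inner_n_linear by (simp add: mult.commute)
    define d where "d j = (1 / m) * c j" for j
    have d: "(\<lambda>i. \<Sum>j<Suc k. d j * p j i) = (\<lambda>i. (1 / m) * x i)"
      unfolding x_def d_def sum_distrib_left by (simp add: ac_simps)
    have "norm_n n (\<lambda>i. \<Sum>j<Suc k. d j * p j i) = 1"
      unfolding d norm_n_scale using m norm_n_nonneg[of n x] by (simp add: m_def)
    moreover have "inner_n n (p l) (\<lambda>i. \<Sum>j<Suc k. d j * p j i) = 0" if "l < k" for l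
      unfolding d inner_n_scale_right using o[OF that] by simp
    ultimately show ?thesis by blast
  qed
  then have "\<forall>k. \<exists>c. k < n \<longrightarrow> norm_n n (\<lambda>i. \<Sum>j<Suc k. c j * p j i) = 1 \<and>
            (\<forall>l<k. inner_n n (p l) (\<lambda>i. \<Sum>j<Suc k. c j * p j i) = 0)" by blast
  from choice[OF this]
  obtain c where c: "\<And>k. k < n \<Longrightarrow> norm_n n (\<lambda>i. \<Sum>j<Suc k. c k j * p j i) = 1"
      "\<And>k l. k < n \<Longrightarrow> l < k \<Longrightarrow> inner_n n (p l) (\<lambda>i. \<Sum>j<Suc k. c k j * p j i) = 0"
    by blast
  define u where "u k = (\<lambda>i. \<Sum>j<Suc k. c k j * p j i)" for k
  have u1: "inner_n n (u k) (u k) = 1" if "k < n" for k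
    using c(1)[OF that] by (simp add: u_def norm_n_sq[symmetric])
  have pu: "inner_n n (p l) (u k) = 0" if "k < n" "l < k" for k l
    using c(2)[OF that] by (simp only: u_def)
  have u0: "inner_n n (u l) (u k) = 0" if "k < n" "l < k" for k l
    unfolding u_def[of l] inner_n_linear using that by (intro sum.neutral) (auto simp: pu)
  have "orthonormal_n n n u"
    unfolding orthonormal_n_def
  proof (intro allI impI)
    fix j k assume "j < n" "k < n"
    then show "inner_n n (u j) (u k) = of_bool (j = k)"
      using u1[of j] u0[of j k] u0[of k j] inner_n_commute[of n "u j" "u k"]
      by (cases j k rule: linorder_cases) auto
  qed
  moreover have "mul_n n a (u k) i = es ! k * u k i" if k: "k < n" and i: "i < n" for k i
  proof -
    define d where "d = (\<lambda>i. mul_n n a (u k) i - es ! k * u k i)"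
    define e where "e l = (\<Sum>j<Suc k. c k j * B $$ (l, j)) - es ! k * c k l" for l
    have dl: "inner_n n (p l) d = 0" if l: "l < k" for l
    proof -
      have "inner_n n (p l) (mul_n n a (u k)) = inner_n n (mul_n n a (p l)) (u k)"
        by (rule mul_n_symmetric) (rule asym)
      also have "\<dots> = inner_n n (\<lambda>i. \<Sum>j<Suc l. B $$ (j, l) * p j i) (u k)"
        by (rule inner_n_cong) (use ap[of l l] l k in auto)
      also have "\<dots> = 0" unfolding inner_n_linear using l k by (intro sum.neutral) (auto simp: pu)
      finally show ?thesis unfolding d_def inner_n_linear using pu[OF k l] by simp
    qed
    have de: "d i = (\<Sum>l<k. e l * p l i)" if i: "i < n" for i
    proof -
      have "mul_n n a (u k) i = (\<Sum>j<Suc k. c k j * mul_n n a (p j) i)"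
        unfolding u_def mul_n_sum mul_n_scale ..
      also have "\<dots> = (\<Sum>j<Suc k. c k j * (\<Sum>l<Suc k. B $$ (l, j) * p l i))"
        using k i by (intro sum.cong refl arg_cong2[where f="(*)"] ap) auto
      also have "\<dots> = (\<Sum>l<Suc k. (\<Sum>j<Suc k. c k j * B $$ (l, j)) * p l i)"
        unfolding sum_distrib_left sum_distrib_right by (subst sum.swap) (simp only: ac_simps)
      moreover have "(\<Sum>l<Suc k. e l * p l i)
          = (\<Sum>l<Suc k. (\<Sum>j<Suc k. c k j * B $$ (l, j)) * p l i) - es ! k * u k i"
        unfolding e_def u_def left_diff_distrib sum_subtractf sum_distrib_left[of "es ! k"]
        by (simp only: mult.assoc)
      ultimately have "d i = (\<Sum>l<Suc k. e l * p l i)"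
        unfolding d_def by simp
      \<comment> \<open>Triangularity leaves only j = k in the coefficient of \<open>p k\<close>,
        and that diagonal entry is the eigenvalue. So the residual stays in the span of the earlier
        columns.\<close>
      moreover have "e k = 0"
      proof -
        have "(\<Sum>j<Suc k. c k j * B $$ (k, j)) = c k k * B $$ (k, k)"
          using ut B k by (simp add: upper_triangular_def)
        then show ?thesis unfolding e_def using es[OF k] by simp
      qed
      ultimately show ?thesis by simp
    qed
    have "inner_n n d d = inner_n n (\<lambda>i. \<Sum>l<k. e l * p l i) d"
      by (rule inner_n_cong) (simp_all add: de)
    also have "\<dots> = 0" unfolding inner_n_linear by (intro sum.neutral) (auto simp: dl)
    finally have "norm_n n d = 0" by (simp add: norm_n_sq[symmetric])
    then show ?thesis using i unfolding norm_n_eq_0 d_def by auto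
  qed
  ultimately show ?thesis using that unfolding a_def by blast
qed

text \<open>A Courant--Fischer bound: the test subspace meets the span of the eigenvectors
  \<open>u k, \<dots>, u (n - 1)\<close>.\<close>

lemma eigenvalue_lower_bound:
  assumes u: "orthonormal_n n n u" "\<And>j i. j < n \<Longrightarrow> i < n \<Longrightarrow> mul_n n B (u j) i = \<mu> j * u j i"
    and mono: "\<And>j. k \<le> j \<Longrightarrow> j < n \<Longrightarrow> \<mu> j \<le> \<mu> k"
    and v: "orthonormal_n n (Suc k) v"
    and lower: "\<And>c. \<tau> * inner_n (Suc k) c c
      \<le> inner_n n (\<lambda>i. \<Sum>j<Suc k. c j * v j i) (mul_n n B (\<lambda>i. \<Sum>j<Suc k. c j * v j i))"
    and "k < n"
  shows "\<tau> \<le> \<mu> k"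
proof -
  obtain c where c: "\<exists>j<Suc k. c j \<noteq> 0" "\<forall>l<k. (\<Sum>j<Suc k. inner_n n (u l) (v j) * c j) = 0"
    using nontrivial_solution[of k "\<lambda>l j. inner_n n (u l) (v j)"] by blast
  define x where "x = (\<lambda>i. \<Sum>j<Suc k. c j * v j i)"
  have ux: "inner_n n (u l) x = 0" if "l < k" for l
    using c(2) that unfolding x_def inner_n_linear by (simp add: mult.commute)
  have xx: "inner_n n x x = inner_n (Suc k) c c"
    using orthonormal_n_combination[OF v, of c] by (simp add: x_def norm_n_sq[symmetric])
  have uBx: "inner_n n (u l) (mul_n n B x) = \<mu> l * inner_n n (u l) x" if l: "l < n" for l
  proof -
    have "inner_n n (u l) (mul_n n B x) = inner_n n (u l) (mul_n n B (\<lambda>i. \<Sum>j<n. inner_n n (u j) x * u j i))"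
      by (intro inner_n_cong refl arg_cong2[where f="mul_n n B"] fun_cong[where f="mul_n n B _"] mul_n_cong)
        (simp_all add: orthonormal_n_basis[OF u(1)])
    also have "\<dots> = inner_n n (u l) (\<lambda>i. \<Sum>j<n. (inner_n n (u j) x * \<mu> j) * u j i)"
      by (intro inner_n_cong refl) (auto simp: mul_n_sum mul_n_scale u(2) intro!: sum.cong)
    also have "\<dots> = inner_n n (u l) x * \<mu> l" by (rule orthonormal_n_coeff[OF u(1) l])
    finally show ?thesis by simp
  qed
  have "\<tau> * inner_n (Suc k) c c \<le> inner_n n x (mul_n n B x)"
    unfolding x_def by (rule lower)
  also have "\<dots> = (\<Sum>l<n. inner_n n (u l) x * (\<mu> l * inner_n n (u l) x))"
    unfolding orthonormal_n_parseval[OF u(1), of x] using uBx by (intro sum.cong) auto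
  also have "\<dots> \<le> (\<Sum>l<n. \<mu> k * (inner_n n (u l) x * inner_n n (u l) x))"
  proof (rule sum_mono)
    fix l assume "l \<in> {..<n}"
    then have "l < k \<or> \<mu> l \<le> \<mu> k" using mono[of l] by (cases "l < k") auto
    then show "inner_n n (u l) x * (\<mu> l * inner_n n (u l) x) \<le> \<mu> k * (inner_n n (u l) x * inner_n n (u l) x)"
      using mult_right_mono[of "\<mu> l" "\<mu> k" "inner_n n (u l) x * inner_n n (u l) x"]
      by (auto simp: ux algebra_simps)
  qed
  also have "\<dots> = \<mu> k * inner_n (Suc k) c c"
    unfolding sum_distrib_left[symmetric] orthonormal_n_parseval[OF u(1), of x, symmetric] by (simp add: xx)
  finally have "\<tau> * inner_n (Suc k) c c \<le> \<mu> k * inner_n (Suc k) c c" .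
  moreover have "inner_n (Suc k) c c > 0"
    using c(1) norm_n_eq_0[of "Suc k" c] norm_n_sq[of "Suc k" c]
    by (metis norm_n_nonneg order_le_less zero_less_power)
  ultimately show ?thesis by simp
qed

text \<open>A trivial kernel makes the determinant nonzero. Applied to the overlaps of
  \<open>v\<close> and \<open>vh\<close>, it produces the graph basis of the perturbed
  subspace.\<close>

lemma right_inverse_exists:
  fixes G :: "nat \<Rightarrow> nat \<Rightarrow> real"
  assumes inj: "\<And>c. (\<And>k. k < r \<Longrightarrow> (\<Sum>l<r. G k l * c l) = 0) \<Longrightarrow> (\<And>l. l < r \<Longrightarrow> c l = 0)"
  shows "\<exists>T. \<forall>k<r. \<forall>j<r. (\<Sum>l<r. G k l * T l j) = of_bool (k = j)"
proof -
  let ?G = "mat r r (\<lambda>(k, l). G k l)"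
  have G: "?G \<in> carrier_mat r r" by simp
  have "det ?G \<noteq> 0"
  proof
    assume "det ?G = 0"
    then obtain c where c: "c \<in> carrier_vec r" "c \<noteq> 0\<^sub>v r" "?G *\<^sub>v c = 0\<^sub>v r"
      using det_0_iff_vec_prod_zero_field[OF G] by auto
    have "(\<Sum>l<r. G k l * c $ l) = 0" if "k < r" for k
    proof -
      have "(?G *\<^sub>v c) $ k = 0" using c(3) that by simp
      then show ?thesis using that c(1) by (simp add: scalar_prod_def atLeast0LessThan)
    qed
    then have "c $ l = 0" if "l < r" for l using inj[of "\<lambda>l. c $ l"] that by blast
    then have "c = 0\<^sub>v r" using c(1) by (intro eq_vecI) auto
    then show False using c(2) by simp
  qed
  then obtain T where T: "T \<in> carrier_mat r r" "?G * T = 1\<^sub>m r"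
    using det_non_zero_imp_unit[OF G] unfolding Units_def ring_mat_def by auto
  show ?thesis
  proof (intro exI[of _ "\<lambda>l j. T $$ (l, j)"] allI impI)
    fix k j assume kj: "k < r" "j < r"
    have "(?G * T) $$ (k, j) = (1\<^sub>m r :: real mat) $$ (k, j)" by (simp add: T)
    then show "(\<Sum>l<r. G k l * T $$ (l, j)) = of_bool (k = j)"
      using kj T(1) by (simp add: scalar_prod_def atLeast0LessThan)
  qed
qed

section \<open>Unperturbed matrix: complementary projection, coercivity and reduced
  resolvent\<close>

locale gapped_eigenbasis =
  fixes n r :: nat and A :: "nat \<Rightarrow> nat \<Rightarrow> real" and v :: "nat \<Rightarrow> nat \<Rightarrow> real"
    and lam :: "nat \<Rightarrow> real" and g :: real
  assumes A_sym: "\<And>i k. i < n \<Longrightarrow> k < n \<Longrightarrow> A i k = A k i"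
    and v: "orthonormal_n n n v"
    and eig: "\<And>j i. j < n \<Longrightarrow> i < n \<Longrightarrow> mul_n n A (v j) i = lam j * v j i"
    and r: "0 < r" "r < n"
    and lam_gap: "\<And>j k. j < r \<Longrightarrow> r \<le> k \<Longrightarrow> k < n \<Longrightarrow> lam k + g \<le> lam j"
    and g: "0 < g"
begin

text \<open>This is I - V1 V1^T = V2 V2^T. Writing it by subtraction of the first \<open>r\<close>
  components makes \<open>P_id\<close> an equality of functions.\<close>

definition P :: "(nat \<Rightarrow> real) \<Rightarrow> nat \<Rightarrow> real" where
  "P x = (\<lambda>i. x i - (\<Sum>k<r. inner_n n (v k) x * v k i))"

lemma v_r: "orthonormal_n n r v"
  using v r by (simp add: orthonormal_n_def)

lemma P_orth: "k < r \<Longrightarrow> inner_n n (v k) (P x) = 0"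
  unfolding P_def inner_n_diff_right using orthonormal_n_coeff[OF v_r] by simp

lemma P_id: "(\<And>k. k < r \<Longrightarrow> inner_n n (v k) x = 0) \<Longrightarrow> P x = x"
  by (simp add: P_def)

lemma P_add: "P (\<lambda>i. x i + y i) = (\<lambda>i. P x i + P y i)"
  and P_scale: "P (\<lambda>i. c * x i) = (\<lambda>i. c * P x i)"
  by (simp_all add: P_def inner_n_linear algebra_simps sum.distrib sum_subtractf sum_distrib_left)

lemma P_sum: "P (\<lambda>i. \<Sum>j\<in>J. x j i) = (\<lambda>i. \<Sum>j\<in>J. P (x j) i)"
  unfolding P_def inner_n_linear sum_subtractf sum_distrib_right by (subst sum.swap) simp

lemma P_cong: "(\<And>i. i < n \<Longrightarrow> x i = y i) \<Longrightarrow> i < n \<Longrightarrow> P x i = P y i"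
proof -
  assume "\<And>i. i < n \<Longrightarrow> x i = y i" "i < n"
  moreover from this have "inner_n n (v k) x = inner_n n (v k) y" for k by (intro inner_n_cong) auto
  ultimately show ?thesis by (simp add: P_def)
qed

text \<open>\<open>P\<close> is a self-adjoint idempotent. The version with two different vectors is
  what the factorisation of I - S^2 in \<open>row_bound\<close> requires.\<close>

lemma pythagoras: "inner_n n x y = inner_n n (P x) (P y) + (\<Sum>k<r. inner_n n (v k) x * inner_n n (v k) y)"
proof -
  have "inner_n n (P x) (P y) = inner_n n x (P y)"
    unfolding P_def[of x] inner_n_linear using P_orth[of _ y] by simp
  also have "\<dots> = inner_n n x y - (\<Sum>k<r. inner_n n (v k) x * inner_n n (v k) y)"
    unfolding P_def inner_n_linear by (simp add: inner_n_commute mult.commute)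
  finally show ?thesis by simp
qed

lemma norm_P: "norm_n n (P x) \<le> norm_n n x"
proof (rule power2_le_imp_le)
  have "0 \<le> (\<Sum>k<r. inner_n n (v k) x * inner_n n (v k) x)" by (intro sum_nonneg) simp
  then show "(norm_n n (P x))\<^sup>2 \<le> (norm_n n x)\<^sup>2"
    unfolding norm_n_sq pythagoras[of x x] by linarith
qed simp

lemma bessel: "norm_n r (\<lambda>k. inner_n n (v k) x) \<le> norm_n n x"
proof (rule power2_le_imp_le)
  show "(norm_n r (\<lambda>k. inner_n n (v k) x))\<^sup>2 \<le> (norm_n n x)\<^sup>2"
    unfolding norm_n_sq pythagoras[of x x] inner_n_def[of r] using inner_n_self_nonneg[of n "P x"] by linarith
qed simp

lemma inner_v_A: "j < n \<Longrightarrow> inner_n n (v j) (mul_n n A x) = lam j * inner_n n (v j) x"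
proof -
  assume j: "j < n"
  have "inner_n n (v j) (mul_n n A x) = inner_n n (mul_n n A (v j)) x"
    by (rule mul_n_symmetric) (rule A_sym)
  also have "\<dots> = inner_n n (\<lambda>i. lam j * v j i) x" by (rule inner_n_cong) (use eig j in auto)
  finally show ?thesis by (simp add: inner_n_linear)
qed

lemma P_A: "i < n \<Longrightarrow> P (mul_n n A x) i = mul_n n A (P x) i"
  unfolding P_def mul_n_diff mul_n_sum mul_n_scale using r by (simp add: inner_v_A eig ac_simps)

lemma quadratic_upper:
  assumes "\<And>k. k < r \<Longrightarrow> inner_n n (v k) z = 0" "\<And>k. r \<le> k \<Longrightarrow> k < n \<Longrightarrow> lam k \<le> b"
  shows "inner_n n z (mul_n n A z) \<le> b * inner_n n z z"
proof -
  have "inner_n n z (mul_n n A z) = (\<Sum>j<n. inner_n n (v j) z * (lam j * inner_n n (v j) z))"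
    unfolding orthonormal_n_parseval[OF v, of z] by (intro sum.cong) (auto simp: inner_v_A)
  also have "\<dots> \<le> (\<Sum>j<n. b * (inner_n n (v j) z * inner_n n (v j) z))"
  proof (rule sum_mono)
    fix j assume "j \<in> {..<n}"
    then have "j < r \<or> lam j \<le> b" using assms(2)[of j] by (cases "j < r") auto
    then show "inner_n n (v j) z * (lam j * inner_n n (v j) z) \<le> b * (inner_n n (v j) z * inner_n n (v j) z)"
      using mult_right_mono[of "lam j" b "inner_n n (v j) z * inner_n n (v j) z"] assms(1)
      by (auto simp: algebra_simps)
  qed
  also have "\<dots> = b * inner_n n z z"
    unfolding sum_distrib_left[symmetric] orthonormal_n_parseval[OF v, of z, symmetric] by simp
  finally show ?thesis .
qed

text \<open>On the complement of the first \<open>r\<close> eigenvectors, m - A is at least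
  \<open>c\<close> as a quadratic form, and Cauchy-Schwarz turns this into a bound on its inverse.
  The shift \<open>m\<close> is free because it is taken at unperturbed as well as at perturbed
  eigenvalues.\<close>

lemma sylvester_lower_bound:
  assumes "\<And>k. k < r \<Longrightarrow> inner_n n (v k) z = 0" "\<And>k. r \<le> k \<Longrightarrow> k < n \<Longrightarrow> lam k + c \<le> m" "0 < c"
  shows "c * norm_n n z \<le> norm_n n (\<lambda>i. m * z i - mul_n n A z i)"
proof -
  have "inner_n n z (mul_n n A z) \<le> (m - c) * inner_n n z z"
    by (rule quadratic_upper[OF assms(1)]) (use assms(2) in \<open>simp_all add: le_diff_eq\<close>)
  then have "c * inner_n n z z \<le> inner_n n z (\<lambda>i. m * z i - mul_n n A z i)"
    by (simp add: inner_n_linear algebra_simps)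
  also have "\<dots> \<le> norm_n n (\<lambda>i. m * z i - mul_n n A z i) * norm_n n z"
    using inner_n_le[of n z "\<lambda>i. m * z i - mul_n n A z i"] by (simp add: mult.commute)
  finally have "inner_n n z z \<le> (norm_n n (\<lambda>i. m * z i - mul_n n A z i) / c) * norm_n n z"
    using assms(3) by (simp add: field_simps)
  then have "norm_n n z \<le> norm_n n (\<lambda>i. m * z i - mul_n n A z i) / c"
    by (rule norm_n_le_of_inner) (use assms(3) in simp)
  then show ?thesis using assms(3) by (simp add: field_simps)
qed

text \<open>The reduced resolvent of \<open>A\<close> at \<open>lam j\<close>, restricted to the span of \<open>v r, \<dots>, v (n - 1)\<close>.\<close>

definition R :: "nat \<Rightarrow> nat \<Rightarrow> nat \<Rightarrow> real" where
  "R j a b = (\<Sum>k\<in>{r..<n}. v k a * v k b / (lam j - lam k))"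

lemma R_apply: "mul_n n (R j) x = (\<lambda>i. \<Sum>k<n. (if k < r then 0 else inner_n n (v k) x / (lam j - lam k)) * v k i)"
proof
  fix i
  have "mul_n n (R j) x i = (\<Sum>k\<in>{r..<n}. inner_n n (v k) x / (lam j - lam k) * v k i)"
    unfolding mul_n_def R_def inner_n_def sum_distrib_right sum_distrib_left sum_divide_distrib
    by (subst sum.swap) (simp add: field_simps)
  also have "\<dots> = (\<Sum>k<n. (if k < r then 0 else inner_n n (v k) x / (lam j - lam k)) * v k i)"
    by (rule sum.mono_neutral_cong_left) auto
  finally show "mul_n n (R j) x i = (\<Sum>k<n. (if k < r then 0 else inner_n n (v k) x / (lam j - lam k)) * v k i)" .
qed

lemma R_orth: "k < r \<Longrightarrow> inner_n n (v k) (mul_n n (R j) x) = 0"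
  unfolding R_apply using orthonormal_n_coeff[OF v, of k] r by simp

lemma R_resolvent:
  assumes "j < r" "i < n"
  shows "lam j * mul_n n (R j) x i - mul_n n A (mul_n n (R j) x) i = P x i"
proof -
  let ?c = "\<lambda>k. if k < r then 0 else inner_n n (v k) x / (lam j - lam k)"
  have "lam j * mul_n n (R j) x i - mul_n n A (mul_n n (R j) x) i
      = (\<Sum>k<n. lam j * (?c k * v k i) - ?c k * (lam k * v k i))"
    unfolding R_apply mul_n_sum mul_n_scale sum_distrib_left sum_subtractf
    using assms by (simp add: eig)
  also have "\<dots> = (\<Sum>k<n. inner_n n (v k) x * v k i - (if k < r then inner_n n (v k) x * v k i else 0))"
  proof (intro sum.cong refl)
    fix k assume "k \<in> {..<n}"
    then have "k < r \<or> lam j - lam k > 0" using lam_gap[OF assms(1), of k] g by (cases "k < r") auto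
    then show "lam j * (?c k * v k i) - ?c k * (lam k * v k i)
        = inner_n n (v k) x * v k i - (if k < r then inner_n n (v k) x * v k i else 0)"
      by (auto simp: field_simps)
  qed
  also have "\<dots> = x i - (\<Sum>k<r. inner_n n (v k) x * v k i)"
  proof -
    have "(\<Sum>k<n. if k < r then inner_n n (v k) x * v k i else 0) = (\<Sum>k<r. inner_n n (v k) x * v k i)"
      using r by (intro sum.mono_neutral_cong_right) auto
    then show ?thesis unfolding sum_subtractf orthonormal_n_basis[OF v assms(2)] by simp
  qed
  finally show ?thesis by (simp add: P_def)
qed

lemma R_norm:
  assumes "j < r" shows "norm_n n (mul_n n (R j) x) \<le> norm_n n x / g"
proof -
  have "g * norm_n n (mul_n n (R j) x) \<le> norm_n n (\<lambda>i. lam j * mul_n n (R j) x i - mul_n n A (mul_n n (R j) x) i)"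
    by (rule sylvester_lower_bound) (use R_orth lam_gap[OF assms] g in auto)
  also have "\<dots> = norm_n n (P x)" by (rule norm_n_cong) (rule R_resolvent[OF assms])
  also have "\<dots> \<le> norm_n n x" by (rule norm_P)
  finally show ?thesis using g by (simp add: field_simps)
qed

end

section \<open>Perturbed invariant subspace: graph representation, Riccati equation and row
  error\<close>

locale perturbed_eigenbasis = gapped_eigenbasis +
  fixes E :: "nat \<Rightarrow> nat \<Rightarrow> real" and e :: real and vh :: "nat \<Rightarrow> nat \<Rightarrow> real" and \<mu> :: "nat \<Rightarrow> real"
    and \<eta> :: real
  assumes E_norm: "\<And>x. norm_n n (mul_n n E x) \<le> e * norm_n n x"
    and e: "0 \<le> e"
    and vh: "orthonormal_n n r vh"
    and vh_eig: "\<And>j i. j < r \<Longrightarrow> i < n \<Longrightarrow> mul_n n A (vh j) i + mul_n n E (vh j) i = \<mu> j * vh j i"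
    and \<mu>: "\<And>j k. j < r \<Longrightarrow> r \<le> k \<Longrightarrow> k < n \<Longrightarrow> lam k + (g - e) \<le> \<mu> j"
    and \<eta>: "\<eta> = 2 * e * sqrt (real r) / g" "\<eta> \<le> 1 / 2"
begin

definition ran :: "(nat \<Rightarrow> real) set" where
  "ran = {x. \<exists>c. \<forall>i<n. x i = (\<Sum>j<r. c j * vh j i)}"

lemma ranI: "(\<And>i. i < n \<Longrightarrow> x i = (\<Sum>j<r. c j * vh j i)) \<Longrightarrow> x \<in> ran"
  unfolding ran_def by blast

lemma \<eta>_nonneg: "0 \<le> \<eta>" using \<eta> e g by simp

lemma e_small: "e \<le> g / 4"
proof -
  have "e \<le> e * sqrt (real r)" using mult_left_mono[of 1 "sqrt (real r)" e] e r by simp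
  moreover have "\<eta> * g \<le> (1 / 2) * g" using \<eta>(2) g by (intro mult_right_mono) auto
  then have "e * sqrt (real r) \<le> g / 4" using \<eta>(1) g by simp
  ultimately show ?thesis by simp
qed

text \<open>Davis-Kahan for one eigenvector: \<open>P\<close> commutes with \<open>A\<close>, so
  projecting the eigenvalue equation gives (\<mu> - A) P vh = P E vh. The factor 2 comes from g - e
  >= g / 2.\<close>

lemma P_vh: assumes j: "j < r" shows "norm_n n (P (vh j)) \<le> 2 * e / g"
proof -
  have eq: "\<mu> j * P (vh j) i - mul_n n A (P (vh j)) i = P (mul_n n E (vh j)) i" if "i < n" for i
  proof -
    have "P (\<lambda>i. \<mu> j * vh j i) i = P (\<lambda>i. mul_n n A (vh j) i + mul_n n E (vh j) i) i"
      by (rule P_cong) (use j vh_eig that in auto)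
    then show ?thesis unfolding P_add P_scale using P_A[OF that] by simp
  qed
  have "(g - e) * norm_n n (P (vh j)) \<le> norm_n n (\<lambda>i. \<mu> j * P (vh j) i - mul_n n A (P (vh j)) i)"
    by (rule sylvester_lower_bound) (use P_orth \<mu>[OF j] g e_small in auto)
  also have "\<dots> = norm_n n (P (mul_n n E (vh j)))" by (rule norm_n_cong) (rule eq)
  also have "\<dots> \<le> e * norm_n n (vh j)" using norm_P E_norm order_trans by blast
  also have "norm_n n (vh j) = 1" using vh j by (rule orthonormal_n_norm)
  finally have "(g - e) * norm_n n (P (vh j)) \<le> e" by simp
  moreover have "(g / 2) * norm_n n (P (vh j)) \<le> (g - e) * norm_n n (P (vh j))"
    using e_small g by (intro mult_right_mono) auto
  ultimately show ?thesis using g by (simp add: field_simps)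
qed

text \<open>Passing from the basis vectors to the whole subspace uses Cauchy-Schwarz over the
  \<open>r\<close> coefficients, which is the origin of sqrt r in \<open>\<eta>\<close>.\<close>

lemma P_ran: assumes "x \<in> ran" shows "norm_n n (P x) \<le> \<eta> * norm_n n x"
proof -
  obtain c where c: "\<And>i. i < n \<Longrightarrow> x i = (\<Sum>j<r. c j * vh j i)" using assms by (auto simp: ran_def)
  have "norm_n n (P x) = norm_n n (\<lambda>i. \<Sum>j<r. c j * P (vh j) i)"
    by (rule norm_n_cong) (use P_cong[of x "\<lambda>i. \<Sum>j<r. c j * vh j i"] c in \<open>simp add: P_sum P_scale\<close>)
  also have "\<dots> \<le> (\<Sum>j<r. norm_n n (\<lambda>i. c j * P (vh j) i))" by (rule norm_n_sum)
  also have "\<dots> \<le> (\<Sum>j<r. \<bar>c j\<bar> * \<bar>2 * e / g\<bar>)"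
  proof (rule sum_mono)
    fix j assume "j \<in> {..<r}"
    then have "norm_n n (P (vh j)) \<le> \<bar>2 * e / g\<bar>" using P_vh[of j] abs_ge_self[of "2 * e / g"] by simp
    then show "norm_n n (\<lambda>i. c j * P (vh j) i) \<le> \<bar>c j\<bar> * \<bar>2 * e / g\<bar>"
      unfolding norm_n_scale by (rule mult_left_mono) simp
  qed
  also have "\<dots> \<le> norm_n r c * norm_n r (\<lambda>j. 2 * e / g)"
    unfolding norm_n_def by (rule L2_set_mult_ineq)
  also have "\<dots> \<le> norm_n r c * (sqrt (real r) * (2 * e / g))"
    by (intro mult_left_mono norm_n_le_sqrt_bound) (use e g in auto)
  also have "norm_n r c = norm_n n x"
    unfolding orthonormal_n_combination[OF vh, symmetric] by (rule norm_n_cong) (simp add: c)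
  finally show ?thesis by (simp add: \<eta>(1) ac_simps)
qed

lemma ran_combination: "(\<And>j. j \<in> J \<Longrightarrow> x j \<in> ran) \<Longrightarrow> (\<lambda>i. \<Sum>j\<in>J. c j * x j i) \<in> ran"
proof -
  assume "\<And>j. j \<in> J \<Longrightarrow> x j \<in> ran"
  then obtain d where d: "\<And>j i. j \<in> J \<Longrightarrow> i < n \<Longrightarrow> x j i = (\<Sum>l<r. d j l * vh l i)"
    unfolding ran_def mem_Collect_eq by metis
  have "(\<Sum>j\<in>J. c j * x j i) = (\<Sum>l<r. (\<Sum>j\<in>J. c j * d j l) * vh l i)" if "i < n" for i
  proof -
    have "(\<Sum>j\<in>J. c j * x j i) = (\<Sum>j\<in>J. \<Sum>l<r. c j * d j l * vh l i)"
      by (intro sum.cong refl) (simp add: d that sum_distrib_left mult.assoc)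
    also have "\<dots> = (\<Sum>l<r. (\<Sum>j\<in>J. c j * d j l) * vh l i)"
      unfolding sum_distrib_right by (rule sum.swap)
    finally show ?thesis .
  qed
  then show ?thesis by (rule ranI)
qed

lemma ran_diff: "x \<in> ran \<Longrightarrow> y \<in> ran \<Longrightarrow> (\<lambda>i. x i - y i) \<in> ran"
  using ran_combination[of UNIV "\<lambda>b. if b then x else y" "\<lambda>b. if b then 1 else -1"]
  by (simp add: UNIV_bool)

lemma ran_vh: "j < r \<Longrightarrow> vh j \<in> ran"
  unfolding ran_def using sum_of_bool_mult(3)[of j r] by (auto intro!: exI[of _ "\<lambda>k. of_bool (k = j)"])

lemma ran_invariant: "x \<in> ran \<Longrightarrow> (\<lambda>i. mul_n n A x i + mul_n n E x i) \<in> ran"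
proof -
  assume "x \<in> ran"
  then obtain c where c: "\<And>i. i < n \<Longrightarrow> x i = (\<Sum>j<r. c j * vh j i)" by (auto simp: ran_def)
  have "mul_n n A x i + mul_n n E x i = (\<Sum>j<r. (c j * \<mu> j) * vh j i)" if "i < n" for i
  proof -
    have "mul_n n A x i + mul_n n E x i = (\<Sum>j<r. c j * (mul_n n A (vh j) i + mul_n n E (vh j) i))"
      using mul_n_cong[of n x "\<lambda>i. \<Sum>j<r. c j * vh j i"] c
      by (simp add: mul_n_sum mul_n_scale sum.distrib algebra_simps)
    then show ?thesis using vh_eig that by (simp add: ac_simps)
  qed
  then show ?thesis by (rule ranI)
qed

text \<open>Such a vector is fixed by \<open>P\<close>, whereas \<open>P\<close> at least halves the
  norm on \<open>ran\<close>. So a vector of \<open>ran\<close> is determined by its coefficients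
  against \<open>v\<close>; existence of the graph basis and expansion in it both rest on
  this.\<close>

lemma ran_0: assumes "x \<in> ran" "\<And>k. k < r \<Longrightarrow> inner_n n (v k) x = 0" "i < n" shows "x i = 0"
proof -
  have "norm_n n x \<le> \<eta> * norm_n n x" using P_ran[OF assms(1)] P_id[OF assms(2)] by simp
  also have "\<dots> \<le> (1 / 2) * norm_n n x" using \<eta>(2) by (rule mult_right_mono) simp
  finally have "norm_n n x = 0" using norm_n_nonneg[of n x] by linarith
  then show ?thesis using assms(3) by (simp add: norm_n_eq_0)
qed

text \<open>In matrix terms the basis is Vh (V1^T Vh)^(-1). A kernel vector of the overlap matrix
  would give a nonzero vector of \<open>ran\<close> orthogonal to V1, which \<open>ran_0\<close>
  excludes.\<close>

lemma dual_basis_exists: "\<exists>h. \<forall>j<r. h j \<in> ran \<and> (\<forall>k<r. inner_n n (v k) (h j) = of_bool (k = j))"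
proof -
  have "\<exists>T. \<forall>k<r. \<forall>j<r. (\<Sum>l<r. inner_n n (v k) (vh l) * T l j) = of_bool (k = j)"
  proof (rule right_inverse_exists)
    fix c l assume c: "\<And>k. k < r \<Longrightarrow> (\<Sum>l<r. inner_n n (v k) (vh l) * c l) = 0" and l: "l < r"
    let ?x = "\<lambda>i. \<Sum>l<r. c l * vh l i"
    have "?x \<in> ran" by (rule ran_combination) (simp add: ran_vh)
    then have "?x i = 0" if "i < n" for i
      using ran_0[of ?x i] c that by (simp add: inner_n_linear mult.commute)
    then have "norm_n n ?x = 0" by (simp add: norm_n_eq_0)
    then show "c l = 0" using orthonormal_n_combination[OF vh, of c] l by (simp add: norm_n_eq_0)
  qed
  then obtain T where T: "\<forall>k<r. \<forall>j<r. (\<Sum>l<r. inner_n n (v k) (vh l) * T l j) = of_bool (k = j)" ..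
  have "(\<lambda>i. \<Sum>l<r. T l j * vh l i) \<in> ran" for j by (rule ran_combination) (simp add: ran_vh)
  then show ?thesis
    by (intro exI[of _ "\<lambda>j i. \<Sum>l<r. T l j * vh l i"])
      (use T in \<open>simp add: inner_n_linear mult.commute\<close>)
qed

text \<open>\<open>h j\<close> is the vector of the perturbed subspace that projects to \<open>v j\<close>, so the \<open>f j\<close> describe
  this subspace as a graph over the span of \<open>v 0, \<dots>, v (r - 1)\<close>.\<close>

definition h :: "nat \<Rightarrow> nat \<Rightarrow> real" where
  "h = (SOME h. \<forall>j<r. h j \<in> ran \<and> (\<forall>k<r. inner_n n (v k) (h j) = of_bool (k = j)))"

definition f :: "nat \<Rightarrow> nat \<Rightarrow> real" where
  "f j = P (h j)"

lemma h_ran: "j < r \<Longrightarrow> h j \<in> ran"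
  and h_dual: "j < r \<Longrightarrow> k < r \<Longrightarrow> inner_n n (v k) (h j) = of_bool (k = j)"
  using someI_ex[OF dual_basis_exists] unfolding h_def[symmetric] by blast+

lemma h_eq: "j < r \<Longrightarrow> h j i = v j i + f j i"
  by (simp add: f_def P_def h_dual sum_of_bool_mult)

text \<open>||h||^2 = 1 + ||P h||^2 <= 1 + ||h||^2 / 4 by \<open>P_ran\<close>, and the last term is
  absorbed.\<close>

lemma h_norm: assumes "j < r" shows "norm_n n (h j) \<le> 2"
proof -
  have 1: "(norm_n n (h j))\<^sup>2 = (norm_n n (P (h j)))\<^sup>2 + 1"
    unfolding norm_n_sq pythagoras[of "h j" "h j"] using assms by (simp add: h_dual sum_of_bool_mult)
  have "norm_n n (P (h j)) \<le> norm_n n (h j) / 2"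
    using P_ran[OF h_ran[OF assms]] mult_right_mono[OF \<eta>(2) norm_n_nonneg[of n "h j"]] by simp
  then have "(norm_n n (P (h j)))\<^sup>2 \<le> (norm_n n (h j) / 2)\<^sup>2" by (intro power_mono) auto
  then have "(norm_n n (h j))\<^sup>2 \<le> 2\<^sup>2" using 1 by (simp add: power_divide)
  then show ?thesis by (rule power2_le_imp_le) simp
qed

lemma f_norm: assumes "j < r" shows "norm_n n (f j) \<le> 2 * \<eta>"
  using P_ran[OF h_ran[OF assms]] mult_left_mono[OF h_norm[OF assms] \<eta>_nonneg] by (simp add: f_def)

lemma f_orth: "k < r \<Longrightarrow> inner_n n (v k) (f j) = 0"
  by (simp add: f_def P_orth)

lemma ran_expand: assumes x: "x \<in> ran" and i: "i < n"
  shows "x i = (\<Sum>k<r. inner_n n (v k) x * h k i)"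
proof -
  let ?y = "\<lambda>i. \<Sum>k<r. inner_n n (v k) x * h k i"
  have y: "?y \<in> ran" by (rule ran_combination) (simp add: h_ran)
  have "inner_n n (v k) (\<lambda>i. x i - ?y i) = 0" if "k < r" for k
    unfolding inner_n_linear using that by (simp add: h_dual sum_of_bool_mult)
  from ran_0[OF ran_diff[OF x y] this i] show ?thesis by simp
qed

text \<open>By invariance (A + E) h_j is a combination of the \<open>h k\<close>, with coefficients
  <v_k, (A + E) h_j> = lam_k delta_kj + <v_k, E h_j>. Projection by \<open>P\<close> replaces each
  \<open>h k\<close> by \<open>f k\<close>, and the diagonal part of the coefficients leaves just
  lam_j f_j.\<close>

lemma riccati:
  assumes j: "j < r" and i: "i < n"
  shows "lam j * f j i - mul_n n A (f j) i
    = P (mul_n n E (h j)) i - (\<Sum>k<r. inner_n n (v k) (mul_n n E (h j)) * f k i)"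
proof -
  let ?m = "\<lambda>k. inner_n n (v k) (\<lambda>i. mul_n n A (h j) i + mul_n n E (h j) i)"
  have m: "?m k = lam k * of_bool (k = j) + inner_n n (v k) (mul_n n E (h j))" if "k < r" for k
    unfolding inner_n_linear using inner_v_A[of k] h_dual[OF j] that r by simp
  have "P (\<lambda>i. mul_n n A (h j) i + mul_n n E (h j) i) i = P (\<lambda>i. \<Sum>k<r. ?m k * h k i) i"
    by (rule P_cong) (use ran_expand[OF ran_invariant[OF h_ran[OF j]]] i in auto)
  then have "mul_n n A (f j) i + P (mul_n n E (h j)) i = (\<Sum>k<r. ?m k * f k i)"
    unfolding P_add P_sum P_scale using P_A[OF i] by (simp add: f_def)
  also have "\<dots> = (\<Sum>k<r. (lam k * f k i) * of_bool (k = j)) + (\<Sum>k<r. inner_n n (v k) (mul_n n E (h j)) * f k i)"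
    unfolding sum.distrib[symmetric] by (intro sum.cong) (auto simp: m algebra_simps)
  also have "\<dots> = lam j * f j i + (\<Sum>k<r. inner_n n (v k) (mul_n n E (h j)) * f k i)"
    using j by (simp add: sum_of_bool_mult)
  finally show ?thesis by simp
qed

definition w :: "nat \<Rightarrow> nat \<Rightarrow> real" where
  "w j = mul_n n (R j) (mul_n n E (v j))"

lemma inner_v_le: "j < n \<Longrightarrow> \<bar>inner_n n (v j) x\<bar> \<le> norm_n n x"
  using inner_n_le[of n "v j" x] by (simp add: orthonormal_n_norm[OF v])

lemma E_h: "j < r \<Longrightarrow> norm_n n (mul_n n E (h j)) \<le> 2 * e"
  using E_norm[of "h j"] mult_left_mono[OF h_norm e, of j] by linarith

lemma E_f: "j < r \<Longrightarrow> norm_n n (mul_n n E (f j)) \<le> 2 * e * \<eta>"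
  using E_norm[of "f j"] mult_left_mono[OF f_norm e, of j] by linarith

text \<open>\<open>w j\<close> solves the equation with right-hand side P E v_j alone, so the
  difference solves it with the rest: P E f_j contributes 2 e \<eta>, and each of the
  \<open>r\<close> products <v_k, E h_j> f_k contributes 4 e \<eta>.\<close>

lemma f_minus_w:
  assumes j: "j < r"
  shows "norm_n n (\<lambda>i. f j i - w j i) \<le> (2 * e * \<eta> + 4 * real r * e * \<eta>) / g"
proof -
  let ?z = "\<lambda>i. f j i - w j i" and ?s = "\<lambda>i. \<Sum>k<r. inner_n n (v k) (mul_n n E (h j)) * f k i"
  have eq: "lam j * ?z i - mul_n n A ?z i = P (mul_n n E (f j)) i - ?s i" if i: "i < n" for i
  proof -
    have "lam j * ?z i - mul_n n A ?z i = P (mul_n n E (h j)) i - ?s i - P (mul_n n E (v j)) i"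
      using riccati[OF j i] R_resolvent[OF j i, of "mul_n n E (v j)"]
      by (simp add: mul_n_diff w_def right_diff_distrib)
    moreover have "P (mul_n n E (h j)) i = P (mul_n n E (v j)) i + P (mul_n n E (f j)) i"
      using P_add[of "mul_n n E (v j)" "mul_n n E (f j)"] P_cong[of "mul_n n E (h j)" "\<lambda>i. mul_n n E (v j) i + mul_n n E (f j) i" i]
        i mul_n_cong[of n "h j" "\<lambda>i. v j i + f j i" E] h_eq[OF j] by (simp add: mul_n_add)
    ultimately show ?thesis by simp
  qed
  have s: "norm_n n ?s \<le> real r * (2 * e * (2 * \<eta>))"
  proof -
    have "norm_n n ?s \<le> (\<Sum>k<r. norm_n n (\<lambda>i. inner_n n (v k) (mul_n n E (h j)) * f k i))" by (rule norm_n_sum)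
    also have "\<dots> \<le> (\<Sum>k<r. 2 * e * (2 * \<eta>))"
    proof (intro sum_mono)
      fix k assume "k \<in> {..<r}"
      then have "\<bar>inner_n n (v k) (mul_n n E (h j))\<bar> * norm_n n (f k) \<le> (2 * e) * (2 * \<eta>)"
        using inner_v_le[of k "mul_n n E (h j)"] E_h[OF j] f_norm[of k] r e by (intro mult_mono) auto
      then show "norm_n n (\<lambda>i. inner_n n (v k) (mul_n n E (h j)) * f k i) \<le> 2 * e * (2 * \<eta>)"
        by (simp only: norm_n_scale)
    qed
    finally show ?thesis by simp
  qed
  have "g * norm_n n ?z \<le> norm_n n (\<lambda>i. lam j * ?z i - mul_n n A ?z i)"
    by (rule sylvester_lower_bound) (use f_orth R_orth lam_gap[OF j] g in \<open>auto simp: inner_n_linear w_def\<close>)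
  also have "\<dots> = norm_n n (\<lambda>i. P (mul_n n E (f j)) i - ?s i)" by (rule norm_n_cong) (rule eq)
  also have "\<dots> \<le> norm_n n (P (mul_n n E (f j))) + norm_n n ?s" by (rule norm_n_diff)
  also have "\<dots> \<le> 2 * e * \<eta> + 4 * real r * e * \<eta>"
    using norm_P[of "mul_n n E (f j)"] E_f[OF j] s by simp
  finally show ?thesis using g by (simp add: field_simps)
qed

text \<open>The summands are, in order, the entries of E v_j, E w_j and E (f_j - w_j), the part of E
  h_j inside ran V1, and the quadratic Riccati term. \<open>l\<close> and \<open>q\<close> enter as
  hypotheses because the operator norm would bound these entries too coarsely for the rate.\<close>

lemma sylvester_entry_bound:
  assumes j: "j < r" and i: "i < n"
    and Ev: "\<bar>mul_n n E (v j) i\<bar> \<le> l" "\<And>k. k < r \<Longrightarrow> \<bar>inner_n n (v k) (mul_n n E (v j))\<bar> \<le> l"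
    and Ew: "\<bar>mul_n n E (w j) i\<bar> \<le> q"
    and \<kappa>: "norm_n r (\<lambda>k. v k i) \<le> \<kappa>"
  shows "\<bar>lam j * f j i - mul_n n A (f j) i\<bar>
    \<le> l + q + e * ((2 * e * \<eta> + 4 * real r * e * \<eta>) / g) + \<kappa> * (2 * e) + real r * ((l + 2 * e * \<eta>) * (2 * \<eta>))"
proof -
  have hvf: "mul_n n E (h j) = (\<lambda>i. mul_n n E (v j) i + mul_n n E (f j) i)"
    using mul_n_cong[of n "h j" "\<lambda>i. v j i + f j i" E] h_eq[OF j] by (auto simp: mul_n_add)
  have 1: "\<bar>mul_n n E (h j) i\<bar> \<le> l + q + e * ((2 * e * \<eta> + 4 * real r * e * \<eta>) / g)"
  proof -
    have "mul_n n E (h j) i = mul_n n E (v j) i + mul_n n E (w j) i + mul_n n E (\<lambda>i. f j i - w j i) i"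
      by (simp add: hvf mul_n_diff)
    moreover have "\<bar>mul_n n E (\<lambda>i. f j i - w j i) i\<bar> \<le> e * ((2 * e * \<eta> + 4 * real r * e * \<eta>) / g)"
      using norm_n_component[OF i, of "mul_n n E (\<lambda>i. f j i - w j i)"] E_norm[of "\<lambda>i. f j i - w j i"]
        mult_left_mono[OF f_minus_w[OF j] e] by linarith
    ultimately show ?thesis using Ev(1) Ew by linarith
  qed
  have 2: "\<bar>\<Sum>k<r. inner_n n (v k) (mul_n n E (h j)) * v k i\<bar> \<le> \<kappa> * (2 * e)"
  proof -
    have "\<bar>inner_n r (\<lambda>k. inner_n n (v k) (mul_n n E (h j))) (\<lambda>k. v k i)\<bar>
        \<le> norm_n r (\<lambda>k. inner_n n (v k) (mul_n n E (h j))) * norm_n r (\<lambda>k. v k i)"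
      by (rule inner_n_le)
    also have "\<dots> \<le> (2 * e) * \<kappa>"
      using bessel[of "mul_n n E (h j)"] E_h[OF j] \<kappa> e by (intro mult_mono) auto
    finally show ?thesis by (simp add: inner_n_def mult.commute)
  qed
  \<comment> \<open>The overlaps <v_k, E v_j> are bounded by \<open>l\<close>: bounding them by
    \<open>e\<close> would leave a term e \<eta>, which is quadratic in \<sigma> sqrt n.\<close>
  have 3: "\<bar>\<Sum>k<r. inner_n n (v k) (mul_n n E (h j)) * f k i\<bar> \<le> real r * ((l + 2 * e * \<eta>) * (2 * \<eta>))"
  proof -
    have "\<bar>inner_n n (v k) (mul_n n E (h j)) * f k i\<bar> \<le> (l + 2 * e * \<eta>) * (2 * \<eta>)" if k: "k < r" for k
    proof -
      have "\<bar>inner_n n (v k) (mul_n n E (h j))\<bar> \<le> l + 2 * e * \<eta>"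
        unfolding hvf inner_n_linear
        using Ev(2)[OF k] inner_v_le[of k "mul_n n E (f j)"] E_f[OF j] k r by linarith
      moreover have "\<bar>f k i\<bar> \<le> 2 * \<eta>" using norm_n_component[OF i, of "f k"] f_norm[OF k] by linarith
      ultimately show ?thesis unfolding abs_mult by (intro mult_mono) auto
    qed
    then have "(\<Sum>k<r. \<bar>inner_n n (v k) (mul_n n E (h j)) * f k i\<bar>) \<le> (\<Sum>k<r. (l + 2 * e * \<eta>) * (2 * \<eta>))"
      by (intro sum_mono) auto
    then show ?thesis using sum_abs[of "\<lambda>k. inner_n n (v k) (mul_n n E (h j)) * f k i" "{..<r}"]
      by (simp only: sum_constant card_lessThan)
  qed
  show ?thesis unfolding riccati[OF j i] using 1 2 3 by (simp add: P_def)
qed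

text \<open>With S = V1^T X, the expansion of X in the graph basis reads X = (V1 + F) S, so that X -
  V1 = F S - V1 (I - S). \<open>S\<close> is a contraction; symmetry and positivity force it to be
  within \<eta>^2 of the identity, excluding an X close to V1 times some other orthogonal
  matrix.\<close>

lemma row_bound:
  assumes x: "\<And>j. j < r \<Longrightarrow> x j \<in> ran" "orthonormal_n n r x"
    and S_sym: "\<And>j k. j < r \<Longrightarrow> k < r \<Longrightarrow> inner_n n (v k) (x j) = inner_n n (v j) (x k)"
    and S_pos: "\<And>c. 0 \<le> (\<Sum>k<r. \<Sum>j<r. c k * inner_n n (v k) (x j) * c j)"
    and i: "i < n"
  shows "norm_n r (\<lambda>j. x j i - v j i) \<le> \<eta>\<^sup>2 * norm_n r (\<lambda>k. v k i) + norm_n r (\<lambda>k. f k i)"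
proof -
  define S where "S k j = inner_n n (v k) (x j)" for k j
  define X where "X c = (\<lambda>i. \<Sum>j<r. c j * x j i)" for c
  have Ssym: "S k j = S j k" if "j < r" "k < r" for j k using S_sym that by (simp add: S_def)
  have Sv: "mul_n r S c k = inner_n n (v k) (X c)" for c k
    by (simp add: S_def X_def mul_n_def inner_n_linear mult.commute)
  have Xran: "X c \<in> ran" for c unfolding X_def by (rule ran_combination) (simp add: x)
  have Xnorm: "norm_n n (X c) = norm_n r c" for c
    unfolding X_def by (rule orthonormal_n_combination[OF x(2)])
  have Xinner: "inner_n n (X c) (X d) = inner_n r c d" for c d
  proof -
    have "inner_n n (X c) (X d) = (\<Sum>j<r. c j * inner_n n (x j) (X d))" unfolding X_def[of c] inner_n_linear ..
    also have "\<dots> = (\<Sum>j<r. c j * d j)" by (intro sum.cong) (auto simp: X_def orthonormal_n_coeff[OF x(2)])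
    finally show ?thesis by (simp add: inner_n_def)
  qed
  have S_contr: "norm_n r (mul_n r S c) \<le> norm_n r c" for c
  proof -
    have "mul_n r S c = (\<lambda>k. inner_n n (v k) (X c))" using Sv by blast
    then show ?thesis using bessel[of "X c"] by (simp add: Xnorm)
  qed
  \<comment> \<open>The auxiliary \<open>y\<close> is (I + S)(I - S) z = (I - S^2) z, and I - S^2 =
    (P X)^T (P X) because X has orthonormal columns. Each factor P X contributes one \<eta>.\<close>
  have near_id: "norm_n r (\<lambda>k. z k - mul_n r S z k) \<le> \<eta>\<^sup>2 * norm_n r z" for z
  proof -
    define d where "d = (\<lambda>k. z k - mul_n r S z k)"
    define y where "y = (\<lambda>k. d k + mul_n r S d k)"
    have y: "y k = z k - mul_n r S (mul_n r S z) k" for k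
      unfolding y_def d_def mul_n_diff by simp
    have "inner_n r y y = inner_n r y z - inner_n r (mul_n r S y) (mul_n r S z)"
      using mul_n_symmetric[of r S y "mul_n r S z"] Ssym
      by (subst (2) y[abs_def]) (simp add: inner_n_linear)
    also have "\<dots> = inner_n n (X y) (X z) - (\<Sum>k<r. inner_n n (v k) (X y) * inner_n n (v k) (X z))"
      by (simp add: Xinner Sv inner_n_def[of r "mul_n r S y"])
    also have "\<dots> = inner_n n (P (X y)) (P (X z))" using pythagoras[of "X y" "X z"] by simp
    also have "\<dots> \<le> norm_n n (P (X y)) * norm_n n (P (X z))" using inner_n_le abs_le_D1 by blast
    also have "\<dots> \<le> (\<eta> * norm_n r y) * (\<eta> * norm_n r z)"
      using P_ran[OF Xran[of y]] P_ran[OF Xran[of z]] \<eta>_nonneg by (intro mult_mono) (auto simp: Xnorm)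
    finally have "inner_n r y y \<le> (\<eta>\<^sup>2 * norm_n r z) * norm_n r y" by (simp add: power2_eq_square ac_simps)
    then have ny: "norm_n r y \<le> \<eta>\<^sup>2 * norm_n r z" by (rule norm_n_le_of_inner) simp
    \<comment> \<open>Positivity of \<open>S\<close> makes I + S norm-nondecreasing, so the bound on
      \<open>y\<close> passes to \<open>d\<close>.\<close>
    have "inner_n r d (mul_n r S d) \<ge> 0"
      using S_pos[of d] unfolding inner_n_def[of r] mul_n_def sum_distrib_left S_def
      by (simp only: mult.assoc)
    then have "(norm_n r d)\<^sup>2 \<le> (norm_n r y)\<^sup>2"
      unfolding norm_n_sq y_def inner_n_linear using inner_n_self_nonneg[of r "mul_n r S d"]
        inner_n_commute[of r d "mul_n r S d"] by simp
    then have "norm_n r d \<le> norm_n r y" by (rule power2_le_imp_le) simp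
    with ny show ?thesis unfolding d_def by simp
  qed
  have eq: "x j i - v j i = (mul_n r S (\<lambda>k. f k i) j) - ((\<lambda>k. v k i) j - mul_n r S (\<lambda>k. v k i) j)" if j: "j < r" for j
  proof -
    have "x j i = (\<Sum>k<r. S k j * h k i)" using ran_expand[OF x(1)[OF j] i] by (simp add: S_def)
    also have "\<dots> = (\<Sum>k<r. S j k * f k i + S j k * v k i)"
      using Ssym j by (intro sum.cong) (auto simp: h_eq algebra_simps)
    finally show ?thesis by (simp add: mul_n_def sum.distrib)
  qed
  have "norm_n r (\<lambda>j. x j i - v j i)
      = norm_n r (\<lambda>j. (mul_n r S (\<lambda>k. f k i) j) - ((\<lambda>k. v k i) j - mul_n r S (\<lambda>k. v k i) j))"
    by (rule norm_n_cong) (rule eq)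
  also have "\<dots> \<le> norm_n r (mul_n r S (\<lambda>k. f k i)) + norm_n r (\<lambda>j. (\<lambda>k. v k i) j - mul_n r S (\<lambda>k. v k i) j)"
    by (rule norm_n_diff)
  also have "\<dots> \<le> norm_n r (\<lambda>k. f k i) + \<eta>\<^sup>2 * norm_n r (\<lambda>k. v k i)"
    by (intro add_mono S_contr near_id)
  finally show ?thesis by simp
qed

end

subsection \<open>Matrix norms\<close>

lemma vec_norm2_eq: "vec_norm2 x = norm_n (dim_vec x) (vec_index x)"
  by (simp add: vec_norm2_def norm_n_def)

lemma two_inf_norm_row:
  assumes "i < dim_row B" shows "norm_n (dim_col B) (\<lambda>j. B $$ (i, j)) \<le> two_inf_norm B"
proof -
  have "vec_norm2 (Matrix.row B i) \<le> two_inf_norm B"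
    unfolding two_inf_norm_def using assms by (intro Max_ge) auto
  moreover have "vec_norm2 (Matrix.row B i) = norm_n (dim_col B) (\<lambda>j. B $$ (i, j))"
    unfolding vec_norm2_eq index_row(2) using assms by (intro norm_n_cong) auto
  ultimately show ?thesis by simp
qed

lemma two_inf_norm_le:
  assumes "0 < dim_row B" "\<And>i. i < dim_row B \<Longrightarrow> norm_n (dim_col B) (\<lambda>j. B $$ (i, j)) \<le> c"
  shows "two_inf_norm B \<le> c"
proof -
  have "vec_norm2 (Matrix.row B i) = norm_n (dim_col B) (\<lambda>j. B $$ (i, j))" if "i < dim_row B" for i
    unfolding vec_norm2_eq index_row(2) using that by (intro norm_n_cong) auto
  then show ?thesis unfolding two_inf_norm_def using assms by (subst Max_le_iff) auto
qed

lemma two_inf_norm_nonneg: "0 < dim_row B \<Longrightarrow> 0 \<le> two_inf_norm B"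
  using two_inf_norm_row[of 0 B] norm_n_nonneg order_trans by blast

lemma two_inf_norm_scale_le:
  assumes "0 < dim_row B" shows "two_inf_norm (c \<cdot>\<^sub>m B) \<le> \<bar>c\<bar> * two_inf_norm B"
proof (rule two_inf_norm_le)
  fix i assume i: "i < dim_row (c \<cdot>\<^sub>m B)"
  then have "norm_n (dim_col (c \<cdot>\<^sub>m B)) (\<lambda>j. (c \<cdot>\<^sub>m B) $$ (i, j)) = norm_n (dim_col B) (\<lambda>j. c * B $$ (i, j))"
    by (auto intro!: norm_n_cong)
  also have "\<dots> \<le> \<bar>c\<bar> * two_inf_norm B"
    unfolding norm_n_scale using two_inf_norm_row[of i B] i by (intro mult_left_mono) auto
  finally show "norm_n (dim_col (c \<cdot>\<^sub>m B)) (\<lambda>j. (c \<cdot>\<^sub>m B) $$ (i, j)) \<le> \<bar>c\<bar> * two_inf_norm B" .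
qed (use assms in simp)

lemma two_inf_norm_normalize:
  assumes "0 < dim_row B" "0 < two_inf_norm B"
  shows "two_inf_norm ((1 / two_inf_norm B) \<cdot>\<^sub>m B) = 1"
proof (rule antisym)
  let ?t = "two_inf_norm B"
  show "two_inf_norm ((1 / ?t) \<cdot>\<^sub>m B) \<le> 1" using two_inf_norm_scale_le[OF assms(1), of "1 / ?t"] assms by simp
  have "?t \<cdot>\<^sub>m ((1 / ?t) \<cdot>\<^sub>m B) = B" using assms by (intro eq_matI) auto
  then have "?t \<le> \<bar>?t\<bar> * two_inf_norm ((1 / ?t) \<cdot>\<^sub>m B)"
    using two_inf_norm_scale_le[of "(1 / ?t) \<cdot>\<^sub>m B" ?t] assms by simp
  then show "1 \<le> two_inf_norm ((1 / ?t) \<cdot>\<^sub>m B)" using assms by simp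
qed

text \<open>A finite bound is what makes the supremum in \<open>spectral_norm\<close> an upper bound
  at all; this one also compares the spectral norm with the entries in
  \<open>sep_spectral_bounds\<close>.\<close>

lemma mult_mat_vec_bound:
  assumes "x \<in> carrier_vec (dim_col B)" "vec_norm2 x = 1"
  shows "vec_norm2 (B *\<^sub>v x) \<le> (\<Sum>i<dim_row B. \<Sum>j<dim_col B. \<bar>B $$ (i, j)\<bar>)"
proof -
  have "vec_norm2 (B *\<^sub>v x) \<le> (\<Sum>i<dim_row B. \<bar>(B *\<^sub>v x) $ i\<bar>)"
    using L2_set_le_sum_abs[of "vec_index (B *\<^sub>v x)" "{..<dim_row B}"] by (simp only: vec_norm2_def dim_mult_mat_vec)
  also have "\<dots> \<le> (\<Sum>i<dim_row B. \<Sum>j<dim_col B. \<bar>B $$ (i, j)\<bar>)"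
  proof (rule sum_mono)
    fix i assume i: "i \<in> {..<dim_row B}"
    have x: "\<bar>x $ j\<bar> \<le> 1" if "j < dim_col B" for j
      using norm_n_component[of j "dim_vec x" "vec_index x"] assms that by (simp add: vec_norm2_eq)
    have "\<bar>(B *\<^sub>v x) $ i\<bar> = \<bar>\<Sum>j<dim_col B. B $$ (i, j) * x $ j\<bar>"
      using i assms by (simp add: scalar_prod_def atLeast0LessThan)
    also have "\<dots> \<le> (\<Sum>j<dim_col B. \<bar>B $$ (i, j) * x $ j\<bar>)" by (rule sum_abs)
    also have "\<dots> \<le> (\<Sum>j<dim_col B. \<bar>B $$ (i, j)\<bar>)"
      unfolding abs_mult by (intro sum_mono mult_left_le) (use x in auto)
    finally show "\<bar>(B *\<^sub>v x) $ i\<bar> \<le> (\<Sum>j<dim_col B. \<bar>B $$ (i, j)\<bar>)" .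
  qed
  finally show ?thesis .
qed

lemma vec_norm2_unit: "j < m \<Longrightarrow> vec_norm2 (unit_vec m j) = 1"
proof -
  assume j: "j < m"
  have "(\<Sum>i<m. ((unit_vec m j :: real vec) $ i)\<^sup>2) = (\<Sum>i<m. if i = j then 1 else 0)"
    using j by (intro sum.cong) auto
  then show ?thesis using j by (simp add: vec_norm2_def L2_set_def)
qed

lemma spectral_norm_ge:
  assumes "x \<in> carrier_vec (dim_col B)" "vec_norm2 x = 1"
  shows "vec_norm2 (B *\<^sub>v x) \<le> spectral_norm B"
  unfolding spectral_norm_def
  by (rule cSup_upper) (use assms mult_mat_vec_bound in \<open>auto intro!: bdd_aboveI\<close>)

lemma spectral_norm_le:
  assumes "0 < dim_col B"
    and "\<And>x. x \<in> carrier_vec (dim_col B) \<Longrightarrow> vec_norm2 x = 1 \<Longrightarrow> vec_norm2 (B *\<^sub>v x) \<le> c"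
  shows "spectral_norm B \<le> c"
  unfolding spectral_norm_def
proof (rule cSup_least)
  show "{vec_norm2 (B *\<^sub>v x) |x. x \<in> carrier_vec (dim_col B) \<and> vec_norm2 x = 1} \<noteq> {}"
    using vec_norm2_unit[OF assms(1)] by (auto intro!: exI[of _ "unit_vec (dim_col B) 0"])
qed (use assms(2) in auto)

lemma spectral_norm_entry:
  assumes "i < dim_row B" "j < dim_col B" shows "\<bar>B $$ (i, j)\<bar> \<le> spectral_norm B"
proof -
  let ?e = "unit_vec (dim_col B) j"
  have "(B *\<^sub>v ?e) $ i = B $$ (i, j)" using assms by simp
  moreover have "\<bar>(B *\<^sub>v ?e) $ i\<bar> \<le> vec_norm2 (B *\<^sub>v ?e)"
    unfolding vec_norm2_eq using assms by (intro norm_n_component) simp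
  ultimately show ?thesis using spectral_norm_ge[of ?e B] vec_norm2_unit[OF assms(2)] by simp
qed

text \<open>These are the test matrices on which the spectral separation can be evaluated
  exactly.\<close>

lemma spectral_norm_single_entry:
  assumes "i0 < m" "j0 < l" "0 \<le> c"
  shows "spectral_norm (mat m l (\<lambda>(i, j). if i = i0 \<and> j = j0 then c else 0)) = c" (is "spectral_norm ?B = c")
proof (rule antisym)
  show "spectral_norm ?B \<le> c"
  proof (rule spectral_norm_le)
    fix x :: "real vec" assume x: "x \<in> carrier_vec (dim_col ?B)" "vec_norm2 x = 1"
    have "(?B *\<^sub>v x) $ i = (if i = i0 then c * x $ j0 else 0)" if "i < m" for i
    proof -
      have "(?B *\<^sub>v x) $ i = (\<Sum>j<l. ?B $$ (i, j) * x $ j)"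
        using x that by (simp add: scalar_prod_def atLeast0LessThan)
      also have "\<dots> = (\<Sum>j<l. if j = j0 then (if i = i0 then c * x $ j0 else 0) else 0)"
        using that by (intro sum.cong) auto
      finally have "(?B *\<^sub>v x) $ i = \<dots>" .
      then show ?thesis using assms by simp
    qed
    then have "vec_norm2 (?B *\<^sub>v x) = L2_set (\<lambda>i. if i = i0 then c * x $ j0 else 0) {..<m}"
      unfolding vec_norm2_def by (intro L2_set_cong) auto
    also have "\<dots> = \<bar>c * x $ j0\<bar>"
      using assms by (simp add: L2_set_def if_distrib[of "\<lambda>x. x\<^sup>2"] cong: if_cong)
    also have "\<dots> \<le> c"
      using norm_n_component[of j0 "dim_vec x" "vec_index x"] x assms
      by (simp add: vec_norm2_eq abs_mult mult_left_le)
    finally show "vec_norm2 (?B *\<^sub>v x) \<le> c" .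
  qed (use assms in simp)
  show "c \<le> spectral_norm ?B" using spectral_norm_entry[of i0 ?B j0] assms by simp
qed

subsection \<open>The separation hypotheses\<close>

locale eigen_data =
  fixes n r :: nat and A V1 V2 :: "real mat" and lam :: "nat \<Rightarrow> real"
  assumes r: "1 \<le> r" "r < n"
    and A: "A \<in> carrier_mat n n" "transpose_mat A = A"
    and ordered: "ordered_eigenvalues A lam"
    and eigengap: "lam (r + 1) < lam r"
    and V1: "V1 \<in> carrier_mat n r" "orthonormal_columns V1"
      "\<And>j. j < r \<Longrightarrow> eigenvector A (Matrix.col V1 j) (lam (j + 1))"
    and V2: "V2 \<in> carrier_mat n (n - r)" "orthonormal_columns V2"
      "\<And>j. j < n - r \<Longrightarrow> eigenvector A (Matrix.col V2 j) (lam (r + j + 1))"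
begin

definition a :: "nat \<Rightarrow> nat \<Rightarrow> real" where
  "a i k = A $$ (i, k)"

definition v :: "nat \<Rightarrow> nat \<Rightarrow> real" where
  "v j i = (if j < r then V1 $$ (i, j) else V2 $$ (i, j - r))"

definition ev :: "nat \<Rightarrow> real" where
  "ev j = lam (j + 1)"

lemma ev_mono: "j \<le> k \<Longrightarrow> k < n \<Longrightarrow> ev k \<le> ev j"
proof (induction k rule: dec_induct)
  case (step k)
  then have "lam (k + 1 + 1) \<le> lam (k + 1)" using ordered A unfolding ordered_eigenvalues_def by auto
  then show ?case using step by (simp add: ev_def)
qed simp

lemma ev_ge: "j < r \<Longrightarrow> lam r \<le> ev j"
proof -
  assume "j < r"
  then have "ev (r - 1) \<le> ev j" using r by (intro ev_mono) auto
  then show ?thesis using r by (simp add: ev_def)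
qed

lemma a_sym: "i < n \<Longrightarrow> k < n \<Longrightarrow> a i k = a k i"
  using A unfolding a_def by (metis carrier_matD index_transpose_mat(1))

lemma eigenvector_entry:
  assumes "W \<in> carrier_mat n m" "j < m" "eigenvector A (Matrix.col W j) c" "i < n"
  shows "mul_n n a (\<lambda>i. W $$ (i, j)) i = c * W $$ (i, j)"
proof -
  have "(A *\<^sub>v Matrix.col W j) $ i = (c \<cdot>\<^sub>v Matrix.col W j) $ i"
    using assms(3) by (simp add: eigenvector_def)
  then show ?thesis using assms A by (simp add: mul_n_def a_def scalar_prod_def atLeast0LessThan)
qed

lemma v_eig: "j < n \<Longrightarrow> i < n \<Longrightarrow> mul_n n a (v j) i = ev j * v j i"
  using eigenvector_entry[OF V1(1) _ V1(3), of j i] eigenvector_entry[OF V2(1) _ V2(3), of "j - r" i] r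
  by (cases "j < r") (auto simp: v_def[abs_def] ev_def)

lemma orthonormal_columns_entries:
  assumes "W \<in> carrier_mat n m" "orthonormal_columns W"
  shows "orthonormal_n n m (\<lambda>j i. W $$ (i, j))"
  unfolding orthonormal_n_def
proof (intro allI impI)
  fix j k assume jk: "j < m" "k < m"
  have "(transpose_mat W * W) $$ (j, k) = (1\<^sub>m (dim_col W) :: real mat) $$ (j, k)"
    using assms by (simp add: orthonormal_columns_def)
  then show "inner_n n (\<lambda>i. W $$ (i, j)) (\<lambda>i. W $$ (i, k)) = of_bool (j = k)"
    using jk assms by (simp add: inner_n_def scalar_prod_def atLeast0LessThan)
qed

text \<open>Orthonormality inside V1 and inside V2 is given. Between the two blocks the eigenvalues
  differ strictly by the eigengap, so symmetry of A makes the inner products vanish.\<close>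

lemma v_orthonormal: "orthonormal_n n n v"
proof -
  note o1 = orthonormal_nD[OF orthonormal_columns_entries[OF V1(1,2)]]
  note o2 = orthonormal_nD[OF orthonormal_columns_entries[OF V2(1,2)]]
  have cross: "inner_n n (v j) (v k) = 0" if jk: "j < r" "r \<le> k" "k < n" for j k
  proof -
    have "ev k < ev j" using ev_ge[OF jk(1)] ev_mono[OF jk(2,3)] eigengap by (simp add: ev_def)
    moreover have "ev j * inner_n n (v j) (v k) = ev k * inner_n n (v j) (v k)"
    proof -
      have "ev j * inner_n n (v j) (v k) = inner_n n (mul_n n a (v j)) (v k)"
        unfolding inner_n_scale_left[symmetric] by (rule inner_n_cong) (use v_eig jk r in auto)
      also have "\<dots> = inner_n n (v j) (mul_n n a (v k))"
        by (rule mul_n_symmetric[symmetric]) (rule a_sym)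
      also have "\<dots> = ev k * inner_n n (v j) (v k)"
        unfolding inner_n_scale_right[symmetric] by (rule inner_n_cong) (use v_eig jk r in auto)
      finally show ?thesis .
    qed
    ultimately show ?thesis by auto
  qed
  show ?thesis
    unfolding orthonormal_n_def
  proof (intro allI impI)
    fix j k assume jk: "j < n" "k < n"
    consider "j < r" "k < r" | "j < r" "r \<le> k" | "r \<le> j" "k < r" | "r \<le> j" "r \<le> k" by linarith
    then show "inner_n n (v j) (v k) = of_bool (j = k)"
    proof cases
      case 1 then show ?thesis using o1[of j k] by (simp add: v_def[abs_def])
    next
      case 2 then show ?thesis using cross[of j k] jk by auto
    next
      case 3 then show ?thesis using cross[of k j] jk by (auto simp: inner_n_commute)
    next
      case 4 then show ?thesis using o2[of "j - r" "k - r"] jk by (auto simp: v_def[abs_def])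
    qed
  qed
qed

sublocale gapped_eigenbasis n r a v ev "lam r - lam (r + 1)"
proof
  fix j k assume "j < r" "r \<le> k" "k < n"
  then have "ev k \<le> lam (r + 1)" "lam r \<le> ev j"
    using ev_mono[of r k] ev_ge[of j] by (auto simp: ev_def)
  then show "ev k + (lam r - lam (r + 1)) \<le> ev j" by simp
qed (use a_sym v_orthonormal v_eig r eigengap in auto)

abbreviation "L1 \<equiv> mat_diag r (\<lambda>i. lam (i + 1))"
abbreviation "L2 \<equiv> mat_diag (n - r) (\<lambda>i. lam (r + i + 1))"
abbreviation "C2 \<equiv> V2 * L2 * transpose_mat V2"

lemma L_carrier: "L1 \<in> carrier_mat r r" "L2 \<in> carrier_mat (n - r) (n - r)" "C2 \<in> carrier_mat n n"
  using V2 by auto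

text \<open>On the complement of ran V1 the matrix V2 L2 V2^T acts as A. Hence the Sylvester
  operator in \<open>sep_on\<close> is the left-hand side of the Riccati equation.\<close>

lemma C2_mult:
  assumes orth: "\<And>k. k < r \<Longrightarrow> inner_n n (v k) x = 0" and i: "i < n"
  shows "(\<Sum>k<n. C2 $$ (i, k) * x k) = mul_n n a x i"
proof -
  have C2: "C2 $$ (i, k) = (\<Sum>l<n - r. V2 $$ (i, l) * lam (r + l + 1) * V2 $$ (k, l))" if "k < n" for k
  proof -
    have "V2 * L2 = mat n (n - r) (\<lambda>(i, l). V2 $$ (i, l) * lam (r + l + 1))"
      using V2(1) by (rule mat_diag_mult_right)
    then show ?thesis using that i V2(1) by (simp add: scalar_prod_def atLeast0LessThan)
  qed
  have "(\<Sum>k<n. C2 $$ (i, k) * x k) = (\<Sum>l<n - r. ev (r + l) * inner_n n (v (r + l)) x * v (r + l) i)"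
  proof -
    have "(\<Sum>k<n. C2 $$ (i, k) * x k) = (\<Sum>k<n. \<Sum>l<n - r. V2 $$ (i, l) * lam (r + l + 1) * V2 $$ (k, l) * x k)"
      unfolding sum_distrib_right[symmetric] by (intro sum.cong refl arg_cong2[where f = "(*)"] C2) auto
    also have "\<dots> = (\<Sum>l<n - r. \<Sum>k<n. V2 $$ (i, l) * lam (r + l + 1) * V2 $$ (k, l) * x k)"
      by (rule sum.swap)
    also have "\<dots> = (\<Sum>l<n - r. ev (r + l) * inner_n n (v (r + l)) x * v (r + l) i)"
      by (simp add: inner_n_def v_def ev_def sum_distrib_left sum_distrib_right ac_simps)
    finally show ?thesis .
  qed
  also have "\<dots> = (\<Sum>j\<in>{r..<n}. ev j * inner_n n (v j) x * v j i)"
    by (rule sum.reindex_bij_witness[of _ "\<lambda>j. j - r" "\<lambda>l. r + l"]) auto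
  also have "\<dots> = (\<Sum>j<n. ev j * inner_n n (v j) x * v j i)"
    by (rule sum.mono_neutral_left) (auto simp: orth)
  also have "\<dots> = (\<Sum>j<n. inner_n n (v j) (mul_n n a x) * v j i)"
    by (intro sum.cong refl) (simp add: inner_v_A)
  also have "\<dots> = mul_n n a x i" by (rule orthonormal_n_basis[OF v_orthonormal i])
  finally show ?thesis .
qed

lemma mat_ran_V2:
  assumes "x \<in> carrier_vec n"
  shows "x \<in> mat_ran V2 \<longleftrightarrow> (\<forall>k<r. inner_n n (v k) (vec_index x) = 0)"
proof
  assume "x \<in> mat_ran V2"
  then obtain c where c: "c \<in> carrier_vec (n - r)" "x = V2 *\<^sub>v c" using V2 by (auto simp: mat_ran_def)
  show "\<forall>k<r. inner_n n (v k) (vec_index x) = 0"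
  proof (intro allI impI)
    fix k assume k: "k < r"
    have "inner_n n (v k) (vec_index x) = inner_n n (v k) (\<lambda>i. \<Sum>l<n - r. c $ l * v (r + l) i)"
      using c V2 by (intro inner_n_cong) (auto simp: scalar_prod_def atLeast0LessThan v_def mult.commute)
    also have "\<dots> = 0"
      unfolding inner_n_linear using k r orthonormal_nD[OF v_orthonormal, of k] by (intro sum.neutral) auto
    finally show "inner_n n (v k) (vec_index x) = 0" .
  qed
next
  assume orth: "\<forall>k<r. inner_n n (v k) (vec_index x) = 0"
  let ?c = "vec (n - r) (\<lambda>l. inner_n n (v (r + l)) (vec_index x))"
  have "x = V2 *\<^sub>v ?c"
  proof (rule eq_vecI)
    fix i assume "i < dim_vec (V2 *\<^sub>v ?c)"
    then have i: "i < n" using V2 by simp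
    have "x $ i = (\<Sum>j<n. inner_n n (v j) (vec_index x) * v j i)"
      by (rule orthonormal_n_basis[OF v_orthonormal i, symmetric])
    also have "\<dots> = (\<Sum>j\<in>{r..<n}. inner_n n (v j) (vec_index x) * v j i)"
      by (rule sum.mono_neutral_right) (use orth in auto)
    also have "\<dots> = (\<Sum>l<n - r. inner_n n (v (r + l)) (vec_index x) * v (r + l) i)"
      by (rule sum.reindex_bij_witness[of _ "\<lambda>l. r + l" "\<lambda>j. j - r"]) auto
    finally show "x $ i = (V2 *\<^sub>v ?c) $ i"
      using i V2 by (simp add: scalar_prod_def atLeast0LessThan v_def mult.commute)
  qed (use assms V2 in simp)
  then show "x \<in> mat_ran V2" using V2 unfolding mat_ran_def by (auto intro!: exI[of _ ?c])
qed

lemma col_orth: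
  assumes "Z \<in> carrier_mat n r" "Matrix.col Z j \<in> mat_ran V2" "j < r" "k < r"
  shows "inner_n n (v k) (\<lambda>i. Z $$ (i, j)) = 0"
proof -
  have "Matrix.col Z j \<in> carrier_vec n" using assms(1) by auto
  then have "inner_n n (v k) (vec_index (Matrix.col Z j)) = 0" using mat_ran_V2 assms(2,4) by blast
  moreover have "inner_n n (v k) (\<lambda>i. Z $$ (i, j)) = inner_n n (v k) (vec_index (Matrix.col Z j))"
    using assms by (intro inner_n_cong) auto
  ultimately show ?thesis by simp
qed

lemma sylvester_entry:
  assumes Z: "Z \<in> carrier_mat n r" and ran: "\<And>j. j < r \<Longrightarrow> Matrix.col Z j \<in> mat_ran V2"
    and ij: "i < n" "j < r"
  shows "(Z * L1 - C2 * Z) $$ (i, j) = ev j * Z $$ (i, j) - mul_n n a (\<lambda>i. Z $$ (i, j)) i"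
proof -
  have orth: "inner_n n (v k) (\<lambda>i. Z $$ (i, j)) = 0" if "k < r" for k
    using Z ran[OF ij(2)] ij(2) that by (rule col_orth)
  have "Z * L1 = mat n r (\<lambda>(i, j). Z $$ (i, j) * lam (j + 1))" using Z by (rule mat_diag_mult_right)
  moreover have "(C2 * Z) $$ (i, j) = (\<Sum>k<n. C2 $$ (i, k) * Z $$ (k, j))"
    using Z V2 ij by (simp add: scalar_prod_def atLeast0LessThan)
  ultimately show ?thesis using ij Z V2 C2_mult[OF orth ij(1)] by (simp add: ev_def)
qed

definition feasible :: "real mat \<Rightarrow> bool" where
  "feasible Z \<longleftrightarrow> Z \<in> carrier_mat n r \<and> (\<forall>j<r. Matrix.col Z j \<in> mat_ran V2) \<and> two_inf_norm Z = 1"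

lemma sep_on_eq: "sep_on two_inf_norm V2 L1 C2 = Inf {two_inf_norm (Z * L1 - C2 * Z) | Z. feasible Z}"
proof -
  have dims: "dim_row C2 = n" "dim_row L1 = r"
    by (rule carrier_matD(1)[OF L_carrier(3)], rule carrier_matD(1)[OF L_carrier(1)])
  have "(Z \<in> carrier_mat n r \<and> (\<forall>j<dim_col Z. Matrix.col Z j \<in> mat_ran V2) \<and> two_inf_norm Z = 1) = feasible Z" for Z
    unfolding feasible_def using carrier_matD(2)[of Z n r] by blast
  then show ?thesis unfolding sep_on_def dims by presburger
qed

lemma feasible_normalized:
  assumes F: "\<And>j k. j < r \<Longrightarrow> k < r \<Longrightarrow> inner_n n (v k) (F j) = 0"
  defines "Z \<equiv> mat n r (\<lambda>(i, j). F j i)"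
  assumes t: "0 < two_inf_norm Z"
  shows "feasible ((1 / two_inf_norm Z) \<cdot>\<^sub>m Z)"
proof -
  let ?Z = "(1 / two_inf_norm Z) \<cdot>\<^sub>m Z"
  have Z: "?Z \<in> carrier_mat n r" by (simp add: Z_def)
  have "Matrix.col ?Z j \<in> mat_ran V2" if j: "j < r" for j
  proof -
    have "inner_n n (v k) (vec_index (Matrix.col ?Z j)) = 0" if "k < r" for k
    proof -
      have "inner_n n (v k) (vec_index (Matrix.col ?Z j)) = inner_n n (v k) (\<lambda>i. (1 / two_inf_norm Z) * F j i)"
        using j by (intro inner_n_cong) (auto simp: Z_def)
      then show ?thesis unfolding inner_n_scale_right using F[OF j that] by simp
    qed
    moreover have "Matrix.col ?Z j \<in> carrier_vec n" 
      by (rule carrier_vecI) (simp add: Z_def)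
    ultimately show ?thesis by (subst mat_ran_V2) auto
  qed
  moreover have "two_inf_norm ?Z = 1" by (rule two_inf_norm_normalize) (use t r in \<open>auto simp: Z_def\<close>)
  ultimately show ?thesis using Z by (simp add: feasible_def)
qed

text \<open>The separation is an infimum over a unit sphere; dividing \<open>F\<close> by its
  (2,\<infinity>) norm turns it into a bound on the inverse operator. The zero matrix cannot be
  normalised and is treated apart.\<close>

lemma sep_on_row_bound:
  assumes F: "\<And>j k. j < r \<Longrightarrow> k < r \<Longrightarrow> inner_n n (v k) (F j) = 0"
    and b: "\<And>i. i < n \<Longrightarrow> norm_n r (\<lambda>j. ev j * F j i - mul_n n a (F j) i) \<le> b"
    and c: "0 \<le> c" "c \<le> sep_on two_inf_norm V2 L1 C2" and i: "i < n"
  shows "c * norm_n r (\<lambda>j. F j i) \<le> b"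
proof -
  define Z where "Z = mat n r (\<lambda>(i, j). F j i)"
  define t where "t = two_inf_norm Z"
  have b0: "0 \<le> b" using b[OF i] norm_n_nonneg order_trans by blast
  have row: "norm_n r (\<lambda>j. F j i) \<le> t"
  proof -
    have "norm_n r (\<lambda>j. F j i) = norm_n (dim_col Z) (\<lambda>j. Z $$ (i, j))"
      using i by (auto simp: Z_def intro!: norm_n_cong)
    also have "\<dots> \<le> t" unfolding t_def by (rule two_inf_norm_row) (use i in \<open>simp add: Z_def\<close>)
    finally show ?thesis .
  qed
  have t0: "0 \<le> t" using row norm_n_nonneg order_trans by blast
  show ?thesis
  proof (cases "t = 0")
    case True
    then have "norm_n r (\<lambda>j. F j i) = 0" using row norm_n_nonneg[of r "\<lambda>j. F j i"] by linarith
    then show ?thesis using b0 by simp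
  next
    case False
    then have t: "0 < t" using t0 by simp
    let ?Z = "(1 / t) \<cdot>\<^sub>m Z"
    have feas: "feasible ?Z" unfolding t_def Z_def by (rule feasible_normalized) (use F t in \<open>auto simp: t_def Z_def\<close>)
    have "sep_on two_inf_norm V2 L1 C2 \<le> two_inf_norm (?Z * L1 - C2 * ?Z)"
      unfolding sep_on_eq
    proof (rule cInf_lower)
      show "bdd_below {two_inf_norm (Z * L1 - C2 * Z) |Z. feasible Z}"
        using r V2(1) by (intro bdd_belowI[of _ 0]) (auto simp: feasible_def intro!: two_inf_norm_nonneg)
    qed (use feas in auto)
    also have "\<dots> \<le> b / t"
    proof (rule two_inf_norm_le)
      fix i' assume "i' < dim_row (?Z * L1 - C2 * ?Z)"
      then have i': "i' < n" using V2(1) by simp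
      have "(?Z * L1 - C2 * ?Z) $$ (i', j) = (1 / t) * (ev j * F j i' - mul_n n a (F j) i')" if j: "j < r" for j
      proof -
        have "(?Z * L1 - C2 * ?Z) $$ (i', j) = ev j * ?Z $$ (i', j) - mul_n n a (\<lambda>i. ?Z $$ (i, j)) i'"
          using feas i' j by (intro sylvester_entry) (auto simp: feasible_def)
        also have "mul_n n a (\<lambda>i. ?Z $$ (i, j)) = mul_n n a (\<lambda>i. (1 / t) * F j i)"
          by (rule mul_n_cong) (use j in \<open>simp add: Z_def\<close>)
        finally show ?thesis unfolding mul_n_scale using i' j by (simp add: Z_def right_diff_distrib)
      qed
      moreover have "dim_col (?Z * L1 - C2 * ?Z) = r" by (simp add: Z_def)
      ultimately have "norm_n (dim_col (?Z * L1 - C2 * ?Z)) (\<lambda>j. (?Z * L1 - C2 * ?Z) $$ (i', j))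
          = norm_n r (\<lambda>j. (1 / t) * (ev j * F j i' - mul_n n a (F j) i'))"
        by (simp only:) (rule norm_n_cong)
      also have "\<dots> \<le> b / t" unfolding norm_n_scale using b[OF i'] t by (simp add: divide_right_mono)
      finally show "norm_n (dim_col (?Z * L1 - C2 * ?Z)) (\<lambda>j. (?Z * L1 - C2 * ?Z) $$ (i', j)) \<le> b / t" .
    qed (use r V2(1) in simp)
    finally have "c \<le> b / t" using c(2) by linarith
    then have "c * t \<le> b" using t by (simp add: field_simps)
    then show ?thesis using mult_left_mono[OF row c(1)] by linarith
  qed
qed

text \<open>The gap is prescribed as a constant in n without a sign, so positivity has to come from
  the eigengap. Comparing row norms with column norms loses factors of n and r; this is harmless,
  since \<open>c\<close> serves only positivity and the uniform value is the prescribed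
  constant.\<close>

lemma sep_on_pos: "0 < sep_on two_inf_norm V2 L1 C2"
proof -
  define \<delta> where "\<delta> = lam r - lam (r + 1)"
  have \<delta>: "\<delta> > 0" using eigengap by (simp add: \<delta>_def)
  define c where "c = \<delta> / (sqrt (real r) * sqrt (real n))"
  have "c \<le> sep_on two_inf_norm V2 L1 C2"
    unfolding sep_on_eq
  proof (rule cInf_greatest)
    \<comment> \<open>Every column is the first column of V2; after normalisation this shows that
      the infimum runs over a nonempty set.\<close>
    let ?F = "\<lambda>_::nat. v r"
    let ?Z = "mat n r (\<lambda>(i, j). v r i)"
    have orth: "inner_n n (v k) (v r) = 0" if "k < r" for k
      using orthonormal_nD[OF v_orthonormal, of k r] that r by auto
    have "0 < two_inf_norm ?Z"
    proof (rule ccontr)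
      assume "\<not> 0 < two_inf_norm ?Z"
      then have "norm_n r (\<lambda>j. v r i) \<le> 0" if "i < n" for i
        using two_inf_norm_row[of i ?Z] that norm_n_cong[of r "\<lambda>j. ?Z $$ (i, j)" "\<lambda>j. v r i"] by simp
      then have "v r i = 0" if "i < n" for i
        using norm_n_component[of 0 r "\<lambda>j. v r i"] that r by fastforce
      then have "inner_n n (v r) (v r) = 0" by (simp add: inner_n_def)
      then show False using orthonormal_nD[OF v_orthonormal, of r r] r by simp
    qed
    then show "{two_inf_norm (Z * L1 - C2 * Z) |Z. feasible Z} \<noteq> {}"
      using feasible_normalized[of ?F] orth by blast
  next
    fix s assume "s \<in> {two_inf_norm (Z * L1 - C2 * Z) |Z. feasible Z}"
    then obtain Z where s: "s = two_inf_norm (Z * L1 - C2 * Z)" and Z: "Z \<in> carrier_mat n r"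
      "\<And>j. j < r \<Longrightarrow> Matrix.col Z j \<in> mat_ran V2" "two_inf_norm Z = 1" by (auto simp: feasible_def)
    have s0: "0 \<le> s" unfolding s using Z r V2(1) by (intro two_inf_norm_nonneg) auto
    have entry: "\<bar>Z $$ (i, j)\<bar> \<le> sqrt (real n) * s / \<delta>" if ij: "i < n" "j < r" for i j
    proof -
      let ?z = "\<lambda>i. Z $$ (i, j)"
      have orth: "inner_n n (v k) ?z = 0" if "k < r" for k
        using Z(1) Z(2)[OF ij(2)] ij(2) that by (rule col_orth)
      have "\<bar>ev j * ?z i' - mul_n n a ?z i'\<bar> \<le> s" if i': "i' < n" for i'
      proof -
        have "\<bar>(Z * L1 - C2 * Z) $$ (i', j)\<bar> \<le> norm_n r (\<lambda>j. (Z * L1 - C2 * Z) $$ (i', j))"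
          by (rule norm_n_component[OF ij(2)])
        also have "\<dots> \<le> s" using two_inf_norm_row[of i' "Z * L1 - C2 * Z"] Z V2(1) i' by (simp add: s)
        finally show ?thesis using sylvester_entry[OF Z(1,2) i' ij(2)] by simp
      qed
      then have "norm_n n (\<lambda>i'. ev j * ?z i' - mul_n n a ?z i') \<le> sqrt (real n) * s"
        by (rule norm_n_le_sqrt_bound) (simp_all add: s0)
      moreover have "\<delta> * norm_n n ?z \<le> norm_n n (\<lambda>i'. ev j * ?z i' - mul_n n a ?z i')"
        unfolding \<delta>_def by (rule sylvester_lower_bound) (use orth lam_gap[OF ij(2)] eigengap in auto)
      ultimately have "norm_n n ?z \<le> sqrt (real n) * s / \<delta>" using \<delta> by (simp add: field_simps)
      then show ?thesis using norm_n_component[OF ij(1), of ?z] by linarith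
    qed
    have "two_inf_norm Z \<le> sqrt (real r) * (sqrt (real n) * s / \<delta>)"
    proof (rule two_inf_norm_le)
      fix i assume "i < dim_row Z"
      then show "norm_n (dim_col Z) (\<lambda>j. Z $$ (i, j)) \<le> sqrt (real r) * (sqrt (real n) * s / \<delta>)"
        unfolding carrier_matD(2)[OF Z(1)] using Z(1) entry s0 \<delta> by (intro norm_n_le_sqrt_bound) auto
    qed (use Z r in simp)
    then have "1 \<le> sqrt (real r) * (sqrt (real n) * s / \<delta>)" using Z(3) by simp
    then show "c \<le> s" using \<delta> r by (simp add: c_def field_simps)
  qed
  moreover have "0 < c" using \<delta> r by (simp add: c_def)
  ultimately show ?thesis by linarith
qed

lemma sep_spectral_entry:
  assumes "Z \<in> carrier_mat (n - r) r" "i < n - r" "j < r"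
  shows "(Z * L1 - L2 * Z) $$ (i, j) = (lam (j + 1) - lam (r + i + 1)) * Z $$ (i, j)"
proof -
  have "Z * L1 = mat (n - r) r (\<lambda>(i, j). Z $$ (i, j) * lam (j + 1))" using assms(1) by (rule mat_diag_mult_right)
  moreover have "L2 * Z = mat (n - r) r (\<lambda>(i, j). lam (r + i + 1) * Z $$ (i, j))"
    using assms(1) by (rule mat_diag_mult_left)
  ultimately show ?thesis using assms by (simp add: algebra_simps)
qed

text \<open>The operator multiplies each entry by an eigenvalue difference that is at least the
  eigengap. The test matrix supported at entry (0, r - 1) meets exactly the eigengap, which gives
  the upper bound; the dimension-dependent constant \<open>c\<close> serves only positivity.\<close>

lemma sep_spectral_bounds:
  "0 < sep spectral_norm L1 L2" "sep spectral_norm L1 L2 \<le> lam r - lam (r + 1)"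
proof -
  define \<delta> where "\<delta> = lam r - lam (r + 1)"
  have \<delta>: "\<delta> > 0" using eigengap by (simp add: \<delta>_def)
  let ?feas = "\<lambda>Z. Z \<in> carrier_mat (n - r) r \<and> spectral_norm Z = 1"
  have dims: "dim_row L2 = n - r" "dim_row L1 = r"
    by (rule carrier_matD(1)[OF L_carrier(2)], rule carrier_matD(1)[OF L_carrier(1)])
  have sep: "sep spectral_norm L1 L2 = Inf {spectral_norm (Z * L1 - L2 * Z) | Z. ?feas Z}"
    unfolding sep_def dims ..
  define B where "B c = mat (n - r) r (\<lambda>(i, j). if i = 0 \<and> j = r - 1 then c else 0)" for c :: real
  have B: "spectral_norm (B c) = c" if "0 \<le> c" for c
    unfolding B_def by (rule spectral_norm_single_entry) (use r that in auto)
  have feas: "?feas (B 1)" using B[of 1] by (simp add: B_def)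
  define c where "c = \<delta> / (real (n - r) * real r)"
  have lower: "c \<le> spectral_norm (Z * L1 - L2 * Z)" if Z: "?feas Z" for Z
  proof -
    let ?s = "spectral_norm (Z * L1 - L2 * Z)"
    have entry: "\<bar>Z $$ (i, j)\<bar> \<le> ?s / \<delta>" if ij: "i < n - r" "j < r" for i j
    proof -
      have "r + i < n" using ij(1) by arith
      from lam_gap[OF ij(2) _ this] have "\<delta> \<le> lam (j + 1) - lam (r + i + 1)"
        by (simp add: \<delta>_def ev_def)
      then have "\<delta> * \<bar>Z $$ (i, j)\<bar> \<le> \<bar>(lam (j + 1) - lam (r + i + 1)) * Z $$ (i, j)\<bar>"
        unfolding abs_mult using \<delta> by (intro mult_right_mono) auto
      also have "\<dots> \<le> ?s"
      proof -
        have "i < dim_row (Z * L1 - L2 * Z)" "j < dim_col (Z * L1 - L2 * Z)"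
          using ij Z dims by auto
        from spectral_norm_entry[OF this] show ?thesis
          by (subst (asm) sep_spectral_entry) (use Z ij in auto)
      qed
      finally show ?thesis using \<delta> by (simp add: field_simps)
    qed
    have "1 = spectral_norm Z" using Z by simp
    also have "\<dots> \<le> (\<Sum>i<dim_row Z. \<Sum>j<dim_col Z. \<bar>Z $$ (i, j)\<bar>)"
      by (rule spectral_norm_le) (use Z r mult_mat_vec_bound in auto)
    also have "\<dots> \<le> (\<Sum>i<n - r. \<Sum>j<r. ?s / \<delta>)"
      unfolding carrier_matD[OF conjunct1[OF Z]] by (intro sum_mono entry) auto
    finally show ?thesis using \<delta> r by (simp add: c_def field_simps)
  qed
  have "c \<le> sep spectral_norm L1 L2"
    unfolding sep by (rule cInf_greatest) (use feas lower in blast)+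
  moreover have "0 < c" using \<delta> r by (simp add: c_def)
  ultimately show "0 < sep spectral_norm L1 L2" by linarith
  have "sep spectral_norm L1 L2 \<le> spectral_norm (B 1 * L1 - L2 * B 1)"
    unfolding sep by (rule cInf_lower) (use feas lower in \<open>auto intro!: bdd_belowI[of _ c]\<close>)
  also have "B 1 * L1 - L2 * B 1 = B \<delta>"
  proof (rule eq_matI)
    fix i j assume "i < dim_row (B \<delta>)" "j < dim_col (B \<delta>)"
    then have ij: "i < n - r" "j < r" by (auto simp: B_def)
    show "(B 1 * L1 - L2 * B 1) $$ (i, j) = B \<delta> $$ (i, j)"
      using sep_spectral_entry[of "B 1" i j] feas ij r by (auto simp: B_def \<delta>_def)
  qed (use dims in \<open>auto simp: B_def\<close>)
  also have "spectral_norm (B \<delta>) = \<delta>" using \<delta> by (intro B) simp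
  finally show "sep spectral_norm L1 L2 \<le> lam r - lam (r + 1)" by (simp add: \<delta>_def)
qed

end

subsection \<open>The orthogonal Procrustes problem\<close>

text \<open>Combine the columns with row \<open>i\<close> itself as coefficients: entry
  \<open>i\<close> of the result is the squared row norm, and its whole norm is the row
  norm.\<close>

lemma orthonormal_n_row:
  assumes "orthonormal_n n r x" "i < n" shows "norm_n r (\<lambda>j. x j i) \<le> 1"
proof -
  let ?c = "\<lambda>j. x j i"
  have "inner_n r ?c ?c = (\<lambda>i'. \<Sum>j<r. ?c j * x j i') i" by (simp add: inner_n_def)
  also have "\<dots> \<le> norm_n n (\<lambda>i'. \<Sum>j<r. ?c j * x j i')"
    by (rule abs_le_D1[OF norm_n_component[OF assms(2)]])
  also have "\<dots> = 1 * norm_n r ?c" using orthonormal_n_combination[OF assms(1), of ?c] by simp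
  finally show ?thesis by (rule norm_n_le_of_inner) simp
qed

lemma orthogonal_mats_mult:
  assumes U: "U \<in> orthogonal_mats r" and W: "W \<in> orthogonal_mats r" shows "U * W \<in> orthogonal_mats r"
proof -
  have c: "U \<in> carrier_mat r r" "W \<in> carrier_mat r r" and o: "transpose_mat U * U = 1\<^sub>m r" "U * transpose_mat U = 1\<^sub>m r"
    "transpose_mat W * W = 1\<^sub>m r" "W * transpose_mat W = 1\<^sub>m r" using U W by (auto simp: orthogonal_mats_def)
  have t: "transpose_mat (U * W) = transpose_mat W * transpose_mat U" using c by (rule transpose_mult)
  have "transpose_mat W * transpose_mat U * (U * W) = transpose_mat W * ((transpose_mat U * U) * W)"
    using c by (simp add: assoc_mult_mat[of _ r r _ r _ r])
  then have 1: "transpose_mat (U * W) * (U * W) = 1\<^sub>m r" using c o t by simp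
  have "U * W * (transpose_mat W * transpose_mat U) = U * ((W * transpose_mat W) * transpose_mat U)"
    using c by (simp add: assoc_mult_mat[of _ r r _ r _ r])
  then have 2: "U * W * transpose_mat (U * W) = 1\<^sub>m r" using c o t by simp
  show ?thesis using 1 2 c by (simp add: orthogonal_mats_def)
qed

text \<open>The Householder matrix I - 2 y y^T. Products of at most two of these are the only
  competitors to which a Procrustes solution is compared.\<close>

definition reflection :: "nat \<Rightarrow> (nat \<Rightarrow> real) \<Rightarrow> real mat" where
  "reflection r y = mat r r (\<lambda>(i, j). of_bool (i = j) - 2 * y i * y j)"

lemma reflection_orthogonal:
  assumes "norm_n r y = 1" shows "reflection r y \<in> orthogonal_mats r"
proof -
  have y: "(\<Sum>k<r. y k * y k) = 1" using assms norm_n_sq[of r y] by (simp add: inner_n_def)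
  have t: "transpose_mat (reflection r y) = reflection r y"
    by (rule eq_matI) (auto simp: reflection_def of_bool_def)
  have "reflection r y * reflection r y = 1\<^sub>m r"
  proof (rule eq_matI)
    fix i j assume "i < dim_row (1\<^sub>m r :: real mat)" "j < dim_col (1\<^sub>m r :: real mat)"
    then have ij: "i < r" "j < r" by auto
    have "(reflection r y * reflection r y) $$ (i, j)
        = (\<Sum>k<r. (of_bool (i = k) - 2 * y i * y k) * (of_bool (k = j) - 2 * y k * y j))"
      using ij by (simp add: reflection_def scalar_prod_def atLeast0LessThan)
    also have "\<dots> = (\<Sum>k<r. of_bool (i = k) * of_bool (k = j)) - (\<Sum>k<r. of_bool (i = k) * (2 * y k * y j))
        - (\<Sum>k<r. (2 * y i * y k) * of_bool (k = j)) + 4 * y i * y j * (\<Sum>k<r. y k * y k)"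
      unfolding sum_distrib_left sum_subtractf[symmetric] sum.distrib[symmetric]
      by (intro sum.cong refl) (simp add: algebra_simps)
    also have "\<dots> = of_bool (i = j)"
      using ij by (simp add: sum_of_bool_mult y)
    finally show "(reflection r y * reflection r y) $$ (i, j) = (1\<^sub>m r :: real mat) $$ (i, j)" using ij by simp
  qed (auto simp: reflection_def)
  then show ?thesis unfolding orthogonal_mats_def using t by (simp add: reflection_def)
qed

text \<open>Comparing the optimum with \<open>U\<close> followed by one reflection gives positivity; two
  reflections, i.e. a small rotation, give symmetry.\<close>

lemma symmetric_of_reflection_inequality:
  fixes S :: "nat \<Rightarrow> nat \<Rightarrow> real"
  assumes ineq: "\<And>y z. norm_n r y = 1 \<Longrightarrow> norm_n r z = 1 \<Longrightarrow>
      2 * inner_n r y z * inner_n r z (mul_n r S y) \<le> inner_n r y (mul_n r S y) + inner_n r z (mul_n r S z)"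
    and i: "i < r" and j: "j < r"
  shows "S i j = S j i"
proof (cases "i = j")
  case False
  define e where "e k l = (of_bool (k = l) :: real)" for k l :: nat
  have e: "inner_n r (e k) (e l) = of_bool (k = l)" if "k < r" "l < r" for k l
    unfolding inner_n_def e_def using that by (simp add: sum_of_bool_mult)
  have Se: "inner_n r (e k) (mul_n r S (e l)) = S k l" if "k < r" "l < r" for k l
    unfolding inner_n_def mul_n_def e_def using that by (simp add: sum_of_bool_mult)
  have n1: "norm_n r (e k) = 1" if "k < r" for k
    using e[OF that that] norm_n_sq[of r "e k"] norm_n_nonneg[of r "e k"] by (simp add: power2_eq_1_iff)
  \<comment> \<open>Take y = e_i and z the normalised e_i + t e_j. After multiplication by s^2 = 1 +
    t^2 the constant terms cancel, so the linear coefficient in \<open>t\<close> has to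
    vanish.\<close>
  have main: "0 \<le> t * (S i j - S j i) + t\<^sup>2 * (S i i + S j j)" for t
  proof -
    define s where "s = sqrt (1 + t\<^sup>2)"
    have s: "s > 0" "s\<^sup>2 = 1 + t\<^sup>2" unfolding s_def by (auto simp: add_pos_nonneg)
    let ?w = "\<lambda>l. e i l + t * e j l"
    let ?z = "\<lambda>l. (1 / s) * ?w l"
    have ww: "inner_n r ?w ?w = s\<^sup>2"
      unfolding inner_n_linear using e i j False s(2) by (simp add: power2_eq_square)
    then have "(norm_n r ?z)\<^sup>2 = 1\<^sup>2" unfolding norm_n_sq inner_n_scale_left inner_n_scale_right using s(1)
      by (simp add: power2_eq_square)
    then have nz: "norm_n r ?z = 1" by (rule power2_eq_imp_eq) auto
    have mz: "mul_n r S ?z = (\<lambda>l. (1 / s) * (mul_n r S (e i) l + t * mul_n r S (e j) l))"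
      unfolding mul_n_scale mul_n_add by (simp add: fun_eq_iff mul_n_scale mul_n_add)
    have "2 * ((1 / s) * 1) * ((1 / s) * (S i i + t * S j i))
        \<le> S i i + (1 / s) * ((1 / s) * ((S i i + t * S i j) + t * (S j i + t * S j j)))"
      using ineq[OF n1[OF i] nz] unfolding mz inner_n_linear using e Se i j False
      by (simp add: add_divide_distrib distrib_left distrib_right)
    then have "s\<^sup>2 * (2 * ((1 / s) * 1) * ((1 / s) * (S i i + t * S j i)))
        \<le> s\<^sup>2 * (S i i + (1 / s) * ((1 / s) * ((S i i + t * S i j) + t * (S j i + t * S j j))))"
      by (rule mult_left_mono) simp
    then have "2 * (S i i + t * S j i) \<le> s\<^sup>2 * S i i + ((S i i + t * S i j) + t * (S j i + t * S j j))"
    proof -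
      have c1: "s\<^sup>2 * (2 * ((1 / s) * 1) * ((1 / s) * X)) = 2 * X" for X
        using s(1) by (simp add: power2_eq_square)
      have c2: "s\<^sup>2 * (Y + (1 / s) * ((1 / s) * X)) = s\<^sup>2 * Y + X" for X Y
        using s(1) by (simp add: power2_eq_square distrib_left)
      assume "s\<^sup>2 * (2 * ((1 / s) * 1) * ((1 / s) * (S i i + t * S j i)))
        \<le> s\<^sup>2 * (S i i + (1 / s) * ((1 / s) * ((S i i + t * S i j) + t * (S j i + t * S j j))))"
      then show ?thesis unfolding c1 c2 .
    qed
    then show ?thesis unfolding s(2) by (simp add: algebra_simps power2_eq_square)
  qed
  define D where "D = S i j - S j i"
  \<comment> \<open>\<open>p\<close> is positive and exceeds the quadratic coefficient, so t = - D /
    p would make the polynomial negative unless D = 0.\<close>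
  define p where "p = \<bar>S i i + S j j\<bar> + 1"
  have p: "p > 0" "S i i + S j j < p" unfolding p_def by linarith+
  have "0 \<le> (- D / p) * D + (- D / p)\<^sup>2 * (S i i + S j j)" using main[of "- D / p"] by (simp add: D_def)
  also have "\<dots> = D\<^sup>2 / p\<^sup>2 * ((S i i + S j j) - p)" using p(1) by (simp add: field_simps power2_eq_square)
  finally have "0 \<le> D\<^sup>2 / p\<^sup>2 * ((S i i + S j j) - p)" .
  moreover have "D\<^sup>2 / p\<^sup>2 * ((S i i + S j j) - p) < 0" if "D \<noteq> 0"
    using that p by (intro mult_pos_neg) auto
  ultimately have "D = 0" by linarith
  then show ?thesis by (simp add: D_def)
qed simp

context eigen_data
begin

definition S :: "real mat \<Rightarrow> nat \<Rightarrow> nat \<Rightarrow> real" where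
  "S X j k = inner_n n (v j) (\<lambda>i. X $$ (i, k))"

lemma S_reflection:
  assumes X: "X \<in> carrier_mat n r" and k: "k < r"
  shows "S (X * reflection r y) j k = S X j k - 2 * y k * mul_n r (S X) y j"
proof -
  have "S (X * reflection r y) j k = inner_n n (v j) (\<lambda>i. X $$ (i, k) - 2 * y k * (\<Sum>l<r. y l * X $$ (i, l)))"
    unfolding S_def
  proof (rule inner_n_cong)
    fix i assume i: "i < n"
    have "(X * reflection r y) $$ (i, k) = (\<Sum>l<r. X $$ (i, l) * (of_bool (l = k) - 2 * y l * y k))"
      using X i k by (simp add: reflection_def scalar_prod_def atLeast0LessThan)
    also have "\<dots> = (\<Sum>l<r. X $$ (i, l) * of_bool (l = k)) - 2 * y k * (\<Sum>l<r. y l * X $$ (i, l))"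
      unfolding sum_distrib_left sum_subtractf[symmetric] by (intro sum.cong refl) (simp add: algebra_simps)
    finally show "(X * reflection r y) $$ (i, k) = X $$ (i, k) - 2 * y k * (\<Sum>l<r. y l * X $$ (i, l))"
      using k by (simp add: sum_of_bool_mult)
  qed simp
  then show ?thesis unfolding inner_n_linear by (simp add: S_def mul_n_def mult.commute)
qed

lemma trace_reflection:
  assumes "X \<in> carrier_mat n r"
  shows "(\<Sum>j<r. S (X * reflection r y) j j) = (\<Sum>j<r. S X j j) - 2 * inner_n r y (mul_n r (S X) y)"
  using S_reflection[OF assms] by (simp add: sum_subtractf inner_n_def sum_distrib_left mult.assoc)

lemma orthonormal_mult:
  assumes "X \<in> carrier_mat n r" "orthonormal_columns X" "U \<in> orthogonal_mats r"
  shows "X * U \<in> carrier_mat n r" "orthonormal_columns (X * U)"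
proof -
  have U: "U \<in> carrier_mat r r" "transpose_mat U * U = 1\<^sub>m r" using assms by (auto simp: orthogonal_mats_def)
  have XX: "transpose_mat X * X = 1\<^sub>m r" using assms by (simp add: orthonormal_columns_def)
  show "X * U \<in> carrier_mat n r" using assms U by auto
  have "transpose_mat (X * U) * (X * U) = transpose_mat U * transpose_mat X * (X * U)"
    using assms U by (simp add: transpose_mult)
  also have "\<dots> = transpose_mat U * (transpose_mat X * (X * U))"
    using assms(1) U(1) by (intro assoc_mult_mat[of _ r r _ n _ r]) auto
  also have "transpose_mat X * (X * U) = (transpose_mat X * X) * U"
    using assms(1) U(1) by (intro assoc_mult_mat[symmetric, of _ r n _ r _ r]) auto
  finally show "orthonormal_columns (X * U)" using U XX assms(1) by (simp add: orthonormal_columns_def)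
qed

text \<open>Both matrices have orthonormal columns, so expanding the square turns the Procrustes
  problem into maximising the trace of V1^T X.\<close>

lemma frobenius_norm_diff:
  assumes X: "X \<in> carrier_mat n r" "orthonormal_columns X"
  shows "(frobenius_norm (X - V1))\<^sup>2 = 2 * real r - 2 * (\<Sum>j<r. S X j j)"
proof -
  let ?x = "\<lambda>j i. X $$ (i, j)"
  note ox = orthonormal_nD[OF orthonormal_columns_entries[OF X]]
  note ov = orthonormal_nD[OF v_r]
  have "(frobenius_norm (X - V1))\<^sup>2 = (\<Sum>ij\<in>{..<n} \<times> {..<r}. ((X - V1) $$ ij)\<^sup>2)"
    using X V1(1) by (simp add: frobenius_norm_def L2_set_def sum_nonneg)
  also have "\<dots> = (\<Sum>i<n. \<Sum>j<r. (?x j i - v j i)\<^sup>2)"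
    unfolding sum.cartesian_product' using X V1(1) by (auto intro!: sum.cong simp: v_def)
  also have "\<dots> = (\<Sum>j<r. inner_n n (\<lambda>i. ?x j i - v j i) (\<lambda>i. ?x j i - v j i))"
    unfolding inner_n_def power2_eq_square by (rule sum.swap)
  also have "\<dots> = (\<Sum>j<r. 2 - 2 * S X j j)"
    unfolding inner_n_linear by (intro sum.cong refl) (simp add: ox ov S_def inner_n_commute[of n "?x _" "v _"])
  finally show ?thesis by (simp add: sum_subtractf sum_distrib_left)
qed

lemma procrustes_optimality:
  assumes Vh: "Vh \<in> carrier_mat n r" "orthonormal_columns Vh" and U: "solves_procrustes r Vh V1 U"
  shows "U \<in> orthogonal_mats r"
    and "\<And>j k. j < r \<Longrightarrow> k < r \<Longrightarrow> S (Vh * U) j k = S (Vh * U) k j"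
    and "\<And>c. 0 \<le> inner_n r c (mul_n r (S (Vh * U)) c)"
proof -
  show O: "U \<in> orthogonal_mats r" using U by (simp add: solves_procrustes_def is_arg_min_def)
  have Uc: "U \<in> carrier_mat r r" using O by (simp add: orthogonal_mats_def)
  let ?X = "Vh * U"
  note X = orthonormal_mult[OF Vh O]
  have max: "(\<Sum>j<r. S (?X * Q) j j) \<le> (\<Sum>j<r. S ?X j j)" if Q: "Q \<in> orthogonal_mats r" for Q
  proof -
    have Qc: "Q \<in> carrier_mat r r" using Q by (simp add: orthogonal_mats_def)
    have assoc: "Vh * (U * Q) = ?X * Q" using Vh(1) Uc Qc by (rule assoc_mult_mat[symmetric])
    have "\<not> frobenius_norm (Vh * (U * Q) - V1) < frobenius_norm (?X - V1)"
      using U orthogonal_mats_mult[OF O Q] unfolding solves_procrustes_def is_arg_min_def by blast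
    then have "(frobenius_norm (?X - V1))\<^sup>2 \<le> (frobenius_norm (?X * Q - V1))\<^sup>2"
      unfolding assoc by (intro power_mono) (auto simp: frobenius_norm_def)
    then show ?thesis
      using frobenius_norm_diff[OF X] frobenius_norm_diff[OF orthonormal_mult[OF X Q]] by simp
  qed
  have pos1: "0 \<le> inner_n r y (mul_n r (S ?X) y)" if "norm_n r y = 1" for y
    using max[OF reflection_orthogonal[OF that]] trace_reflection[OF X(1), of y] by simp
  show "0 \<le> inner_n r c (mul_n r (S ?X) c)" for c
  proof (cases "norm_n r c = 0")
    case True
    then show ?thesis by (simp add: norm_n_eq_0 inner_n_def)
  next
    case False
    then have m: "norm_n r c > 0" using norm_n_nonneg[of r c] by linarith
    have "0 \<le> inner_n r (\<lambda>i. (1 / norm_n r c) * c i) (mul_n r (S ?X) (\<lambda>i. (1 / norm_n r c) * c i))"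
      by (rule pos1) (use m in \<open>simp only: norm_n_scale, simp\<close>)
    then have "0 \<le> (1 / norm_n r c) * ((1 / norm_n r c) * inner_n r c (mul_n r (S ?X) c))"
      unfolding mul_n_scale[abs_def] inner_n_linear .
    then show ?thesis using m mult_pos_pos[OF m m] by (auto simp: zero_le_divide_iff zero_le_mult_iff)
  qed
  show "S ?X j k = S ?X k j" if "j < r" "k < r" for j k
  proof (rule symmetric_of_reflection_inequality[of r "S ?X", OF _ that])
    fix y z assume y: "norm_n r y = 1" and z: "norm_n r z = 1"
    let ?X' = "?X * reflection r y"
    note Q = reflection_orthogonal[OF y]
    note X' = orthonormal_mult[OF X Q]
    have Qc: "reflection r y \<in> carrier_mat r r" "reflection r z \<in> carrier_mat r r" by (auto simp: reflection_def)
    have "(\<Sum>j<r. S (?X' * reflection r z) j j) \<le> (\<Sum>j<r. S ?X j j)"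
      using max[OF orthogonal_mats_mult[OF Q reflection_orthogonal[OF z]]] assoc_mult_mat[OF X(1) Qc] by simp
    then have "0 \<le> inner_n r y (mul_n r (S ?X) y) + inner_n r z (mul_n r (S ?X') z)"
      using trace_reflection[OF X'(1), of z] trace_reflection[OF X(1), of y] by simp
    moreover have "inner_n r z (mul_n r (S ?X') z)
        = inner_n r z (mul_n r (S ?X) z) - 2 * inner_n r y z * inner_n r z (mul_n r (S ?X) y)"
    proof -
      have "mul_n r (S ?X') z = (\<lambda>j. mul_n r (S ?X) z j - (2 * inner_n r y z) * mul_n r (S ?X) y j)"
      proof
        fix j
        have "mul_n r (S ?X') z j = (\<Sum>k<r. (S ?X j k - 2 * y k * mul_n r (S ?X) y j) * z k)"
          unfolding mul_n_def[of r "S ?X'"] by (intro sum.cong refl) (simp add: S_reflection[OF X(1)])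
        also have "\<dots> = mul_n r (S ?X) z j - (2 * inner_n r y z) * mul_n r (S ?X) y j"
          unfolding mul_n_def[of r "S ?X" z] inner_n_def sum_distrib_left sum_distrib_right sum_subtractf[symmetric]
          by (intro sum.cong refl) (simp add: algebra_simps)
        finally show "mul_n r (S ?X') z j = mul_n r (S ?X) z j - (2 * inner_n r y z) * mul_n r (S ?X) y j" .
      qed
      then show ?thesis by (simp add: inner_n_linear)
    qed
    ultimately show "2 * inner_n r y z * inner_n r z (mul_n r (S ?X) y)
        \<le> inner_n r y (mul_n r (S ?X) y) + inner_n r z (mul_n r (S ?X) z)" by simp
  qed
qed

end

subsection \<open>The deterministic bound\<close>

lemma prod_interval_eq_prod_list:
  "(\<Prod>i = 1..n. f i) = (\<Prod>x\<leftarrow>map g [0..<n]. h x)" if "\<And>j. j < n \<Longrightarrow> f (j + 1) = h (g j)"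
proof -
  have "(\<Prod>i = 1..n. f i) = (\<Prod>j<n. f (j + 1))"
    by (rule prod.reindex_bij_witness[of _ Suc "\<lambda>i. i - 1"]) auto
  also have "\<dots> = (\<Prod>j\<in>set [0..<n]. h (g j))" using that by (intro prod.cong) auto
  also have "\<dots> = (\<Prod>x\<leftarrow>map g [0..<n]. h x)"
    by (subst prod.distinct_set_conv_list) (simp_all add: comp_def)
  finally show ?thesis .
qed

context eigen_data
begin

text \<open>One half of Weyl's inequality. The test space for \<open>eigenvalue_lower_bound\<close>
  is ran V1, on which A is at least \<open>lam r\<close> as a form and the perturbation costs at
  most \<open>e\<close>. This settles the smallest of the first \<open>r\<close> eigenvalues, and
  the ordering settles the others.\<close>

lemma weyl_bound:
  assumes B: "B \<in> carrier_mat n n" "transpose_mat B = B" and lamB: "ordered_eigenvalues B lamB"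
    and \<epsilon>: "\<And>x. norm_n n (mul_n n (\<lambda>i k. B $$ (i, k) - a i k) x) \<le> e * norm_n n x"
    and j: "j < r"
  shows "lam r - e \<le> lamB (j + 1)"
proof -
  define es where "es = map (\<lambda>j. lamB (j + 1)) [0..<n]"
  have "char_poly B = (\<Prod>i = 1..n. [:- lamB i, 1:])"
    using lamB carrier_matD(1)[OF B(1)] unfolding ordered_eigenvalues_def by blast
  also have "\<dots> = (\<Prod>e\<leftarrow>es. [:- e, 1:])"
    unfolding es_def by (rule prod_interval_eq_prod_list) simp
  finally have "char_poly B = (\<Prod>e\<leftarrow>es. [:- e, 1:])" .
  from symmetric_eigenbasis[OF B this] obtain u where u: "orthonormal_n n n u"
    "\<And>j i. j < n \<Longrightarrow> i < n \<Longrightarrow> mul_n n (\<lambda>i k. B $$ (i, k)) (u j) i = es ! j * u j i" by blast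
  have mono: "lamB (k + 1) \<le> lamB (j + 1)" if "j \<le> k" "k < n" for j k
    using that
  proof (induction k rule: dec_induct)
    case (step k)
    then have "lamB (k + 1 + 1) \<le> lamB (k + 1)" using lamB B unfolding ordered_eigenvalues_def by auto
    then show ?case using step by simp
  qed simp
  have Suc: "Suc (r - 1) = r" using r by simp
  have "lam r - e \<le> lamB (r - 1 + 1)"
  proof (rule eigenvalue_lower_bound[of n u "\<lambda>i k. B $$ (i, k)" "\<lambda>j. lamB (j + 1)" "r - 1" v])
    show "mul_n n (\<lambda>i k. B $$ (i, k)) (u j) i = lamB (j + 1) * u j i" if "j < n" "i < n" for j i
      using u(2)[OF that] that by (simp add: es_def)
    show "(lam r - e) * inner_n (Suc (r - 1)) c c \<le> inner_n n (\<lambda>i. \<Sum>j<Suc (r - 1). c j * v j i)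
        (mul_n n (\<lambda>i k. B $$ (i, k)) (\<lambda>i. \<Sum>j<Suc (r - 1). c j * v j i))" for c
    proof -
      define x where "x = (\<lambda>i. \<Sum>j<r. c j * v j i)"
      let ?E = "\<lambda>i k. B $$ (i, k) - a i k"
      have nx: "norm_n n x = norm_n r c" unfolding x_def by (rule orthonormal_n_combination[OF v_r])
      have "mul_n n (\<lambda>i k. B $$ (i, k)) x = (\<lambda>i. mul_n n a x i + mul_n n ?E x i)"
        unfolding mul_n_def sum.distrib[symmetric] by (simp add: algebra_simps)
      then have "inner_n n x (mul_n n (\<lambda>i k. B $$ (i, k)) x) = inner_n n x (mul_n n a x) + inner_n n x (mul_n n ?E x)"
        by (simp add: inner_n_linear)
      moreover have "lam r * inner_n r c c \<le> inner_n n x (mul_n n a x)"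
      proof -
        have "inner_n n x (mul_n n a x) = (\<Sum>j<r. c j * inner_n n (v j) (mul_n n a x))"
          unfolding x_def[unfolded fun_eq_iff] by (subst x_def) (simp add: inner_n_linear)
        also have "\<dots> = (\<Sum>j<r. c j * (ev j * c j))"
          using r orthonormal_n_coeff[OF v_r] by (intro sum.cong refl) (simp add: inner_v_A x_def)
        also have "\<dots> \<ge> (\<Sum>j<r. lam r * (c j * c j))"
        proof (rule sum_mono)
          fix j assume "j \<in> {..<r}"
          then have "lam r * (c j * c j) \<le> ev j * (c j * c j)" using ev_ge by (intro mult_right_mono) auto
          then show "lam r * (c j * c j) \<le> c j * (ev j * c j)" by (simp add: ac_simps)
        qed
        finally show ?thesis by (simp add: inner_n_def sum_distrib_left)
      qed
      moreover have "- (e * inner_n r c c) \<le> inner_n n x (mul_n n ?E x)"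
      proof -
        have "\<bar>inner_n n x (mul_n n ?E x)\<bar> \<le> norm_n n x * norm_n n (mul_n n ?E x)" by (rule inner_n_le)
        also have "\<dots> \<le> norm_n n x * (e * norm_n n x)" by (intro mult_left_mono \<epsilon>) simp
        also have "\<dots> = e * inner_n r c c" by (simp add: nx norm_n_sq[symmetric] power2_eq_square)
        finally show ?thesis by linarith
      qed
      ultimately have "(lam r - e) * inner_n r c c \<le> inner_n n x (mul_n n (\<lambda>i k. B $$ (i, k)) x)"
        by (simp add: left_diff_distrib)
      then show ?thesis unfolding Suc x_def .
    qed
    show "lamB (j + 1) \<le> lamB (r - 1 + 1)" if "r - 1 \<le> j" "j < n" for j by (rule mono[OF that])
  qed (use u(1) r v_r in \<open>simp_all add: Suc\<close>)
  also have "\<dots> \<le> lamB (j + 1)" using j r by (intro mono) auto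
  finally show ?thesis .
qed

lemma perturbed_rows:
  fixes Z :: "real mat" and \<sigma> e g l q \<kappa> \<eta> :: real
  defines "E \<equiv> (\<lambda>i k. \<sigma> * Z $$ (i, k))"
  assumes Z: "Z \<in> carrier_mat n n" "transpose_mat Z = Z"
    and e: "0 \<le> e" "\<And>x. norm_n n (mul_n n E x) \<le> e * norm_n n x"
    and g: "0 < g" "g \<le> lam r - lam (r + 1)" "g \<le> sep_on two_inf_norm V2 L1 C2"
    and \<eta>: "\<eta> = 2 * e * sqrt (real r) / g" "\<eta> \<le> 1 / 2"
    and l: "\<And>i j. i < n \<Longrightarrow> j < r \<Longrightarrow> \<bar>mul_n n E (v j) i\<bar> \<le> l"
      "\<And>k j. k < r \<Longrightarrow> j < r \<Longrightarrow> \<bar>inner_n n (v k) (mul_n n E (v j))\<bar> \<le> l"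
    and q: "\<And>i j. i < n \<Longrightarrow> j < r \<Longrightarrow> \<bar>mul_n n E (mul_n n (R j) (mul_n n E (v j))) i\<bar> \<le> q"
    and \<kappa>: "\<And>i. i < n \<Longrightarrow> norm_n r (\<lambda>k. v k i) \<le> \<kappa>"
    and Vh: "Vh \<in> carrier_mat n r" "orthonormal_columns Vh"
    and dom: "dominant_invariant_subspace r (A + \<sigma> \<cdot>\<^sub>m Z) (mat_ran Vh)"
    and U: "solves_procrustes r Vh V1 U"
  shows "two_inf_norm (Vh * U - V1) \<le> \<eta>\<^sup>2 * \<kappa> + sqrt (real r) *
    (l + q + e * ((2 * e * \<eta> + 4 * real r * e * \<eta>) / g) + \<kappa> * (2 * e)
      + real r * ((l + 2 * e * \<eta>) * (2 * \<eta>))) / g"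
proof -
  let ?B = "A + \<sigma> \<cdot>\<^sub>m Z"
  let ?\<beta> = "l + q + e * ((2 * e * \<eta> + 4 * real r * e * \<eta>) / g) + \<kappa> * (2 * e)
      + real r * ((l + 2 * e * \<eta>) * (2 * \<eta>))"
  have B: "?B \<in> carrier_mat n n" using A Z by auto
  have Zsym: "Z $$ (i, k) = Z $$ (k, i)" if "i < n" "k < n" for i k
    using Z that by (metis carrier_matD index_transpose_mat(1))
  have Bsym: "transpose_mat ?B = ?B"
    by (rule eq_matI) (use A(1) Z(1) a_sym[unfolded a_def] Zsym in auto)
  have Bent: "?B $$ (i, k) = a i k + E i k" if "i < n" "k < n" for i k
    using that A Z by (simp add: a_def E_def)
  from dom obtain lamB W where lamB: "ordered_eigenvalues ?B lamB" and W: "W \<in> carrier_mat n r" "orthonormal_columns W"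
    "\<And>j. j < r \<Longrightarrow> eigenvector ?B (Matrix.col W j) (lamB (j + 1))" and ranW: "mat_ran Vh = mat_ran W"
    using B unfolding dominant_invariant_subspace_def by auto
  define vh where "vh = (\<lambda>j i. W $$ (i, j))"
  have vh: "orthonormal_n n r vh" unfolding vh_def by (rule orthonormal_columns_entries[OF W(1,2)])
  have mulE: "mul_n n (\<lambda>i k. ?B $$ (i, k) - a i k) x i = mul_n n E x i" if "i < n" for x i
    unfolding mul_n_def using that by (intro sum.cong refl) (simp add: Bent del: index_add_mat)
  \<comment> \<open>The locale is entered a second time with the possibly smaller constant
    \<open>g\<close>. The definition of \<open>R\<close> does not contain this constant, so
    hypothesis \<open>q\<close> speaks of the same resolvents.\<close>
  have gapped: "gapped_eigenbasis n r a v ev g"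
  proof
    show "ev k + g \<le> ev j" if "j < r" "r \<le> k" "k < n" for j k using lam_gap[OF that] g(2) by linarith
  qed (use a_sym v_orthonormal v_eig r g in auto)
  interpret pe: perturbed_eigenbasis n r a v ev g E e vh "\<lambda>j. lamB (j + 1)" \<eta>
  proof (intro perturbed_eigenbasis.intro perturbed_eigenbasis_axioms.intro gapped)
    fix j i assume j: "j < r" and i: "i < n"
    have "(?B *\<^sub>v Matrix.col W j) $ i = (lamB (j + 1) \<cdot>\<^sub>v Matrix.col W j) $ i"
      using W(3)[OF j] by (simp add: eigenvector_def)
    also have "(?B *\<^sub>v Matrix.col W j) $ i = (\<Sum>k<n. ?B $$ (i, k) * W $$ (k, j))"
      using B W(1) i j by (simp add: scalar_prod_def atLeast0LessThan del: index_add_mat)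
    also have "\<dots> = mul_n n a (vh j) i + mul_n n E (vh j) i"
      unfolding mul_n_def sum.distrib[symmetric] using i
      by (intro sum.cong refl) (simp add: Bent vh_def algebra_simps del: index_add_mat)
    finally show "mul_n n a (vh j) i + mul_n n E (vh j) i = lamB (j + 1) * vh j i"
      using W(1) i j by (simp add: vh_def)
  next
    fix j k assume jk: "j < r" "r \<le> k" "k < n"
    have "lam r - e \<le> lamB (j + 1)"
    proof (rule weyl_bound[OF B Bsym lamB _ jk(1)])
      fix x
      have "norm_n n (mul_n n (\<lambda>i k. ?B $$ (i, k) - a i k) x) = norm_n n (mul_n n E x)"
        by (rule norm_n_cong) (rule mulE)
      then show "norm_n n (mul_n n (\<lambda>i k. ?B $$ (i, k) - a i k) x) \<le> e * norm_n n x" using e(2) by simp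
    qed
    moreover have "ev k \<le> lam (r + 1)" using ev_mono[OF jk(2,3)] by (simp add: ev_def)
    ultimately show "ev k + (g - e) \<le> lamB (j + 1)" using g(2) by linarith
  qed (use e vh \<eta> in auto)
  note proc = procrustes_optimality[OF Vh U]
  note X = orthonormal_mult[OF Vh proc(1)]
  have Uc: "U \<in> carrier_mat r r" using proc(1) by (simp add: orthogonal_mats_def)
  define x where "x = (\<lambda>j i. (Vh * U) $$ (i, j))"
  \<comment> \<open>The columns of Vh U are in general not eigenvectors. Only the range of Vh
    matters, and it is spanned by the eigenvector matrix \<open>W\<close>.\<close>
  have x_ran: "x j \<in> pe.ran" if j: "j < r" for j
  proof -
    have "Matrix.col (Vh * U) j = Vh *\<^sub>v Matrix.col U j" using Vh(1) Uc j by (intro col_mult2) auto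
    then have "Matrix.col (Vh * U) j \<in> mat_ran Vh"
      unfolding mat_ran_def using Vh(1) Uc by (auto intro!: exI[of _ "Matrix.col U j"] carrier_vecI)
    then obtain c where c: "c \<in> carrier_vec r" "Matrix.col (Vh * U) j = W *\<^sub>v c"
      unfolding ranW using W(1) by (auto simp: mat_ran_def)
    have "x j i = (\<Sum>k<r. c $ k * vh k i)" if i: "i < n" for i
    proof -
      have "x j i = Matrix.col (Vh * U) j $ i" using Vh(1) Uc i j by (simp add: x_def)
      also have "\<dots> = (\<Sum>k<r. c $ k * vh k i)"
        unfolding c(2) using W(1) c(1) i by (simp add: vh_def scalar_prod_def atLeast0LessThan mult.commute)
      finally show ?thesis .
    qed
    then show ?thesis by (rule pe.ranI)
  qed
  have x_on: "orthonormal_n n r x" unfolding x_def by (rule orthonormal_columns_entries[OF X])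
  have Seq: "S (Vh * U) k j = inner_n n (v k) (x j)" for j k by (simp add: S_def x_def)
  show ?thesis
  proof (rule two_inf_norm_le)
    fix i assume "i < dim_row (Vh * U - V1)"
    then have i: "i < n" using V1(1) by simp
    have "norm_n (dim_col (Vh * U - V1)) (\<lambda>j. (Vh * U - V1) $$ (i, j)) = norm_n r (\<lambda>j. x j i - v j i)"
    proof -
      have "dim_col (Vh * U - V1) = r" using V1(1) by simp
      then show ?thesis using i X(1) V1(1) by (auto simp: x_def v_def intro!: norm_n_cong)
    qed
    also have "\<dots> \<le> \<eta>\<^sup>2 * norm_n r (\<lambda>k. v k i) + norm_n r (\<lambda>k. pe.f k i)"
    proof (rule pe.row_bound[OF x_ran x_on _ _ i])
      show "inner_n n (v k) (x j) = inner_n n (v j) (x k)" if "j < r" "k < r" for j k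
        using proc(2)[OF that] by (simp add: Seq)
      show "0 \<le> (\<Sum>k<r. \<Sum>j<r. c k * inner_n n (v k) (x j) * c j)" for c
        using proc(3)[of c] unfolding inner_n_def[of r] mul_n_def Seq sum_distrib_left by (simp only: mult.assoc)
    qed
    also have "\<dots> \<le> \<eta>\<^sup>2 * \<kappa> + sqrt (real r) * ?\<beta> / g"
    proof (intro add_mono mult_left_mono \<kappa> i)
      have "g * norm_n r (\<lambda>k. pe.f k i) \<le> sqrt (real r) * ?\<beta>"
      proof (rule sep_on_row_bound[OF pe.f_orth _ _ g(3) i])
        fix i' assume i': "i' < n"
        have entry: "\<bar>ev j * pe.f j i' - mul_n n a (pe.f j) i'\<bar> \<le> ?\<beta>" if j: "j < r" for j
          by (rule pe.sylvester_entry_bound[OF j i']) (use l q \<kappa> i' j in \<open>auto simp: pe.w_def\<close>)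
        have "0 \<le> ?\<beta>" using entry[of 0] r by linarith
        then show "norm_n r (\<lambda>j. ev j * pe.f j i' - mul_n n a (pe.f j) i') \<le> sqrt (real r) * ?\<beta>"
          using entry by (intro norm_n_le_sqrt_bound) auto
      qed (use g in auto)
      then show "norm_n r (\<lambda>k. pe.f k i) \<le> sqrt (real r) * ?\<beta> / g" using g(1) by (simp add: field_simps)
    qed simp
    finally show "norm_n (dim_col (Vh * U - V1)) (\<lambda>j. (Vh * U - V1) $$ (i, j))
        \<le> \<eta>\<^sup>2 * \<kappa> + sqrt (real r) * ?\<beta> / g" .
  qed (use V1(1) r in simp)
qed

lemma trivial_bound:
  assumes "Vh \<in> carrier_mat n r" "orthonormal_columns Vh" "solves_procrustes r Vh V1 U"
  shows "two_inf_norm (Vh * U - V1) \<le> 2"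
proof (rule two_inf_norm_le)
  note X = orthonormal_mult[OF assms(1,2) procrustes_optimality(1)[OF assms]]
  fix i assume "i < dim_row (Vh * U - V1)"
  then have i: "i < n" using V1(1) by simp
  have "dim_col (Vh * U - V1) = r" using V1(1) by simp
  then have "norm_n (dim_col (Vh * U - V1)) (\<lambda>j. (Vh * U - V1) $$ (i, j))
      = norm_n r (\<lambda>j. (Vh * U) $$ (i, j) - V1 $$ (i, j))"
    using i V1(1) by (auto intro!: norm_n_cong)
  also have "\<dots> \<le> norm_n r (\<lambda>j. (Vh * U) $$ (i, j)) + norm_n r (\<lambda>j. V1 $$ (i, j))" by (rule norm_n_diff)
  also have "\<dots> \<le> 1 + 1"
    using orthonormal_n_row[OF orthonormal_columns_entries[OF X] i]
      orthonormal_n_row[OF orthonormal_columns_entries[OF V1(1,2)] i] by (rule add_mono)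
  finally show "norm_n (dim_col (Vh * U - V1)) (\<lambda>j. (Vh * U - V1) $$ (i, j)) \<le> 2" by simp
qed (use V1(1) r in simp)

text \<open>Sum the squared entries of V1 by columns and by rows. With \<open>\<kappa>\<close> = K1
  / sqrt n this bounds the rank by K1^2, independently of n.\<close>

lemma rank_le:
  assumes "\<And>i. i < n \<Longrightarrow> norm_n r (\<lambda>k. v k i) \<le> \<kappa>"
  shows "real r \<le> real n * \<kappa>\<^sup>2"
proof -
  have "real r = (\<Sum>j<r. inner_n n (v j) (v j))" using orthonormal_nD[OF v_r] by simp
  also have "\<dots> = (\<Sum>i<n. inner_n r (\<lambda>j. v j i) (\<lambda>j. v j i))" unfolding inner_n_def by (rule sum.swap)
  also have "\<dots> \<le> (\<Sum>i<n. \<kappa>\<^sup>2)"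
    unfolding norm_n_sq[symmetric] using assms by (intro sum_mono power_mono) auto
  finally show ?thesis by simp
qed

end

subsection \<open>Gaussian linear forms with independent coefficients\<close>

definition std_normal :: "real measure" where
  "std_normal = density lborel (\<lambda>x. ennreal (std_normal_density x))"

lemma prob_space_std_normal: "prob_space std_normal"
  unfolding std_normal_def by (rule prob_space_normal_density) simp

lemma sets_std_normal [simp, measurable_cong]: "sets std_normal = sets borel"
  by (simp add: std_normal_def)

lemma space_std_normal [simp]: "space std_normal = UNIV"
  by (simp add: std_normal_def)

text \<open>Tilting the standard normal density by this exponential shifts its mean to
  \<open>y\<close>, so the total mass stays 1.\<close>

lemma std_normal_exp: "(\<integral>\<^sup>+x. ennreal (exp (y * x - y\<^sup>2 / 2)) \<partial>std_normal) = 1"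
proof -
  have "(\<integral>\<^sup>+x. ennreal (exp (y * x - y\<^sup>2 / 2)) \<partial>std_normal)
      = (\<integral>\<^sup>+x. ennreal (std_normal_density x) * ennreal (exp (y * x - y\<^sup>2 / 2)) \<partial>lborel)"
    unfolding std_normal_def by (rule nn_integral_density) auto
  also have "\<dots> = (\<integral>\<^sup>+x. ennreal (normal_density y 1 x) \<partial>lborel)"
  proof (rule nn_integral_cong)
    fix x :: real
    have "std_normal_density x * exp (y * x - y\<^sup>2 / 2) = normal_density y 1 x"
      unfolding normal_density_def by (simp add: exp_add[symmetric] power2_eq_square algebra_simps diff_divide_distrib add_divide_distrib)
    then show "ennreal (std_normal_density x) * ennreal (exp (y * x - y\<^sup>2 / 2)) = ennreal (normal_density y 1 x)"
      by (simp add: ennreal_mult'[symmetric])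
  qed
  also have "\<dots> = ennreal (\<integral>x. normal_density y 1 x \<partial>lborel)"
    by (rule nn_integral_eq_integral) auto
  finally show ?thesis by simp
qed

context prob_space
begin

definition std_gaussians :: "'i set \<Rightarrow> ('i \<Rightarrow> 'a \<Rightarrow> real) \<Rightarrow> bool" where
  "std_gaussians I X \<longleftrightarrow> finite I \<and> indep_vars (\<lambda>_. borel) X I \<and>
     (\<forall>i\<in>I. distributed M lborel (X i) (\<lambda>x. ennreal (std_normal_density x)))"

lemma std_gaussians_measurable: "std_gaussians I X \<Longrightarrow> i \<in> I \<Longrightarrow> X i \<in> borel_measurable M"
  unfolding std_gaussians_def indep_vars_def by auto

lemma std_gaussians_distr:
  assumes X: "std_gaussians I X" and J: "J \<subseteq> I"
  shows "distr M (PiM J (\<lambda>_. borel)) (\<lambda>\<omega>. \<lambda>i\<in>J. X i \<omega>) = PiM J (\<lambda>_. std_normal)"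
\<comment> \<open>The empty index set does occur: for linear forms J = I, and
  \<open>gaussian_exponential\<close> also uses this lemma for I - J.\<close>
proof (cases "J = {}")
  case True
  let ?D = "distr M (PiM {} (\<lambda>_. borel :: real measure)) (\<lambda>\<omega>. \<lambda>i\<in>{}. X i \<omega>)"
  interpret D: prob_space ?D
    by (rule prob_space_distr) (rule measurable_restrict, simp)
  interpret N: prob_space "PiM ({} :: 'b set) (\<lambda>_. std_normal)"
    by (rule prob_space_PiM) (rule prob_space_std_normal)
  show ?thesis unfolding True
  proof (rule measure_eqI)
    fix A assume "A \<in> sets ?D"
    then consider "A = {}" | "A = {\<lambda>k. undefined}" by (auto simp: sets_PiM_empty)
    then show "emeasure ?D A = emeasure (PiM {} (\<lambda>_. std_normal)) A"
      using D.emeasure_space_1 N.emeasure_space_1 by cases (auto simp: space_PiM_empty)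
  qed (simp add: sets_PiM_empty)
next
  case False
  have ind: "indep_vars (\<lambda>_. borel) X J"
    using X J indep_vars_subset unfolding std_gaussians_def by blast
  have rv: "X i \<in> borel_measurable M" if "i \<in> J" for i using std_gaussians_measurable[OF X] J that by auto
  have "distr M borel (X i) = std_normal" if "i \<in> J" for i
  proof -
    have "distr M lborel (X i) = std_normal"
      using X J that unfolding std_gaussians_def std_normal_def
      by (intro distributed_distr_eq_density) auto
    then show ?thesis by (metis distr_cong sets_lborel)
  qed
  then have "(\<Pi>\<^sub>M i\<in>J. distr M borel (X i)) = PiM J (\<lambda>_. std_normal)" by (intro PiM_cong) auto
  then show ?thesis using indep_vars_iff_distr_eq_PiM'[of J X "\<lambda>_. borel"] False rv ind by simp
qed

text \<open>Conditionally on the variables outside \<open>J\<close>, the sum of the \<open>Y i * X i\<close> is a centred Gaussian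
  with variance the sum of the \<open>(Y i)\<^sup>2\<close>.\<close>

lemma gaussian_exponential:
  assumes X: "std_gaussians I X" and J: "J \<subseteq> I"
    and h: "\<And>i. i \<in> J \<Longrightarrow> h i \<in> borel_measurable (PiM (I - J) (\<lambda>_. borel))"
  defines "Y i \<omega> \<equiv> h i (\<lambda>k\<in>I - J. X k \<omega>)"
  shows "(\<integral>\<^sup>+\<omega>. ennreal (exp (\<Sum>i\<in>J. Y i \<omega> * X i \<omega> - (Y i \<omega>)\<^sup>2 / 2)) \<partial>M) = 1"
proof -
  let ?BJ = "PiM J (\<lambda>_. borel :: real measure)" and ?BK = "PiM (I - J) (\<lambda>_. borel :: real measure)"
  let ?NJ = "PiM J (\<lambda>_. std_normal)" and ?NK = "PiM (I - J) (\<lambda>_. std_normal)"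
  let ?XJ = "\<lambda>\<omega>. \<lambda>i\<in>J. X i \<omega>" and ?XK = "\<lambda>\<omega>. \<lambda>i\<in>I - J. X i \<omega>"
  have fin: "finite J" using X J finite_subset unfolding std_gaussians_def by blast
  interpret N: prob_space std_normal by (rule prob_space_std_normal)
  interpret NJ: product_prob_space "\<lambda>_. std_normal" J ..
  have PJ: "prob_space ?NJ" by (rule prob_space_PiM) (rule prob_space_std_normal)
  have PK: "prob_space ?NK" by (rule prob_space_PiM) (rule prob_space_std_normal)
  have "indep_var ?BK ?XK ?BJ ?XJ"
    using X J by (intro indep_var_restrict[of _ X I]) (auto simp: std_gaussians_def)
  then have rvJ: "?XJ \<in> measurable M ?BJ" and rvK: "?XK \<in> measurable M ?BK"
    and joint: "distr M ?BK ?XK \<Otimes>\<^sub>M distr M ?BJ ?XJ = distr M (?BK \<Otimes>\<^sub>M ?BJ) (\<lambda>\<omega>. (?XK \<omega>, ?XJ \<omega>))"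
    unfolding indep_var_distribution_eq by auto
  note h[measurable]
  let ?F = "\<lambda>p. ennreal (exp (\<Sum>i\<in>J. h i (fst p) * snd p i - (h i (fst p))\<^sup>2 / 2))"
  have F: "?F \<in> borel_measurable (?BK \<Otimes>\<^sub>M ?BJ)" by measurable
  have "(\<integral>\<^sup>+\<omega>. ennreal (exp (\<Sum>i\<in>J. Y i \<omega> * X i \<omega> - (Y i \<omega>)\<^sup>2 / 2)) \<partial>M) = (\<integral>\<^sup>+\<omega>. ?F (?XK \<omega>, ?XJ \<omega>) \<partial>M)"
    by (intro nn_integral_cong) (simp add: Y_def)
  also have "\<dots> = (\<integral>\<^sup>+p. ?F p \<partial>distr M (?BK \<Otimes>\<^sub>M ?BJ) (\<lambda>\<omega>. (?XK \<omega>, ?XJ \<omega>)))"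
    using rvJ rvK F by (subst nn_integral_distr) auto
  also have "\<dots> = (\<integral>\<^sup>+p. ?F p \<partial>(?NK \<Otimes>\<^sub>M ?NJ))"
    unfolding joint[symmetric] using std_gaussians_distr[OF X J] std_gaussians_distr[OF X, of "I - J"] by simp
  \<comment> \<open>With the coefficients frozen at \<open>x\<close>, the inner integral factors
    over \<open>J\<close>, and every factor is 1 by \<open>std_normal_exp\<close>.\<close>
  also have "\<dots> = (\<integral>\<^sup>+x. \<integral>\<^sup>+y. ?F (x, y) \<partial>?NJ \<partial>?NK)"
    by (rule sigma_finite_measure.nn_integral_fst[OF prob_space_imp_sigma_finite[OF PJ], symmetric]) (use F in \<open>simp cong: measurable_cong_sets\<close>)
  also have "\<dots> = (\<integral>\<^sup>+x. 1 \<partial>?NK)"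
  proof (rule nn_integral_cong)
    fix x
    have "(\<integral>\<^sup>+y. ?F (x, y) \<partial>?NJ) = (\<integral>\<^sup>+y. (\<Prod>i\<in>J. ennreal (exp (h i x * y i - (h i x)\<^sup>2 / 2))) \<partial>?NJ)"
      by (simp add: exp_sum[OF fin] prod_ennreal)
    also have "\<dots> = (\<Prod>i\<in>J. \<integral>\<^sup>+y. ennreal (exp (h i x * y - (h i x)\<^sup>2 / 2)) \<partial>std_normal)"
      by (rule NJ.product_nn_integral_prod[OF fin]) simp
    finally show "(\<integral>\<^sup>+y. ?F (x, y) \<partial>?NJ) = 1" by (simp add: std_normal_exp)
  qed
  also have "\<dots> = 1" by (simp add: prob_space.emeasure_space_1[OF PK])
  finally show ?thesis .
qed

text \<open>A Chernoff bound for random variance: since the variance constraint is part of the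
  event, the compensator s^2 / 2 times the sum of the (Y i)^2 is at most a constant there. The
  choice s = u / B optimises the exponent.\<close>

lemma gaussian_tail_one_sided:
  assumes X: "std_gaussians I X" and J: "J \<subseteq> I"
    and h: "\<And>i. i \<in> J \<Longrightarrow> h i \<in> borel_measurable (PiM (I - J) (\<lambda>_. borel))"
    and B: "0 < B" and u: "0 \<le> u"
  defines "Y i \<omega> \<equiv> h i (\<lambda>k\<in>I - J. X k \<omega>)"
  shows "prob {\<omega>\<in>space M. (\<Sum>i\<in>J. Y i \<omega> * X i \<omega>) \<ge> u * B \<and> (\<Sum>i\<in>J. (Y i \<omega>)\<^sup>2) \<le> B\<^sup>2} \<le> exp (- u\<^sup>2 / 2)"
proof -
  define s where "s = u / B"
  let ?S = "{\<omega>\<in>space M. (\<Sum>i\<in>J. Y i \<omega> * X i \<omega>) \<ge> u * B \<and> (\<Sum>i\<in>J. (Y i \<omega>)\<^sup>2) \<le> B\<^sup>2}"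
  let ?G = "\<lambda>\<omega>. \<Sum>i\<in>J. (s * Y i \<omega>) * X i \<omega> - (s * Y i \<omega>)\<^sup>2 / 2"
  have rvK: "(\<lambda>\<omega>. \<lambda>k\<in>I - J. X k \<omega>) \<in> measurable M (PiM (I - J) (\<lambda>_. borel))"
    using std_gaussians_measurable[OF X] by (intro measurable_restrict) auto
  have Ym: "Y i \<in> borel_measurable M" if "i \<in> J" for i
    unfolding Y_def using measurable_compose[OF rvK h[OF that]] by simp
  have Xm: "X i \<in> borel_measurable M" if "i \<in> J" for i
    using std_gaussians_measurable[OF X] J that by auto
  note Ym[measurable] Xm[measurable]
  have "(\<integral>\<^sup>+\<omega>. ennreal (exp (?G \<omega>)) \<partial>M) = 1"
    using gaussian_exponential[OF X J, of "\<lambda>i x. s * h i x"] h unfolding Y_def by simp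
  moreover have "ennreal (exp (u\<^sup>2 / 2)) * indicator ?S \<omega> \<le> ennreal (exp (?G \<omega>))" if "\<omega> \<in> space M" for \<omega>
  proof (cases "\<omega> \<in> ?S")
    case True
    then have 1: "(\<Sum>i\<in>J. Y i \<omega> * X i \<omega>) \<ge> u * B" and 2: "(\<Sum>i\<in>J. (Y i \<omega>)\<^sup>2) \<le> B\<^sup>2" by auto
    have "?G \<omega> = s * (\<Sum>i\<in>J. Y i \<omega> * X i \<omega>) - s\<^sup>2 / 2 * (\<Sum>i\<in>J. (Y i \<omega>)\<^sup>2)"
      unfolding sum_subtractf sum_distrib_left by (simp add: power_mult_distrib mult.assoc)
    also have "\<dots> \<ge> s * (u * B) - s\<^sup>2 / 2 * B\<^sup>2"
      using mult_left_mono[OF 1, of s] mult_left_mono[OF 2, of "s\<^sup>2 / 2"] u B by (simp add: s_def)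
    also have "s * (u * B) - s\<^sup>2 / 2 * B\<^sup>2 = u\<^sup>2 / 2"
      using B by (simp add: s_def power2_eq_square field_simps)
    finally show ?thesis using True by (simp add: ennreal_leI)
  qed simp
  then have "(\<integral>\<^sup>+\<omega>. ennreal (exp (u\<^sup>2 / 2)) * indicator ?S \<omega> \<partial>M) \<le> (\<integral>\<^sup>+\<omega>. ennreal (exp (?G \<omega>)) \<partial>M)"
    by (rule nn_integral_mono)
  moreover have S: "?S \<in> sets M" by measurable
  then have "(\<integral>\<^sup>+\<omega>. ennreal (exp (u\<^sup>2 / 2)) * indicator ?S \<omega> \<partial>M) = ennreal (exp (u\<^sup>2 / 2) * prob ?S)"
    by (simp add: nn_integral_cmult_indicator emeasure_eq_measure ennreal_mult')
  ultimately have "exp (u\<^sup>2 / 2) * prob ?S \<le> 1" by simp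
  then have "exp (- (u\<^sup>2 / 2)) * (exp (u\<^sup>2 / 2) * prob ?S) \<le> exp (- (u\<^sup>2 / 2)) * 1"
    by (intro mult_left_mono) auto
  then show ?thesis by (simp add: mult.assoc[symmetric] exp_add[symmetric])
qed

lemma gaussian_tail:
  assumes X: "std_gaussians I X" and J: "J \<subseteq> I"
    and h: "\<And>i. i \<in> J \<Longrightarrow> h i \<in> borel_measurable (PiM (I - J) (\<lambda>_. borel))"
    and B: "0 < B" and u: "0 \<le> u"
  defines "Y i \<omega> \<equiv> h i (\<lambda>k\<in>I - J. X k \<omega>)"
  defines "T \<equiv> {\<omega>\<in>space M. \<bar>\<Sum>i\<in>J. Y i \<omega> * X i \<omega>\<bar> \<ge> u * B \<and> (\<Sum>i\<in>J. (Y i \<omega>)\<^sup>2) \<le> B\<^sup>2}"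
  shows "T \<in> sets M" "prob T \<le> 2 * exp (- u\<^sup>2 / 2)"
proof -
  let ?S = "\<lambda>c. {\<omega>\<in>space M. (\<Sum>i\<in>J. (c * Y i \<omega>) * X i \<omega>) \<ge> u * B \<and> (\<Sum>i\<in>J. (c * Y i \<omega>)\<^sup>2) \<le> B\<^sup>2}"
  have rvK: "(\<lambda>\<omega>. \<lambda>k\<in>I - J. X k \<omega>) \<in> measurable M (PiM (I - J) (\<lambda>_. borel))"
    using std_gaussians_measurable[OF X] by (intro measurable_restrict) auto
  have Ym: "Y i \<in> borel_measurable M" if "i \<in> J" for i
    unfolding Y_def using measurable_compose[OF rvK h[OF that]] by simp
  have Xm: "X i \<in> borel_measurable M" if "i \<in> J" for i
    using std_gaussians_measurable[OF X] J that by auto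
  note Ym[measurable] Xm[measurable]
  show "T \<in> sets M" unfolding T_def by measurable
  have Sm: "?S c \<in> sets M" for c by measurable
  have "T \<subseteq> ?S 1 \<union> ?S (-1)"
    unfolding T_def by (auto simp: sum_negf abs_if split: if_splits)
  then have "prob T \<le> prob (?S 1 \<union> ?S (-1))" using Sm by (intro finite_measure_mono) auto
  also have "\<dots> \<le> prob (?S 1) + prob (?S (-1))" using Sm by (intro measure_Un_le) auto
  also have "\<dots> \<le> exp (- u\<^sup>2 / 2) + exp (- u\<^sup>2 / 2)"
    unfolding Y_def using h
    by (intro add_mono gaussian_tail_one_sided[OF X J _ B u, where h = "\<lambda>i x. _ * h i x"]) auto
  finally show "prob T \<le> 2 * exp (- u\<^sup>2 / 2)" by simp
qed

end

subsection \<open>The operator norm via an integer net\<close>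

text \<open>Dividing the net by \<open>4 \<surd>n\<close> gives a \<open>1/4\<close>-net of the unit ball, by rounding coordinates towards
  zero. Its cardinality is bounded by weighting the point \<open>p\<close> with \<open>exp (16 n - \<parallel>p\<parallel>\<^sup>2)\<close>.\<close>

definition int_net :: "nat \<Rightarrow> (nat \<Rightarrow> int) set" where
  "int_net n = {p \<in> {..<n} \<rightarrow>\<^sub>E {- 4 * int n..4 * int n}. (\<Sum>a<n. (p a)\<^sup>2) \<le> 16 * int n}"

lemma finite_int_net: "finite (int_net n)"
  unfolding int_net_def by (rule finite_subset[OF _ finite_PiE[of "{..<n}" "\<lambda>_. {- 4 * int n..4 * int n}"]]) auto

text \<open>exp (- k^2) <= 2^(-|k|) reduces the sum to two geometric series and a central term, at
  most 1 + 2 = 3.\<close>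

lemma sum_exp_neg_square_le: "(\<Sum>k\<in>{- int m..int m}. exp (- (real_of_int k)\<^sup>2)) \<le> 3"
proof -
  have "exp (- (real_of_int k)\<^sup>2) \<le> (1 / 2) ^ nat \<bar>k\<bar>" for k
  proof -
    have "real (nat \<bar>k\<bar>) \<le> (real_of_int k)\<^sup>2"
    proof (cases "k = 0")
      case False
      then have "\<bar>k\<bar> * 1 \<le> \<bar>k\<bar> * \<bar>k\<bar>" by (intro mult_left_mono) auto
      then have "real_of_int \<bar>k\<bar> \<le> real_of_int (\<bar>k\<bar> * \<bar>k\<bar>)" by (intro of_int_le_iff[THEN iffD2]) simp
      then show ?thesis by (simp add: power2_eq_square)
    qed simp
    then have "exp (- (real_of_int k)\<^sup>2) \<le> exp (real (nat \<bar>k\<bar>) * (- 1))" by simp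
    also have "\<dots> = exp (- 1) ^ nat \<bar>k\<bar>" by (rule exp_of_nat_mult)
    also have "\<dots> \<le> (1 / 2) ^ nat \<bar>k\<bar>"
      using exp_ge_add_one_self[of 1] by (intro power_mono) (simp_all add: exp_minus field_simps)
    finally show ?thesis .
  qed
  then have "(\<Sum>k\<in>{- int m..int m}. exp (- (real_of_int k)\<^sup>2)) \<le> (\<Sum>k\<in>{- int m..int m}. (1 / 2) ^ nat \<bar>k\<bar>)"
    by (rule sum_mono)
  also have "\<dots> = 3 - 2 * (1 / 2) ^ m"
  proof (induction m)
    case (Suc m)
    have "{- int (Suc m)..int (Suc m)} = insert (- int (Suc m)) (insert (int (Suc m)) {- int m..int m})" by auto
    moreover have "nat (1 + int m) = Suc m" by simp
    ultimately show ?case using Suc by (simp add: add.commute[of 1])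
  qed simp
  also have "\<dots> \<le> 3" by simp
  finally show ?thesis .
qed

text \<open>The exponent 18 is 16 from the weight plus 2, because each coordinate contributes a
  factor of at most 3 <= exp 2.\<close>

lemma card_int_net: "real (card (int_net n)) \<le> exp (18 * real n)"
proof -
  let ?B = "{- 4 * int n..4 * int n}"
  have "real (card (int_net n)) = (\<Sum>p\<in>int_net n. 1)" by simp
  also have "\<dots> \<le> (\<Sum>p\<in>int_net n. exp (16 * real n) * (\<Prod>a<n. exp (- (real_of_int (p a))\<^sup>2)))"
  proof (rule sum_mono)
    fix p assume "p \<in> int_net n"
    then have "(\<Sum>a<n. (p a)\<^sup>2) \<le> 16 * int n" by (simp add: int_net_def)
    then have "real_of_int (\<Sum>a<n. (p a)\<^sup>2) \<le> real_of_int (16 * int n)" by (intro of_int_le_iff[THEN iffD2])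
    then have "1 \<le> exp (16 * real n + (\<Sum>a<n. - (real_of_int (p a))\<^sup>2))"
      by (simp add: sum_negf)
    then show "1 \<le> exp (16 * real n) * (\<Prod>a<n. exp (- (real_of_int (p a))\<^sup>2))"
      by (simp add: exp_add exp_sum)
  qed
  also have "\<dots> \<le> (\<Sum>p\<in>{..<n} \<rightarrow>\<^sub>E ?B. exp (16 * real n) * (\<Prod>a<n. exp (- (real_of_int (p a))\<^sup>2)))"
  proof (rule sum_mono2)
    show "finite ({..<n} \<rightarrow>\<^sub>E ?B)" by (intro finite_PiE) auto
    show "int_net n \<subseteq> {..<n} \<rightarrow>\<^sub>E ?B" unfolding int_net_def by blast
  qed (intro mult_nonneg_nonneg prod_nonneg, simp_all)
  also have "\<dots> = exp (16 * real n) * (\<Prod>a<n. \<Sum>k\<in>?B. exp (- (real_of_int k)\<^sup>2))"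
    by (subst prod_sum_PiE) (simp_all add: sum_distrib_left)
  also have "\<dots> \<le> exp (16 * real n) * (\<Prod>a<n. 3)"
    using sum_exp_neg_square_le[of "4 * n"] by (intro mult_left_mono prod_mono) (auto intro!: sum_nonneg)
  also have "(\<Prod>a<n. 3 :: real) \<le> exp 2 ^ n"
    using exp_ge_add_one_self[of 2] by (simp add: power_mono)
  also have "exp 2 ^ n = exp (2 * real n)" by (simp add: exp_of_nat_mult[symmetric] mult.commute)
  finally show ?thesis by (simp add: exp_add[symmetric])
qed

text \<open>Rounding towards zero never increases an absolute value, so a rounded point stays in the
  ball that defines the net; rounding to the nearest integer would not guarantee this.\<close>

definition round_to_zero :: "real \<Rightarrow> int" where
  "round_to_zero y = (if 0 \<le> y then \<lfloor>y\<rfloor> else \<lceil>y\<rceil>)"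

lemma round_to_zero: "\<bar>real_of_int (round_to_zero y)\<bar> \<le> \<bar>y\<bar>" "\<bar>y - real_of_int (round_to_zero y)\<bar> \<le> 1"
proof -
  have "\<bar>real_of_int (round_to_zero y)\<bar> \<le> \<bar>y\<bar> \<and> \<bar>y - real_of_int (round_to_zero y)\<bar> \<le> 1"
  proof (cases "0 \<le> y")
    case True
    then have "0 \<le> real_of_int \<lfloor>y\<rfloor>" by simp
    moreover have "real_of_int \<lfloor>y\<rfloor> \<le> y" "y < real_of_int \<lfloor>y\<rfloor> + 1" by linarith+
    ultimately show ?thesis using True unfolding round_to_zero_def by (simp only: if_True) linarith
  next
    case False
    then have "real_of_int \<lceil>y\<rceil> \<le> 0" by simp
    moreover have "y \<le> real_of_int \<lceil>y\<rceil>" "real_of_int \<lceil>y\<rceil> < y + 1" by linarith+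
    ultimately show ?thesis using False unfolding round_to_zero_def by (simp only: if_False) linarith
  qed
  then show "\<bar>real_of_int (round_to_zero y)\<bar> \<le> \<bar>y\<bar>" "\<bar>y - real_of_int (round_to_zero y)\<bar> \<le> 1" by auto
qed

lemma net_approximation:
  assumes n: "n \<ge> 1" and x: "norm_n n x \<le> 1"
  obtains p where "p \<in> int_net n" "norm_n n (\<lambda>a. real_of_int (p a) / (4 * sqrt n)) \<le> 1"
    "norm_n n (\<lambda>a. x a - real_of_int (p a) / (4 * sqrt n)) \<le> 1 / 4"
proof -
  let ?t = "4 * sqrt (real n)"
  have t: "?t > 0" using n by simp
  define p where "p = (\<lambda>a\<in>{..<n}. round_to_zero (?t * x a))"
  have le: "\<bar>real_of_int (p a)\<bar> \<le> \<bar>?t * x a\<bar>" if "a < n" for a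
    using that round_to_zero(1)[of "?t * x a"] by (simp add: p_def)
  have "(\<Sum>a<n. (real_of_int (p a))\<^sup>2) \<le> (\<Sum>a<n. (?t * x a)\<^sup>2)"
    by (intro sum_mono) (use le in \<open>auto simp: abs_le_square_iff[symmetric]\<close>)
  also have "\<dots> = ?t\<^sup>2 * inner_n n x x"
    unfolding inner_n_def sum_distrib_left by (simp add: power_mult_distrib) (simp add: power2_eq_square)
  also have "inner_n n x x \<le> 1" using x by (simp add: norm_n_sq[symmetric] power_le_one)
  finally have sq: "(\<Sum>a<n. (real_of_int (p a))\<^sup>2) \<le> ?t\<^sup>2" by (simp add: mult_left_mono)
  then have "real_of_int (\<Sum>a<n. (p a)\<^sup>2) \<le> real_of_int (16 * int n)" by (simp add: power_mult_distrib)
  then have sqi: "(\<Sum>a<n. (p a)\<^sup>2) \<le> 16 * int n" by (simp only: of_int_le_iff)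
  have "p a \<in> {- 4 * int n..4 * int n}" if "a < n" for a
  proof -
    have "(p a)\<^sup>2 \<le> (\<Sum>a<n. (p a)\<^sup>2)" using that by (intro member_le_sum) auto
    also note sqi
    also have "16 * int n \<le> (4 * int n)\<^sup>2" using n by (simp add: power2_eq_square)
    finally have "\<bar>p a\<bar> \<le> \<bar>4 * int n\<bar>" by (simp only: abs_le_square_iff)
    then show ?thesis by auto
  qed
  then have "p \<in> int_net n" unfolding int_net_def using sqi by (auto simp: p_def)
  moreover have "norm_n n (\<lambda>a. real_of_int (p a) / ?t) \<le> 1"
  proof (rule power2_le_imp_le)
    have "(norm_n n (\<lambda>a. real_of_int (p a) / ?t))\<^sup>2 = (\<Sum>a<n. (real_of_int (p a))\<^sup>2) / ?t\<^sup>2"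
      unfolding norm_n_sq inner_n_def sum_divide_distrib
      by (simp only: power2_eq_square times_divide_times_eq)
    also have "\<dots> \<le> 1" using sq t by (simp add: divide_le_eq_1)
    finally show "(norm_n n (\<lambda>a. real_of_int (p a) / ?t))\<^sup>2 \<le> 1\<^sup>2" by simp
  qed simp
  moreover have "norm_n n (\<lambda>a. x a - real_of_int (p a) / ?t) \<le> sqrt (real n) * (1 / ?t)"
  proof (rule norm_n_le_sqrt_bound)
    fix a assume a: "a < n"
    have "x a - real_of_int (p a) / ?t = (?t * x a - real_of_int (p a)) / ?t" using t by (simp add: field_simps)
    then have "\<bar>x a - real_of_int (p a) / ?t\<bar> = \<bar>?t * x a - real_of_int (p a)\<bar> / ?t" using t by (simp add: abs_divide)
    also have "\<dots> \<le> 1 / ?t"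
      using round_to_zero(2)[of "?t * x a"] a t by (intro divide_right_mono) (simp_all add: p_def)
    finally show "\<bar>x a - real_of_int (p a) / ?t\<bar> \<le> 1 / ?t" .
  qed (use t in simp)
  ultimately show ?thesis using that[of p] n by simp
qed

text \<open>Let \<Lambda> be the supremum of the bilinear form over unit balls. Replacing both
  arguments by scaled net points costs \<Lambda> / 4 twice, and the scaling (4 sqrt n)^2 gives
  \<Lambda> <= \<kappa> / (16 n) + \<Lambda> / 2. The supremum is finite, so \<Lambda> / 2 can be
  absorbed.\<close>

lemma operator_norm_via_net:
  assumes n: "n \<ge> 1"
    and net: "\<And>p q. p \<in> int_net n \<Longrightarrow> q \<in> int_net n \<Longrightarrow>
      \<bar>inner_n n (\<lambda>a. real_of_int (p a)) (mul_n n A (\<lambda>a. real_of_int (q a)))\<bar> \<le> \<kappa>"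
  shows "norm_n n (mul_n n A x) \<le> \<kappa> / (8 * real n) * norm_n n x"
proof -
  define U where "U = {\<bar>inner_n n x (mul_n n A y)\<bar> | x y. norm_n n x \<le> 1 \<and> norm_n n y \<le> 1}"
  define \<Lambda> where "\<Lambda> = Sup U"
  have bdd: "bdd_above U"
  proof (rule bdd_aboveI)
    fix b assume "b \<in> U"
    then obtain x y where b: "b = \<bar>inner_n n x (mul_n n A y)\<bar>" and xy: "norm_n n x \<le> 1" "norm_n n y \<le> 1"
      unfolding U_def by blast
    have "b \<le> (\<Sum>i<n. \<bar>x i * mul_n n A y i\<bar>)" unfolding b inner_n_def by (rule sum_abs)
    also have "\<dots> \<le> (\<Sum>i<n. \<Sum>k<n. \<bar>A i k\<bar>)"
    proof (rule sum_mono)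
      fix i assume i: "i \<in> {..<n}"
      have "\<bar>mul_n n A y i\<bar> \<le> (\<Sum>k<n. \<bar>A i k * y k\<bar>)" unfolding mul_n_def by (rule sum_abs)
      also have "\<dots> \<le> (\<Sum>k<n. \<bar>A i k\<bar>)"
      proof (rule sum_mono)
        fix k assume "k \<in> {..<n}"
        then have "\<bar>y k\<bar> \<le> 1" using norm_n_component[of k n y] xy by auto
        then show "\<bar>A i k * y k\<bar> \<le> \<bar>A i k\<bar>" unfolding abs_mult by (intro mult_left_le) auto
      qed
      finally have *: "\<bar>mul_n n A y i\<bar> \<le> (\<Sum>k<n. \<bar>A i k\<bar>)" .
      have "\<bar>x i\<bar> \<le> 1" using norm_n_component[of i n x] xy i by auto
      then have "\<bar>x i * mul_n n A y i\<bar> \<le> \<bar>mul_n n A y i\<bar>" unfolding abs_mult by (intro mult_left_le_one_le) auto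
      with * show "\<bar>x i * mul_n n A y i\<bar> \<le> (\<Sum>k<n. \<bar>A i k\<bar>)" by linarith
    qed
    finally show "b \<le> (\<Sum>i<n. \<Sum>k<n. \<bar>A i k\<bar>)" .
  qed
  have \<Lambda>: "\<bar>inner_n n x (mul_n n A y)\<bar> \<le> \<Lambda>" if "norm_n n x \<le> 1" "norm_n n y \<le> 1" for x y
    unfolding \<Lambda>_def by (rule cSup_upper[OF _ bdd]) (use that in \<open>auto simp: U_def\<close>)
  have zero: "norm_n n (\<lambda>_. 0) \<le> 1" by (simp add: norm_n_def L2_set_def)
  have "U \<noteq> {}" unfolding U_def using zero by blast
  have \<Lambda>0: "0 \<le> \<Lambda>" using \<Lambda>[OF zero zero] by linarith
  have scaled: "\<bar>inner_n n x (mul_n n A y)\<bar> \<le> \<Lambda> * a * b"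
    if "norm_n n x \<le> a" "norm_n n y \<le> b" "a > 0" "b > 0" for x y a b
  proof -
    have "norm_n n (\<lambda>i. (1 / a) * x i) \<le> 1" "norm_n n (\<lambda>i. (1 / b) * y i) \<le> 1"
      unfolding norm_n_scale using that by (auto simp: field_simps)
    from \<Lambda>[OF this] have "\<bar>(1 / a) * ((1 / b) * inner_n n x (mul_n n A y))\<bar> \<le> \<Lambda>"
      unfolding mul_n_scale[abs_def] inner_n_linear by simp
    then show ?thesis using that by (simp add: abs_mult field_simps)
  qed
  have "\<Lambda> \<le> \<kappa> / (16 * real n) + \<Lambda> / 2"
    unfolding \<Lambda>_def
  proof (rule cSup_least[OF \<open>U \<noteq> {}\<close>], fold \<Lambda>_def)
    fix b assume "b \<in> U"
    then obtain x y where b: "b = \<bar>inner_n n x (mul_n n A y)\<bar>" and x: "norm_n n x \<le> 1" and y: "norm_n n y \<le> 1"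
      unfolding U_def by blast
    obtain p where p: "p \<in> int_net n" "norm_n n (\<lambda>a. real_of_int (p a) / (4 * sqrt n)) \<le> 1"
      "norm_n n (\<lambda>a. x a - real_of_int (p a) / (4 * sqrt n)) \<le> 1 / 4"
      using net_approximation[OF n x] by blast
    obtain q where q: "q \<in> int_net n" "norm_n n (\<lambda>a. real_of_int (q a) / (4 * sqrt n)) \<le> 1"
      "norm_n n (\<lambda>a. y a - real_of_int (q a) / (4 * sqrt n)) \<le> 1 / 4"
      using net_approximation[OF n y] by blast
    let ?p = "\<lambda>a. real_of_int (p a) / (4 * sqrt n)" and ?q = "\<lambda>a. real_of_int (q a) / (4 * sqrt n)"
    have split: "inner_n n x (mul_n n A y) = inner_n n ?p (mul_n n A ?q)
        + inner_n n ?p (mul_n n A (\<lambda>a. y a - ?q a)) + inner_n n (\<lambda>a. x a - ?p a) (mul_n n A y)"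
      unfolding mul_n_diff[abs_def] inner_n_linear by simp
    have eq: "?p = (\<lambda>a. (1 / (4 * sqrt n)) * real_of_int (p a))" "?q = (\<lambda>a. (1 / (4 * sqrt n)) * real_of_int (q a))"
      by simp_all
    have "inner_n n ?p (mul_n n A ?q)
        = inner_n n (\<lambda>a. real_of_int (p a)) (mul_n n A (\<lambda>a. real_of_int (q a))) / (16 * real n)"
      unfolding eq mul_n_scale[abs_def] inner_n_linear by (simp add: field_simps)
    then have "\<bar>inner_n n ?p (mul_n n A ?q)\<bar> \<le> \<kappa> / (16 * real n)"
      using net[OF p(1) q(1)] by (simp add: abs_divide divide_right_mono)
    moreover have "\<bar>inner_n n ?p (mul_n n A (\<lambda>a. y a - ?q a))\<bar> \<le> \<Lambda> / 4"
      using scaled[OF p(2) q(3)] by simp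
    moreover have "\<bar>inner_n n (\<lambda>a. x a - ?p a) (mul_n n A y)\<bar> \<le> \<Lambda> / 4"
      using scaled[OF p(3) y] by simp
    ultimately show "b \<le> \<kappa> / (16 * real n) + \<Lambda> / 2" unfolding b split by linarith
  qed
  then have \<Lambda>\<kappa>: "\<Lambda> \<le> \<kappa> / (8 * real n)" by (simp add: field_simps)
  have "norm_n n (mul_n n A x) \<le> \<Lambda> * norm_n n x"
  proof (cases "norm_n n x = 0 \<or> norm_n n (mul_n n A x) = 0")
    case True
    then have "norm_n n (mul_n n A x) = 0"
      by (auto simp: norm_n_eq_0 mul_n_def)
    then show ?thesis using \<Lambda>0 by simp
  next
    case False
    then have "norm_n n x > 0" "norm_n n (mul_n n A x) > 0"
      using norm_n_nonneg[of n x] norm_n_nonneg[of n "mul_n n A x"] by linarith+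
    then have "inner_n n (mul_n n A x) (mul_n n A x) \<le> (\<Lambda> * norm_n n x) * norm_n n (mul_n n A x)"
      using scaled[of "mul_n n A x" _ x, OF order_refl order_refl] by (simp add: abs_le_iff ac_simps)
    then show ?thesis by (rule norm_n_le_of_inner) (use \<Lambda>0 in simp)
  qed
  also have "\<dots> \<le> \<kappa> / (8 * real n) * norm_n n x" by (intro mult_right_mono \<Lambda>\<kappa>) simp
  finally show ?thesis .
qed

subsection \<open>Symmetric Gaussian matrices\<close>

definition upper_pairs :: "nat \<Rightarrow> (nat \<times> nat) set" where
  "upper_pairs n = {(i, j). i \<le> j \<and> j < n}"

lemma finite_upper_pairs: "finite (upper_pairs n)"
  by (rule finite_subset[of _ "{..<n} \<times> {..<n}"]) (auto simp: upper_pairs_def)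

lemma sum_upper_pairs:
  fixes F :: "nat \<Rightarrow> nat \<Rightarrow> real"
  shows "(\<Sum>a<n. \<Sum>b<n. F a b) = (\<Sum>p\<in>upper_pairs n. if fst p = snd p then F (fst p) (fst p)
    else F (fst p) (snd p) + F (snd p) (fst p))"
proof (induction n)
  case (Suc n)
  let ?G = "\<lambda>p. if fst p = snd p then F (fst p) (fst p) else F (fst p) (snd p) + F (snd p) (fst p)"
  have eq: "upper_pairs (Suc n) = insert (n, n) (upper_pairs n \<union> (\<lambda>i. (i, n)) ` {..<n})"
    by (auto simp: upper_pairs_def less_Suc_eq)
  have "(\<Sum>p\<in>upper_pairs (Suc n). ?G p) = F n n + ((\<Sum>p\<in>upper_pairs n. ?G p) + (\<Sum>p\<in>(\<lambda>i. (i, n)) ` {..<n}. ?G p))"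
    unfolding eq using finite_upper_pairs[of n]
    by (subst sum.insert, auto simp: upper_pairs_def, subst sum.union_disjoint) auto
  also have "(\<Sum>p\<in>(\<lambda>i. (i, n)) ` {..<n}. ?G p) = (\<Sum>i<n. F i n + F n i)"
    by (subst sum.reindex) (auto simp: inj_on_def)
  finally show ?case using Suc by (simp add: sum.distrib)
qed (simp add: upper_pairs_def)

locale symmetric_gaussian = prob_space M for M :: "'a measure" +
  fixes n :: nat and \<zeta> :: "'a \<Rightarrow> nat \<Rightarrow> nat \<Rightarrow> real"
  assumes \<zeta>_sym: "\<And>\<omega> a b. \<omega> \<in> space M \<Longrightarrow> a < n \<Longrightarrow> b < n \<Longrightarrow> \<zeta> \<omega> a b = \<zeta> \<omega> b a"
    and gaussians: "std_gaussians (upper_pairs n) (\<lambda>p \<omega>. \<zeta> \<omega> (fst p) (snd p))"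
begin

text \<open>An off-diagonal variable carries the coefficient c_ab + c_ba. By (x + y)^2 <= 2 (x^2 +
  y^2) the variance is at most 2 B^2, whence u^2 / 4 in the exponent instead of u^2 / 2.\<close>

lemma linear_tail:
  assumes c: "(\<Sum>a<n. \<Sum>b<n. (c a b)\<^sup>2) \<le> B\<^sup>2" and B: "0 < B" and u: "0 \<le> u"
  defines "T \<equiv> {\<omega>\<in>space M. \<bar>\<Sum>a<n. \<Sum>b<n. c a b * \<zeta> \<omega> a b\<bar> \<ge> u * B}"
  shows "T \<in> sets M" "prob T \<le> 2 * exp (- u\<^sup>2 / 4)"
proof -
  let ?I = "upper_pairs n"
  let ?C = "\<lambda>p. if fst p = snd p then c (fst p) (fst p) else c (fst p) (snd p) + c (snd p) (fst p)"
  have eq: "(\<Sum>a<n. \<Sum>b<n. c a b * \<zeta> \<omega> a b) = (\<Sum>p\<in>?I. ?C p * \<zeta> \<omega> (fst p) (snd p))" if "\<omega> \<in> space M" for \<omega>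
    unfolding sum_upper_pairs
    by (intro sum.cong refl) (use \<zeta>_sym[OF that] in \<open>auto simp: upper_pairs_def algebra_simps\<close>)
  have "(\<Sum>p\<in>?I. (?C p)\<^sup>2) \<le> (\<Sum>p\<in>?I. 2 * (if fst p = snd p then (c (fst p) (fst p))\<^sup>2
      else (c (fst p) (snd p))\<^sup>2 + (c (snd p) (fst p))\<^sup>2))"
  proof (rule sum_mono)
    fix p
    have "(x + y)\<^sup>2 \<le> 2 * (x\<^sup>2 + y\<^sup>2)" for x y :: real
      using sum_squares_bound[of x y] by (simp add: power2_sum)
    then show "(?C p)\<^sup>2 \<le> 2 * (if fst p = snd p then (c (fst p) (fst p))\<^sup>2
      else (c (fst p) (snd p))\<^sup>2 + (c (snd p) (fst p))\<^sup>2)" by simp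
  qed
  also have "\<dots> = 2 * (\<Sum>a<n. \<Sum>b<n. (c a b)\<^sup>2)" unfolding sum_distrib_left[symmetric] sum_upper_pairs ..
  finally have C: "(\<Sum>p\<in>?I. (?C p)\<^sup>2) \<le> (sqrt 2 * B)\<^sup>2" using c by (simp add: power_mult_distrib)
  have T: "T = {\<omega>\<in>space M. \<bar>\<Sum>p\<in>?I. ?C p * \<zeta> \<omega> (fst p) (snd p)\<bar> \<ge> (u / sqrt 2) * (sqrt 2 * B)
      \<and> (\<Sum>p\<in>?I. (?C p)\<^sup>2) \<le> (sqrt 2 * B)\<^sup>2}"
    unfolding T_def using eq C by (auto simp del: if_split)
  note tail = gaussian_tail[OF gaussians order_refl, of "\<lambda>p _. ?C p" "sqrt 2 * B" "u / sqrt 2"]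
  show "T \<in> sets M" unfolding T using B u by (intro tail) auto
  have "prob T \<le> 2 * exp (- (u / sqrt 2)\<^sup>2 / 2)" unfolding T using B u by (intro tail) auto
  then show "prob T \<le> 2 * exp (- u\<^sup>2 / 4)" by (simp add: power_divide)
qed

text \<open>\<open>minor i\<close> is independent of row \<open>i\<close>.\<close>

definition minor :: "nat \<Rightarrow> 'a \<Rightarrow> nat \<Rightarrow> nat \<Rightarrow> real" where
  "minor i \<omega> a b = (if a = i \<or> b = i then 0 else \<zeta> \<omega> a b)"

text \<open>Leave-one-out: \<open>y\<close> depends only on the variables outside row and column
  \<open>i\<close>, so conditionally on them the inner product with row \<open>i\<close> is Gaussian
  with variance ||y||^2. \<open>J\<close> collects the independent variables that make up row
  \<open>i\<close>.\<close>

lemma row_tail: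
  fixes Q :: "nat \<Rightarrow> nat \<Rightarrow> real" and x :: "nat \<Rightarrow> real"
  assumes i: "i < n" and B: "0 < B" and u: "0 \<le> u"
  defines "y \<omega> \<equiv> mul_n n Q (mul_n n (minor i \<omega>) x)"
  defines "T \<equiv> {\<omega>\<in>space M. \<bar>inner_n n (\<zeta> \<omega> i) (y \<omega>)\<bar> \<ge> u * B \<and> inner_n n (y \<omega>) (y \<omega>) \<le> B\<^sup>2}"
  shows "T \<in> sets M" "prob T \<le> 2 * exp (- u\<^sup>2 / 2)"
proof -
  let ?I = "upper_pairs n"
  define \<iota> where "\<iota> k = (min i k, max i k)" for k
  define J where "J = \<iota> ` {..<n}"
  have inj: "inj_on \<iota> {..<n}" by (auto simp: inj_on_def \<iota>_def min_def max_def split: if_splits)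
  have J: "J \<subseteq> ?I" using i by (auto simp: J_def \<iota>_def upper_pairs_def)
  define other where "other p = (if fst p = i then snd p else fst p)" for p :: "nat \<times> nat"
  have other: "other (\<iota> k) = k" for k by (auto simp: other_def \<iota>_def)
  \<comment> \<open>\<open>h\<close> rebuilds \<open>y\<close> from the variables outside
    \<open>J\<close>, reading each entry of the minor at its ordered index pair;
    \<open>other\<close> recovers the column index from the pair.\<close>
  define h where "h p z = (\<Sum>a<n. Q (other p) a * (\<Sum>b<n. (if a = i \<or> b = i then 0 else z (min a b, max a b)) * x b))"
    for p and z :: "nat \<times> nat \<Rightarrow> real"
  have notJ: "(min a b, max a b) \<in> ?I - J" if "a < n" "b < n" "a \<noteq> i" "b \<noteq> i" for a b
    using that by (auto simp: upper_pairs_def J_def \<iota>_def min_def max_def split: if_splits)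
  have hm: "h p \<in> borel_measurable (PiM (?I - J) (\<lambda>_. borel))" for p
  proof -
    have "(\<lambda>z. if a = i \<or> b = i then 0 else z (min a b, max a b)) \<in> borel_measurable (PiM (?I - J) (\<lambda>_. borel :: real measure))"
      if "a < n" "b < n" for a b
      using notJ[OF that] by (cases "a = i \<or> b = i") (auto intro: measurable_component_singleton)
    then show ?thesis unfolding h_def by (intro borel_measurable_sum borel_measurable_times) auto
  qed
  have \<zeta>\<iota>: "\<zeta> \<omega> (fst (\<iota> k)) (snd (\<iota> k)) = \<zeta> \<omega> i k" if "k < n" "\<omega> \<in> space M" for k \<omega>
    using \<zeta>_sym[OF that(2) i that(1)] by (auto simp: \<iota>_def min_def max_def)
  have hy: "h (\<iota> k) (\<lambda>p\<in>?I - J. \<zeta> \<omega> (fst p) (snd p)) = y \<omega> k" if "k < n" "\<omega> \<in> space M" for k \<omega>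
  proof -
    have "(if a = i \<or> b = i then 0 else (\<lambda>p\<in>?I - J. \<zeta> \<omega> (fst p) (snd p)) (min a b, max a b)) = minor i \<omega> a b"
      if "a < n" "b < n" for a b
      using notJ[OF that] \<zeta>_sym[OF \<open>\<omega> \<in> space M\<close> that] by (auto simp: minor_def min_def max_def)
    then show ?thesis unfolding h_def y_def mul_n_def other by simp
  qed
  have T: "T = {\<omega>\<in>space M. \<bar>\<Sum>p\<in>J. h p (\<lambda>p\<in>?I - J. \<zeta> \<omega> (fst p) (snd p)) * \<zeta> \<omega> (fst p) (snd p)\<bar> \<ge> u * B
      \<and> (\<Sum>p\<in>J. (h p (\<lambda>p\<in>?I - J. \<zeta> \<omega> (fst p) (snd p)))\<^sup>2) \<le> B\<^sup>2}"
  proof -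
    have "(\<Sum>p\<in>J. h p (\<lambda>p\<in>?I - J. \<zeta> \<omega> (fst p) (snd p)) * \<zeta> \<omega> (fst p) (snd p)) = inner_n n (\<zeta> \<omega> i) (y \<omega>)"
      "(\<Sum>p\<in>J. (h p (\<lambda>p\<in>?I - J. \<zeta> \<omega> (fst p) (snd p)))\<^sup>2) = inner_n n (y \<omega>) (y \<omega>)" if "\<omega> \<in> space M" for \<omega>
      unfolding J_def sum.reindex[OF inj] inner_n_def using that hy[unfolded J_def] \<zeta>\<iota>
      by (auto intro!: sum.cong simp: power2_eq_square mult.commute)
    then show ?thesis unfolding T_def by auto
  qed
  note tail = gaussian_tail[OF gaussians J hm B u]
  show "T \<in> sets M" "prob T \<le> 2 * exp (- u\<^sup>2 / 2)" unfolding T by (rule tail)+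
qed

end

lemma (in prob_space) prob_UN_le:
  assumes "finite S" "\<And>s. s \<in> S \<Longrightarrow> B s \<in> sets M" "\<And>s. s \<in> S \<Longrightarrow> prob (B s) \<le> p" "real (card S) * p \<le> t"
  shows "(\<Union>s\<in>S. B s) \<in> sets M" "prob (\<Union>s\<in>S. B s) \<le> t"
proof -
  show "(\<Union>s\<in>S. B s) \<in> sets M" using assms by (intro sets.finite_UN) auto
  have "prob (\<Union>s\<in>S. B s) \<le> (\<Sum>s\<in>S. prob (B s))"
    using assms by (intro finite_measure_subadditive_finite) auto
  also have "\<dots> \<le> (\<Sum>s\<in>S. p)" by (rule sum_mono) (rule assms(3))
  finally show "prob (\<Union>s\<in>S. B s) \<le> t" using assms(4) by simp
qed

lemma norm_n_mask: "norm_n n (\<lambda>a. if a = i then 0 else y a) \<le> norm_n n y"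
proof (rule power2_le_imp_le)
  show "(norm_n n (\<lambda>a. if a = i then 0 else y a))\<^sup>2 \<le> (norm_n n y)\<^sup>2"
    unfolding norm_n_sq inner_n_def by (intro sum_mono) auto
qed simp

section \<open>Leave-one-out remainders and one event for all random estimates\<close>

context symmetric_gaussian
begin

text \<open>Restoring row and column \<open>i\<close> adds the full product at entry
  \<open>i\<close> and x_i times row \<open>i\<close> at the other entries. A row has norm at most
  \<open>c\<close> because applying the matrix to its own row \<open>i\<close> yields the squared
  norm as entry \<open>i\<close>.\<close>

lemma minor_remainder:
  assumes \<omega>: "\<omega> \<in> space M" and i: "i < n"
    and op: "\<And>x. norm_n n (mul_n n (\<zeta> \<omega>) x) \<le> c * norm_n n x" and c: "0 \<le> c"
  shows "norm_n n (\<lambda>a. mul_n n (\<zeta> \<omega>) x a - mul_n n (minor i \<omega>) x a)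
      \<le> \<bar>mul_n n (\<zeta> \<omega>) x i\<bar> + \<bar>x i\<bar> * c"
    and "norm_n n (\<zeta> \<omega> i) \<le> c"
proof -
  have "inner_n n (\<zeta> \<omega> i) (\<zeta> \<omega> i) \<le> c * norm_n n (\<zeta> \<omega> i)"
    using norm_n_component[OF i, of "mul_n n (\<zeta> \<omega>) (\<zeta> \<omega> i)"] op[of "\<zeta> \<omega> i"]
    by (simp add: mul_n_inner)
  then show row: "norm_n n (\<zeta> \<omega> i) \<le> c" by (rule norm_n_le_of_inner) (rule c)
  let ?e = "\<lambda>a. if a = i then mul_n n (\<zeta> \<omega>) x i else 0"
  let ?d = "\<lambda>a. x i * (if a = i then 0 else \<zeta> \<omega> i a)"
  have "mul_n n (\<zeta> \<omega>) x a - mul_n n (minor i \<omega>) x a = ?e a + ?d a" if a: "a < n" for a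
  proof (cases "a = i")
    case False
    have "mul_n n (\<zeta> \<omega>) x a - mul_n n (minor i \<omega>) x a = (\<Sum>b<n. if b = i then \<zeta> \<omega> a i * x i else 0)"
      unfolding mul_n_def sum_subtractf[symmetric] using False by (intro sum.cong) (auto simp: minor_def)
    then show ?thesis using False i \<zeta>_sym[OF \<omega> i a] by simp
  qed (simp add: mul_n_def minor_def)
  then have "norm_n n (\<lambda>a. mul_n n (\<zeta> \<omega>) x a - mul_n n (minor i \<omega>) x a) = norm_n n (\<lambda>a. ?e a + ?d a)"
    by (rule norm_n_cong)
  also have "\<dots> \<le> norm_n n ?e + norm_n n ?d" by (rule norm_n_add)
  also have "norm_n n ?e = \<bar>mul_n n (\<zeta> \<omega>) x i\<bar>"
  proof (rule power2_eq_imp_eq)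
    have "inner_n n ?e ?e = (\<Sum>a<n. if a = i then (mul_n n (\<zeta> \<omega>) x i)\<^sup>2 else 0)"
      unfolding inner_n_def by (intro sum.cong) (auto simp: power2_eq_square)
    then show "(norm_n n ?e)\<^sup>2 = \<bar>mul_n n (\<zeta> \<omega>) x i\<bar>\<^sup>2" using i by (simp add: norm_n_sq)
  qed auto
  also have "norm_n n ?d \<le> \<bar>x i\<bar> * c"
    unfolding norm_n_scale using order_trans[OF norm_n_mask row] by (intro mult_left_mono) auto
  finally show "norm_n n (\<lambda>a. mul_n n (\<zeta> \<omega>) x a - mul_n n (minor i \<omega>) x a)
      \<le> \<bar>mul_n n (\<zeta> \<omega>) x i\<bar> + \<bar>x i\<bar> * c" by simp
qed

text \<open>The minor is the matrix compressed by a coordinate projection on both sides, so it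
  inherits the operator bound.\<close>

lemma minor_op:
  assumes op: "\<And>x. norm_n n (mul_n n (\<zeta> \<omega>) x) \<le> c * norm_n n x" and c: "0 \<le> c"
  shows "norm_n n (mul_n n (minor i \<omega>) x) \<le> c * norm_n n x"
proof -
  let ?x = "\<lambda>b. if b = i then 0 else x b"
  have "mul_n n (minor i \<omega>) x = (\<lambda>a. if a = i then 0 else mul_n n (\<zeta> \<omega>) ?x a)"
    unfolding mul_n_def minor_def by (intro ext) (auto intro!: sum.cong sum.neutral)
  then have "norm_n n (mul_n n (minor i \<omega>) x) \<le> norm_n n (mul_n n (\<zeta> \<omega>) ?x)"
    using norm_n_mask by simp
  also have "\<dots> \<le> c * norm_n n ?x" by (rule op)
  also have "\<dots> \<le> c * norm_n n x" using norm_n_mask c by (intro mult_left_mono) auto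
  finally show ?thesis .
qed

text \<open>\<open>Q\<close> stands for the resolvents; they are deterministic, as
  \<open>row_tail\<close> demands, and otherwise only their norm matters. The failure probability is
  2 exp (- n) for the net and 2 / n^2 for each of the three families of entries.\<close>

lemma good_event:
  fixes Q :: "nat \<Rightarrow> nat \<Rightarrow> nat \<Rightarrow> real"
  assumes n: "2 \<le> n" and r: "r \<le> n" and v: "\<And>j. j < r \<Longrightarrow> norm_n n (v j) = 1"
    and Q: "\<And>j x. j < r \<Longrightarrow> norm_n n (mul_n n (Q j) x) \<le> norm_n n x / g" and g: "0 < g"
  shows "\<exists>G\<in>sets M. prob G \<ge> 1 - (2 * exp (- real n) + 6 / (real n)\<^sup>2) \<and> (\<forall>\<omega>\<in>G. \<omega> \<in> space M \<and>
    (\<forall>x. norm_n n (mul_n n (\<zeta> \<omega>) x) \<le> 26 * sqrt n * norm_n n x) \<and>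
    (\<forall>i<n. \<forall>j<r. \<bar>mul_n n (\<zeta> \<omega>) (v j) i\<bar> \<le> 4 * sqrt (ln n)) \<and>
    (\<forall>k<r. \<forall>j<r. \<bar>inner_n n (v k) (mul_n n (\<zeta> \<omega>) (v j))\<bar> \<le> 4 * sqrt (ln n)) \<and>
    (\<forall>i<n. \<forall>j<r. \<bar>mul_n n (\<zeta> \<omega>) (mul_n n (Q j) (mul_n n (\<zeta> \<omega>) (v j))) i\<bar>
      \<le> 26 * sqrt n / g * (8 * sqrt (ln n) + 26 * sqrt n * \<bar>v j i\<bar>)))"
proof -
  let ?L = "sqrt (ln (real n))" and ?N = "real n"
  have lnn: "0 \<le> ln ?N" using n by simp
  define B where "B = 26 * sqrt ?N / g"
  have B: "B > 0" using n g by (simp add: B_def)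
  have vsq: "(\<Sum>b<n. (v j b)\<^sup>2) = 1" if "j < r" for j
    using v[OF that] norm_n_sq[of n "v j"] by (simp add: inner_n_def power2_eq_square)
  \<comment> \<open>16 n bounds the Frobenius norm of p q^T for net points. The level 13 sqrt n is
    chosen to beat the number of pairs, and 13 * 16 / 8 = 26 is the resulting operator
    constant.\<close>
  define T1 where "T1 = (\<lambda>(p :: nat \<Rightarrow> int, q :: nat \<Rightarrow> int). {\<omega>\<in>space M.
    \<bar>\<Sum>a<n. \<Sum>b<n. (real_of_int (p a) * real_of_int (q b)) * \<zeta> \<omega> a b\<bar> \<ge> (13 * sqrt ?N) * (16 * ?N)})"
  define T2 where "T2 = (\<lambda>(i, j). {\<omega>\<in>space M.
    \<bar>\<Sum>a<n. \<Sum>b<n. (if a = i then v j b else 0) * \<zeta> \<omega> a b\<bar> \<ge> (4 * ?L) * 1})"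
  define T3 where "T3 = (\<lambda>(k, j). {\<omega>\<in>space M.
    \<bar>\<Sum>a<n. \<Sum>b<n. (v k a * v j b) * \<zeta> \<omega> a b\<bar> \<ge> (4 * ?L) * 1})"
  define y where "y i j \<omega> = mul_n n (Q j) (mul_n n (minor i \<omega>) (v j))" for i j \<omega>
  \<comment> \<open>\<open>B\<close> bounds ||y|| once the operator bound holds, so on the good
    event the variance constraint is satisfied automatically.\<close>
  define T4 where "T4 = (\<lambda>(i, j). {\<omega>\<in>space M.
    \<bar>inner_n n (\<zeta> \<omega> i) (y i j \<omega>)\<bar> \<ge> (4 * ?L) * B \<and> inner_n n (y i j \<omega>) (y i j \<omega>) \<le> B\<^sup>2})"
  have exp4: "exp (- (4 * ln ?N)) = 1 / ?N ^ 4"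
  proof -
    have "exp (4 * ln ?N) = exp (ln ?N) ^ 4" using exp_of_nat_mult[of 4 "ln ?N"] by simp
    then show ?thesis using n by (simp add: exp_minus divide_inverse)
  qed
  have count: "real (card ({..<m} \<times> {..<r})) * (2 * (1 / ?N ^ 4)) \<le> 2 / ?N\<^sup>2" if "m \<le> n" for m
  proof -
    have "real m * real r \<le> ?N * ?N" using that r by (intro mult_mono) auto
    then have "real m * real r * (2 * (1 / ?N ^ 4)) \<le> ?N * ?N * (2 * (1 / ?N ^ 4))"
      by (intro mult_right_mono) auto
    also have "\<dots> = 2 / ?N\<^sup>2" using n by (simp add: power2_eq_square power4_eq_xxxx)
    finally show ?thesis by (simp add: card_cartesian_product)
  qed
  have T1: "T1 s \<in> sets M" "prob (T1 s) \<le> 2 * exp (- (13 * sqrt ?N)\<^sup>2 / 4)" if "s \<in> int_net n \<times> int_net n" for s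
  proof -
    obtain p q where s: "s = (p, q)" "p \<in> int_net n" "q \<in> int_net n" using \<open>s \<in> int_net n \<times> int_net n\<close> by auto
    have le: "(\<Sum>a<n. (real_of_int (p a))\<^sup>2) \<le> 16 * ?N" if "p \<in> int_net n" for p
    proof -
      have "real_of_int (\<Sum>a<n. (p a)\<^sup>2) \<le> real_of_int (16 * int n)"
        using that unfolding int_net_def of_int_le_iff by simp
      then show ?thesis by simp
    qed
    have "(\<Sum>a<n. \<Sum>b<n. (real_of_int (p a) * real_of_int (q b))\<^sup>2)
        = (\<Sum>a<n. (real_of_int (p a))\<^sup>2) * (\<Sum>b<n. (real_of_int (q b))\<^sup>2)"
      by (simp add: sum_product power_mult_distrib)
    also have "\<dots> \<le> (16 * ?N) * (16 * ?N)" using s le by (intro mult_mono) (auto intro: sum_nonneg)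
    finally have "(\<Sum>a<n. \<Sum>b<n. (real_of_int (p a) * real_of_int (q b))\<^sup>2) \<le> (16 * ?N)\<^sup>2"
      by (simp only: power2_eq_square)
    moreover have "0 < 16 * ?N" "0 \<le> 13 * sqrt ?N" using n by auto
    ultimately have "T1 (p, q) \<in> sets M" "prob (T1 (p, q)) \<le> 2 * exp (- (13 * sqrt ?N)\<^sup>2 / 4)"
      unfolding T1_def prod.case by (rule linear_tail)+
    then show "T1 s \<in> sets M" "prob (T1 s) \<le> 2 * exp (- (13 * sqrt ?N)\<^sup>2 / 4)" unfolding s(1) .
  qed
  have U1: "(\<Union>s\<in>int_net n \<times> int_net n. T1 s) \<in> sets M" "prob (\<Union>s\<in>int_net n \<times> int_net n. T1 s) \<le> 2 * exp (- ?N)"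
  proof -
    have "real (card (int_net n \<times> int_net n)) * (2 * exp (- (13 * sqrt ?N)\<^sup>2 / 4)) \<le> 2 * exp (- ?N)"
    proof -
      have "real (card (int_net n)) * real (card (int_net n)) \<le> exp (18 * ?N) * exp (18 * ?N)"
        by (intro mult_mono card_int_net) auto
      then have "real (card (int_net n \<times> int_net n)) \<le> exp (36 * ?N)"
        by (simp add: card_cartesian_product exp_add[symmetric])
      then have "real (card (int_net n \<times> int_net n)) * (2 * exp (- (13 * sqrt ?N)\<^sup>2 / 4))
          \<le> exp (36 * ?N) * (2 * exp (- (13 * sqrt ?N)\<^sup>2 / 4))"
        by (intro mult_right_mono) auto
      \<comment> \<open>The two nets contribute 36 n and the tail 13^2 / 4 n = 42.25 n, which leaves
        more than n.\<close>
      also have "\<dots> = 2 * exp (36 * ?N - 169 / 4 * ?N)"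
        by (simp add: power_mult_distrib exp_add[symmetric] exp_diff exp_minus field_simps)
      also have "\<dots> \<le> 2 * exp (- ?N)" by simp
      finally show ?thesis .
    qed
    note * = prob_UN_le[of "int_net n \<times> int_net n" T1, OF _ T1 this]
    show "(\<Union>s\<in>int_net n \<times> int_net n. T1 s) \<in> sets M" "prob (\<Union>s\<in>int_net n \<times> int_net n. T1 s) \<le> 2 * exp (- ?N)"
      using * finite_int_net by auto
  qed
  have L16: "- (4 * ?L)\<^sup>2 / 4 = - (4 * ln ?N)" using lnn by (simp add: power_mult_distrib)
  have T2: "T2 s \<in> sets M" "prob (T2 s) \<le> 2 * (1 / ?N ^ 4)" if "s \<in> {..<n} \<times> {..<r}" for s
  proof -
    obtain i j where s: "s = (i, j)" "i < n" "j < r" using \<open>s \<in> {..<n} \<times> {..<r}\<close> by auto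
    have "(\<Sum>a<n. \<Sum>b<n. (if a = i then v j b else 0)\<^sup>2) = (\<Sum>a<n. if a = i then \<Sum>b<n. (v j b)\<^sup>2 else 0)"
      by (intro sum.cong) auto
    then have "(\<Sum>a<n. \<Sum>b<n. (if a = i then v j b else 0)\<^sup>2) \<le> 1\<^sup>2" using s vsq by simp
    moreover have "0 < (1 :: real)" "0 \<le> 4 * ?L" using lnn by auto
    ultimately have "T2 (i, j) \<in> sets M" "prob (T2 (i, j)) \<le> 2 * exp (- (4 * ?L)\<^sup>2 / 4)"
      unfolding T2_def prod.case by (rule linear_tail)+
    then show "T2 s \<in> sets M" "prob (T2 s) \<le> 2 * (1 / ?N ^ 4)" unfolding s(1) L16 exp4 .
  qed
  have T3: "T3 s \<in> sets M" "prob (T3 s) \<le> 2 * (1 / ?N ^ 4)" if "s \<in> {..<r} \<times> {..<r}" for s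
  proof -
    obtain k j where s: "s = (k, j)" "k < r" "j < r" using \<open>s \<in> {..<r} \<times> {..<r}\<close> by auto
    have "(\<Sum>a<n. \<Sum>b<n. (v k a * v j b)\<^sup>2) = (\<Sum>a<n. (v k a)\<^sup>2) * (\<Sum>b<n. (v j b)\<^sup>2)"
      by (simp add: sum_product power_mult_distrib)
    then have "(\<Sum>a<n. \<Sum>b<n. (v k a * v j b)\<^sup>2) \<le> 1\<^sup>2" using s vsq by simp
    moreover have "0 < (1 :: real)" "0 \<le> 4 * ?L" using lnn by auto
    ultimately have "T3 (k, j) \<in> sets M" "prob (T3 (k, j)) \<le> 2 * exp (- (4 * ?L)\<^sup>2 / 4)"
      unfolding T3_def prod.case by (rule linear_tail)+
    then show "T3 s \<in> sets M" "prob (T3 s) \<le> 2 * (1 / ?N ^ 4)" unfolding s(1) L16 exp4 .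
  qed
  have T4: "T4 s \<in> sets M" "prob (T4 s) \<le> 2 * (1 / ?N ^ 4)" if "s \<in> {..<n} \<times> {..<r}" for s
  proof -
    obtain i j where s: "s = (i, j)" "i < n" "j < r" using \<open>s \<in> {..<n} \<times> {..<r}\<close> by auto
    have "0 \<le> 4 * ?L" using lnn by simp
    with s(2) B have *: "T4 (i, j) \<in> sets M" "prob (T4 (i, j)) \<le> 2 * exp (- (4 * ?L)\<^sup>2 / 2)"
      unfolding T4_def prod.case y_def by (rule row_tail)+
    show "T4 s \<in> sets M" unfolding s(1) by (rule *)
    have "prob (T4 s) \<le> 2 * exp (- (4 * ?L)\<^sup>2 / 2)" unfolding s(1) by (rule *)
    \<comment> \<open>The one-row tail has the better exponent 8 ln n; it is weakened to 4 ln n so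
      that \<open>count\<close> covers all three families.\<close>
    also have "- (4 * ?L)\<^sup>2 / 2 \<le> - (4 * ln ?N)" using lnn by (simp add: power_mult_distrib)
    finally show "prob (T4 s) \<le> 2 * (1 / ?N ^ 4)" by (simp add: exp4)
  qed
  let ?U1 = "\<Union>s\<in>int_net n \<times> int_net n. T1 s" and ?U2 = "\<Union>s\<in>{..<n} \<times> {..<r}. T2 s"
    and ?U3 = "\<Union>s\<in>{..<r} \<times> {..<r}. T3 s" and ?U4 = "\<Union>s\<in>{..<n} \<times> {..<r}. T4 s"
  have U2: "?U2 \<in> sets M" "prob ?U2 \<le> 2 / ?N\<^sup>2"
    using prob_UN_le[of _ T2, OF _ T2 count[of n]] by auto
  have U3: "?U3 \<in> sets M" "prob ?U3 \<le> 2 / ?N\<^sup>2"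
    using prob_UN_le[of _ T3, OF _ T3 count[OF r]] by auto
  have U4: "?U4 \<in> sets M" "prob ?U4 \<le> 2 / ?N\<^sup>2"
    using prob_UN_le[of _ T4, OF _ T4 count[of n]] by auto
  let ?U = "(?U1 \<union> ?U2) \<union> (?U3 \<union> ?U4)"
  have Um: "?U \<in> sets M" using U1 U2 U3 U4 by auto
  have "prob ?U \<le> prob (?U1 \<union> ?U2) + prob (?U3 \<union> ?U4)"
    using U1 U2 U3 U4 by (intro measure_Un_le) auto
  also have "\<dots> \<le> (prob ?U1 + prob ?U2) + (prob ?U3 + prob ?U4)"
    using U1 U2 U3 U4 by (intro add_mono measure_Un_le) auto
  also have "\<dots> \<le> 2 * exp (- ?N) + 6 / ?N\<^sup>2" using U1(2) U2(2) U3(2) U4(2) by simp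
  finally have Up: "prob ?U \<le> 2 * exp (- ?N) + 6 / ?N\<^sup>2" .
  show ?thesis
  proof (intro bexI conjI ballI)
    show "space M - ?U \<in> sets M" using Um by auto
    show "1 - (2 * exp (- ?N) + 6 / ?N\<^sup>2) \<le> prob (space M - ?U)"
      using prob_compl[OF Um] Up by linarith
    fix \<omega> assume "\<omega> \<in> space M - ?U"
    then have \<omega>: "\<omega> \<in> space M" and notin: "\<And>s. s \<in> int_net n \<times> int_net n \<Longrightarrow> \<omega> \<notin> T1 s"
      "\<And>s. s \<in> {..<n} \<times> {..<r} \<Longrightarrow> \<omega> \<notin> T2 s" "\<And>s. s \<in> {..<r} \<times> {..<r} \<Longrightarrow> \<omega> \<notin> T3 s"
      "\<And>s. s \<in> {..<n} \<times> {..<r} \<Longrightarrow> \<omega> \<notin> T4 s" by blast+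
    show "\<omega> \<in> space M" by (rule \<omega>)
    have op: "norm_n n (mul_n n (\<zeta> \<omega>) x) \<le> 26 * sqrt ?N * norm_n n x" for x
    proof -
      have "norm_n n (mul_n n (\<zeta> \<omega>) x) \<le> ((13 * sqrt ?N) * (16 * ?N)) / (8 * ?N) * norm_n n x"
      proof (rule operator_norm_via_net)
        fix p q assume pq: "p \<in> int_net n" "q \<in> int_net n"
        have "inner_n n (\<lambda>a. real_of_int (p a)) (mul_n n (\<zeta> \<omega>) (\<lambda>a. real_of_int (q a)))
          = (\<Sum>a<n. \<Sum>b<n. (real_of_int (p a) * real_of_int (q b)) * \<zeta> \<omega> a b)"
          unfolding inner_n_def mul_n_def sum_distrib_left by (simp add: ac_simps)
        then show "\<bar>inner_n n (\<lambda>a. real_of_int (p a)) (mul_n n (\<zeta> \<omega>) (\<lambda>a. real_of_int (q a)))\<bar>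
            \<le> (13 * sqrt ?N) * (16 * ?N)"
          using notin(1)[of "(p, q)"] pq \<omega> unfolding T1_def by auto
      qed (use n in simp)
      also have "((13 * sqrt ?N) * (16 * ?N)) / (8 * ?N) = 26 * sqrt ?N" using n by simp
      finally show ?thesis .
    qed
    then show "\<forall>x. norm_n n (mul_n n (\<zeta> \<omega>) x) \<le> 26 * sqrt ?N * norm_n n x" by blast
    have row: "\<bar>mul_n n (\<zeta> \<omega>) (v j) i\<bar> \<le> 4 * ?L" if "i < n" "j < r" for i j
    proof -
      have "(\<Sum>a<n. \<Sum>b<n. (if a = i then v j b else 0) * \<zeta> \<omega> a b)
          = (\<Sum>a<n. if a = i then mul_n n (\<zeta> \<omega>) (v j) i else 0)"
        by (intro sum.cong) (auto simp: mul_n_def mult.commute)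
      then show ?thesis using notin(2)[of "(i, j)"] that \<omega> unfolding T2_def by auto
    qed
    then show "\<forall>i<n. \<forall>j<r. \<bar>mul_n n (\<zeta> \<omega>) (v j) i\<bar> \<le> 4 * ?L" by blast
    show "\<forall>k<r. \<forall>j<r. \<bar>inner_n n (v k) (mul_n n (\<zeta> \<omega>) (v j))\<bar> \<le> 4 * ?L"
    proof (intro allI impI)
      fix k j assume kj: "k < r" "j < r"
      have "inner_n n (v k) (mul_n n (\<zeta> \<omega>) (v j)) = (\<Sum>a<n. \<Sum>b<n. (v k a * v j b) * \<zeta> \<omega> a b)"
        unfolding inner_n_def mul_n_def sum_distrib_left by (simp add: ac_simps)
      then show "\<bar>inner_n n (v k) (mul_n n (\<zeta> \<omega>) (v j))\<bar> \<le> 4 * ?L"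
        using notin(3)[of "(k, j)"] kj \<omega> unfolding T3_def by auto
    qed
    show "\<forall>i<n. \<forall>j<r. \<bar>mul_n n (\<zeta> \<omega>) (mul_n n (Q j) (mul_n n (\<zeta> \<omega>) (v j))) i\<bar>
      \<le> 26 * sqrt ?N / g * (8 * ?L + 26 * sqrt ?N * \<bar>v j i\<bar>)"
    proof (intro allI impI)
      fix i j assume i: "i < n" and j: "j < r"
      let ?c = "26 * sqrt ?N"
      let ?d = "\<lambda>a. mul_n n (\<zeta> \<omega>) (v j) a - mul_n n (minor i \<omega>) (v j) a"
      have c: "0 \<le> ?c" by simp
      have "norm_n n (y i j \<omega>) \<le> norm_n n (mul_n n (minor i \<omega>) (v j)) / g" unfolding y_def by (rule Q[OF j])
      also have "\<dots> \<le> B"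
        unfolding B_def using minor_op[OF op c, of i "v j"] v[OF j] g by (intro divide_right_mono) auto
      finally have "(norm_n n (y i j \<omega>))\<^sup>2 \<le> B\<^sup>2" by (rule power_mono) simp
      then have main: "\<bar>inner_n n (\<zeta> \<omega> i) (y i j \<omega>)\<bar> \<le> 4 * ?L * B"
        using notin(4)[of "(i, j)"] i j \<omega> unfolding T4_def norm_n_sq by auto
      have "\<bar>inner_n n (\<zeta> \<omega> i) (mul_n n (Q j) ?d)\<bar> \<le> norm_n n (\<zeta> \<omega> i) * norm_n n (mul_n n (Q j) ?d)"
        by (rule inner_n_le)
      also have "\<dots> \<le> ?c * ((4 * ?L + \<bar>v j i\<bar> * ?c) / g)"
      proof (intro mult_mono)
        show "norm_n n (\<zeta> \<omega> i) \<le> ?c" by (rule minor_remainder(2)[OF \<omega> i op c])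
        have "norm_n n ?d \<le> 4 * ?L + \<bar>v j i\<bar> * ?c"
          using minor_remainder(1)[OF \<omega> i op c, of "v j"] row[OF i j] by linarith
        then show "norm_n n (mul_n n (Q j) ?d) \<le> (4 * ?L + \<bar>v j i\<bar> * ?c) / g"
          using Q[OF j, of ?d] g by (meson divide_right_mono less_imp_le order_trans)
      qed auto
      finally have rem: "\<bar>inner_n n (\<zeta> \<omega> i) (mul_n n (Q j) ?d)\<bar> \<le> ?c * ((4 * ?L + \<bar>v j i\<bar> * ?c) / g)" .
      \<comment> \<open>Split off the part that uses the minor. It gives 4 sqrt (ln n) from the
        conditional Gaussian tail; the remainder gives another 4 sqrt (ln n) from entry
        \<open>i\<close> of the product with v_j, and a term with |v_j i| from the deleted
        column.\<close>
      have "mul_n n (\<zeta> \<omega>) (mul_n n (Q j) (mul_n n (\<zeta> \<omega>) (v j))) i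
          = inner_n n (\<zeta> \<omega> i) (y i j \<omega>) + inner_n n (\<zeta> \<omega> i) (mul_n n (Q j) ?d)"
        unfolding mul_n_inner[of n "\<zeta> \<omega>" _ i] y_def mul_n_diff[abs_def] inner_n_linear by simp
      then have "\<bar>mul_n n (\<zeta> \<omega>) (mul_n n (Q j) (mul_n n (\<zeta> \<omega>) (v j))) i\<bar>
          \<le> 4 * ?L * B + ?c * ((4 * ?L + \<bar>v j i\<bar> * ?c) / g)" using main rem by linarith
      also have "\<dots> = ?c / g * (8 * ?L + ?c * \<bar>v j i\<bar>)" unfolding B_def using g by (simp add: field_simps)
      finally show "\<bar>mul_n n (\<zeta> \<omega>) (mul_n n (Q j) (mul_n n (\<zeta> \<omega>) (v j))) i\<bar>
          \<le> ?c / g * (8 * ?L + ?c * \<bar>v j i\<bar>)" .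
    qed
  qed
qed

end

subsection \<open>Assembling the rate\<close>

text \<open>With x = \<sigma> sqrt N one has \<eta> <= a x, where 52 = 2 * 26. The Procrustes term
  falls under \<sigma>^2 sqrt N, the linear terms under \<sigma> L, the replacement of F by W under
  x^3, and the remaining terms under several of them.\<close>

lemma rate_arithmetic:
  fixes N L \<sigma> K1 K2 g r e \<eta> \<kappa> l q :: real
  assumes g: "0 < g" and K1: "0 < K1" and K2: "0 < K2" and N: "0 < N" and L: "1 \<le> L" and \<sigma>: "0 < \<sigma>"
    and \<epsilon>: "\<sigma> * sqrt N \<le> K2" and r: "0 \<le> r" "r \<le> K1\<^sup>2"
    and e: "e = 26 * (\<sigma> * sqrt N)" and \<eta>: "\<eta> = 2 * e * sqrt r / g" "\<eta> \<le> 1 / 2"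
    and \<kappa>: "\<kappa> = K1 / sqrt N" and l: "l = \<sigma> * (4 * L)"
    and q: "q = \<sigma>\<^sup>2 * (26 * sqrt N / g * (8 * L + 26 * sqrt N * \<kappa>))"
  defines "a \<equiv> 52 * K1 / g"
  defines "T \<equiv> \<sigma>\<^sup>2 * sqrt N + \<sigma> * L + (\<sigma> * sqrt N) ^ 3"
  shows "\<eta>\<^sup>2 * \<kappa> + sqrt r * (l + q + e * ((2 * e * \<eta> + 4 * r * e * \<eta>) / g) + \<kappa> * (2 * e)
      + r * ((l + 2 * e * \<eta>) * (2 * \<eta>))) / g
    \<le> (a\<^sup>2 * K1 + K1 * (4 + (208 * K2 / g + 676 * K1 / g) + 676 * (2 + 4 * K1\<^sup>2) * a / g + 52 * K1
      + K1\<^sup>2 * (4 + 104 * a\<^sup>2)) / g) * T"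
proof -
  define s where "s = sqrt N"
  define x where "x = \<sigma> * s"
  have s: "s > 0" using N by (simp add: s_def)
  have x: "x > 0" using s \<sigma> by (simp add: x_def)
  have ex: "e = 26 * x" by (simp add: e x_def s_def)
  have a: "a > 0" using K1 g by (simp add: a_def)
  have sr: "sqrt r \<le> K1" "0 \<le> sqrt r" using r K1 by (auto intro: real_le_lsqrt)
  have T: "\<sigma>\<^sup>2 * s \<le> T" "\<sigma> * L \<le> T" "x ^ 3 \<le> T" "0 \<le> T"
    unfolding T_def s_def[symmetric] x_def using s \<sigma> L by (auto simp: add_nonneg_nonneg)
  have \<eta>0: "0 \<le> \<eta>" using \<eta>(1) ex x g sr by simp
  have \<eta>a: "\<eta> \<le> a * x"
  proof -
    have "\<eta> = (52 * x / g) * sqrt r" by (simp add: \<eta>(1) ex)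
    also have "\<dots> \<le> (52 * x / g) * K1" using sr x g by (intro mult_left_mono) auto
    finally show ?thesis by (simp add: a_def ac_simps)
  qed
  have t1: "\<eta>\<^sup>2 * \<kappa> \<le> a\<^sup>2 * K1 * T"
  proof -
    have "\<eta>\<^sup>2 * \<kappa> \<le> (a * x)\<^sup>2 * \<kappa>"
      using \<eta>a \<eta>0 s K1 by (intro mult_right_mono power_mono) (auto simp: \<kappa> s_def)
    also have "\<dots> = a\<^sup>2 * K1 * (\<sigma>\<^sup>2 * s)"
      using s by (simp add: \<kappa> s_def[symmetric] x_def power_mult_distrib power2_eq_square)
    also have "\<dots> \<le> a\<^sup>2 * K1 * T" using T(1) K1 by (intro mult_left_mono) auto
    finally show ?thesis .
  qed
  have t2: "l \<le> 4 * T" using T(2) by (simp add: l mult.assoc mult.left_commute)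
  \<comment> \<open>208 = 26 * 8 and 676 = 26^2. The first part is x times \<sigma> L, where the
    bound x <= K2 is used; incoherence turns the second into \<sigma>^2 sqrt N.\<close>
  have t3: "q \<le> (208 * K2 / g + 676 * K1 / g) * T"
  proof -
    have "q = 208 / g * (x * (\<sigma> * L)) + 676 * K1 / g * (\<sigma>\<^sup>2 * s)"
      using s g by (simp add: q \<kappa> s_def[symmetric] x_def power2_eq_square field_simps)
    also have "\<dots> \<le> 208 / g * (K2 * T) + 676 * K1 / g * T"
      using T \<epsilon> x \<sigma> L g K1 K2
      by (intro add_mono mult_left_mono mult_mono) (auto simp: x_def s_def)
    finally show ?thesis by (simp add: distrib_right)
  qed
  have t4: "e * ((2 * e * \<eta> + 4 * r * e * \<eta>) / g) \<le> 676 * (2 + 4 * K1\<^sup>2) * a / g * T"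
  proof -
    have "e * ((2 * e * \<eta> + 4 * r * e * \<eta>) / g) = 676 / g * x\<^sup>2 * ((2 + 4 * r) * \<eta>)"
      by (simp add: ex power2_eq_square field_simps)
    also have "\<dots> \<le> 676 / g * x\<^sup>2 * ((2 + 4 * K1\<^sup>2) * (a * x))"
      using r \<eta>a \<eta>0 g by (intro mult_left_mono mult_mono) auto
    also have "\<dots> = 676 * (2 + 4 * K1\<^sup>2) * a / g * x ^ 3"
      by (simp add: power2_eq_square power3_eq_cube)
    also have "\<dots> \<le> 676 * (2 + 4 * K1\<^sup>2) * a / g * T"
      using T(3) a g by (intro mult_left_mono) (auto simp: add_nonneg_nonneg)
    finally show ?thesis .
  qed
  have t5: "\<kappa> * (2 * e) \<le> 52 * K1 * T"
  proof -
    have "\<kappa> * (2 * e) = 52 * K1 * (\<sigma> * 1)" using s by (simp add: \<kappa> s_def[symmetric] ex x_def)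
    also have "\<dots> \<le> 52 * K1 * (\<sigma> * L)" using L \<sigma> K1 by (intro mult_left_mono) auto
    also have "\<dots> \<le> 52 * K1 * T" using T(2) K1 by (intro mult_left_mono) auto
    finally show ?thesis .
  qed
  \<comment> \<open>Here \<eta> is used in two ways: 2 \<eta> <= 1 keeps the Gaussian part at order
    \<sigma> L, while \<eta> <= a x makes the other part cubic.\<close>
  have t6: "r * ((l + 2 * e * \<eta>) * (2 * \<eta>)) \<le> K1\<^sup>2 * (4 + 104 * a\<^sup>2) * T"
  proof -
    have l0: "0 \<le> l" using \<sigma> L by (simp add: l)
    have "(l + 2 * e * \<eta>) * (2 * \<eta>) = l * (2 * \<eta>) + 104 * (x * \<eta>\<^sup>2)"
      by (simp add: ex power2_eq_square algebra_simps)
    also have "\<dots> \<le> l * 1 + 104 * (x * (a * x)\<^sup>2)"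
      using \<eta>(2) \<eta>a \<eta>0 x l0 by (intro add_mono mult_left_mono power_mono) auto
    also have "x * (a * x)\<^sup>2 = a\<^sup>2 * x ^ 3" by (simp add: power2_eq_square power3_eq_cube)
    also have "l * 1 + 104 * (a\<^sup>2 * x ^ 3) \<le> 4 * T + 104 * (a\<^sup>2 * T)"
      using t2 T(3) by (intro add_mono mult_left_mono) auto
    also have "\<dots> = (4 + 104 * a\<^sup>2) * T" by (simp add: algebra_simps)
    finally have "(l + 2 * e * \<eta>) * (2 * \<eta>) \<le> (4 + 104 * a\<^sup>2) * T" .
    moreover have nonneg: "0 \<le> (l + 2 * e * \<eta>) * (2 * \<eta>)" using l0 ex x \<eta>0 by simp
    ultimately have "r * ((l + 2 * e * \<eta>) * (2 * \<eta>)) \<le> K1\<^sup>2 * ((4 + 104 * a\<^sup>2) * T)"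
      by (intro mult_mono[OF r(2) _ _ nonneg]) auto
    then show ?thesis by (simp add: mult.assoc)
  qed
  let ?\<beta> = "l + q + e * ((2 * e * \<eta> + 4 * r * e * \<eta>) / g) + \<kappa> * (2 * e) + r * ((l + 2 * e * \<eta>) * (2 * \<eta>))"
  let ?b = "4 + (208 * K2 / g + 676 * K1 / g) + 676 * (2 + 4 * K1\<^sup>2) * a / g + 52 * K1 + K1\<^sup>2 * (4 + 104 * a\<^sup>2)"
  have "?\<beta> \<le> 4 * T + (208 * K2 / g + 676 * K1 / g) * T + 676 * (2 + 4 * K1\<^sup>2) * a / g * T + 52 * K1 * T
      + K1\<^sup>2 * (4 + 104 * a\<^sup>2) * T"
    by (intro add_mono t2 t3 t4 t5 t6)
  also have "\<dots> = ?b * T" by (simp only: distrib_right)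
  finally have "sqrt r * ?\<beta> \<le> sqrt r * (?b * T)" using sr by (intro mult_left_mono)
  also have "\<dots> \<le> K1 * (?b * T)"
    using sr T(4) K1 K2 g a by (intro mult_right_mono mult_nonneg_nonneg add_nonneg_nonneg) auto
  finally have "sqrt r * ?\<beta> / g \<le> K1 * (?b * T) / g" using g by (intro divide_right_mono) auto
  then have "\<eta>\<^sup>2 * \<kappa> + sqrt r * ?\<beta> / g \<le> a\<^sup>2 * K1 * T + K1 * (?b * T) / g" using t1 by linarith
  also have "\<dots> = (a\<^sup>2 * K1 + K1 * ?b / g) * T" by (simp add: distrib_right)
  finally show ?thesis .
qed

text \<open>The last summand serves the regime \<open>\<sigma> \<surd>n > g / (104 K1)\<close>, where only the trivial bound 2 is
  available.\<close>

definition rate_constant :: "real \<Rightarrow> real \<Rightarrow> real \<Rightarrow> real" where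
  "rate_constant g K1 K2 = (52 * K1 / g)\<^sup>2 * K1 + K1 * (4 + (208 * K2 / g + 676 * K1 / g)
      + 676 * (2 + 4 * K1\<^sup>2) * (52 * K1 / g) / g + 52 * K1 + K1\<^sup>2 * (4 + 104 * (52 * K1 / g)\<^sup>2)) / g
    + 2 / (g / (104 * K1)) ^ 3"

text \<open>The event is chosen before \<open>Vh\<close> and \<open>U\<close>, so one event serves
  every choice of them, and it depends on neither regime of \<sigma> sqrt n. The constant contains
  only \<open>g\<close>, \<open>K1\<close> and \<open>K2\<close>.\<close>

lemma (in eigen_data) high_probability_bound:
  fixes Z :: "'a \<Rightarrow> real mat"
  assumes M: "prob_space M" "gaussian_symmetric M n Z" and n: "3 \<le> n"
    and gap: "min (sep spectral_norm L1 L2) (sep_on two_inf_norm V2 L1 C2) = g"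
    and K1: "0 < K1" "two_inf_norm V1 \<le> K1 * (1 / sqrt (real n))"
    and K2: "0 < K2" "0 < \<sigma>" "\<sigma> \<le> K2 * (1 / sqrt (real n))"
  shows "\<exists>G\<in>sets M. 1 - (2 * exp (- real n) + 6 / (real n)\<^sup>2) \<le> measure M G \<and> measure M G \<le> 1 \<and>
    (\<forall>\<omega>\<in>G. \<forall>Vh U. Vh \<in> carrier_mat n r \<and> orthonormal_columns Vh \<and>
      dominant_invariant_subspace r (A + \<sigma> \<cdot>\<^sub>m Z \<omega>) (mat_ran Vh) \<and> solves_procrustes r Vh V1 U \<longrightarrow>
      two_inf_norm (Vh * U - V1) \<le> rate_constant g K1 K2 *
        (\<sigma>\<^sup>2 * sqrt (real n) + \<sigma> * sqrt (ln (real n)) + (\<sigma> * sqrt (real n)) ^ 3))"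
proof -
  let ?N = "real n"
  let ?L = "sqrt (ln ?N)"
  let ?T = "\<sigma>\<^sup>2 * sqrt ?N + \<sigma> * ?L + (\<sigma> * sqrt ?N) ^ 3"
  have gap0: "0 < g" and gap_le: "g \<le> lam r - lam (r + 1)" and gap_sep: "g \<le> sep_on two_inf_norm V2 L1 C2"
    using gap sep_spectral_bounds sep_on_pos by auto
  \<comment> \<open>n >= 3 exceeds e. This lets a bare \<sigma> be absorbed into \<sigma> sqrt (ln
    n).\<close>
  have L: "1 \<le> ?L"
  proof -
    have "exp 1 \<le> ?N" using exp_le n by linarith
    then have "1 \<le> ln ?N" using n by (subst ln_ge_iff) auto
    then show ?thesis by simp
  qed
  interpret prob_space M by (rule M)
  define \<zeta> where "\<zeta> \<omega> a b = Z \<omega> $$ (a, b)" for \<omega> a b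
  have Zmat: "Z \<omega> \<in> carrier_mat n n" "transpose_mat (Z \<omega>) = Z \<omega>" if "\<omega> \<in> space M" for \<omega>
    using M(2) that by (auto simp: gaussian_symmetric_def)
  interpret symmetric_gaussian M n \<zeta>
  proof
    show "\<zeta> \<omega> a b = \<zeta> \<omega> b a" if "\<omega> \<in> space M" "a < n" "b < n" for \<omega> a b
      using Zmat[OF that(1)] that(2,3) unfolding \<zeta>_def by (metis carrier_matD index_transpose_mat(1))
    show "std_gaussians (upper_pairs n) (\<lambda>p \<omega>. \<zeta> \<omega> (fst p) (snd p))"
      using M(2) finite_upper_pairs[of n] unfolding std_gaussians_def gaussian_symmetric_def upper_pairs_def \<zeta>_def
      by auto
  qed
  have R: "norm_n n (mul_n n (R j) x) \<le> norm_n n x / g" if "j < r" for j x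
    using R_norm[OF that, of x] gap0 gap_le by (smt (verit) frac_le norm_n_nonneg)
  obtain G where G: "G \<in> sets M" "1 - (2 * exp (- ?N) + 6 / ?N\<^sup>2) \<le> prob G"
    and good: "\<And>\<omega>. \<omega> \<in> G \<Longrightarrow> \<omega> \<in> space M"
      "\<And>\<omega> x. \<omega> \<in> G \<Longrightarrow> norm_n n (mul_n n (\<zeta> \<omega>) x) \<le> 26 * sqrt ?N * norm_n n x"
      "\<And>\<omega> i j. \<omega> \<in> G \<Longrightarrow> i < n \<Longrightarrow> j < r \<Longrightarrow> \<bar>mul_n n (\<zeta> \<omega>) (v j) i\<bar> \<le> 4 * ?L"
      "\<And>\<omega> k j. \<omega> \<in> G \<Longrightarrow> k < r \<Longrightarrow> j < r \<Longrightarrow> \<bar>inner_n n (v k) (mul_n n (\<zeta> \<omega>) (v j))\<bar> \<le> 4 * ?L"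
      "\<And>\<omega> i j. \<omega> \<in> G \<Longrightarrow> i < n \<Longrightarrow> j < r \<Longrightarrow> \<bar>mul_n n (\<zeta> \<omega>) (mul_n n (R j) (mul_n n (\<zeta> \<omega>) (v j))) i\<bar>
        \<le> 26 * sqrt ?N / g * (8 * ?L + 26 * sqrt ?N * \<bar>v j i\<bar>)"
    using good_event[of r v R g, OF _ _ orthonormal_n_norm[OF v_r] R gap0] n r by auto
  \<comment> \<open>Since \<eta> <= 52 K1 / g times \<sigma> sqrt n, the threshold with 104 = 2 * 52
    is exactly what ensures \<eta> <= 1 / 2.\<close>
  define c0 where "c0 = g / (104 * K1)"
  have c0: "c0 > 0" using gap0 K1 by (simp add: c0_def)
  \<comment> \<open>Removing the summand for the large-noise regime leaves the constant of
    \<open>rate_arithmetic\<close>.\<close>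
  define C0 where "C0 = rate_constant g K1 K2 - 2 / c0 ^ 3"
  have C0: "0 \<le> C0" using gap0 K1 K2 by (simp add: C0_def rate_constant_def c0_def)
  have T0: "0 \<le> ?T" using K2 L by (simp add: add_nonneg_nonneg)
  have row_norm: "norm_n r (\<lambda>k. v k i) \<le> K1 / sqrt ?N" if i: "i < n" for i
  proof -
    have "norm_n r (\<lambda>k. v k i) = norm_n (dim_col V1) (\<lambda>j. V1 $$ (i, j))"
      using V1(1) by (auto simp: v_def intro!: norm_n_cong)
    also have "\<dots> \<le> K1 / sqrt ?N" using two_inf_norm_row[of i V1] K1(2) i V1(1) by simp
    finally show ?thesis .
  qed
  have rK1: "real r \<le> K1\<^sup>2"
    using rank_le[OF row_norm] n by (simp add: power_divide)
  have small: "two_inf_norm (Vh * U - V1) \<le> C0 * ?T"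
    if \<omega>: "\<omega> \<in> G" and c: "\<sigma> * sqrt ?N \<le> c0" and Vh: "Vh \<in> carrier_mat n r" "orthonormal_columns Vh"
      and dom: "dominant_invariant_subspace r (A + \<sigma> \<cdot>\<^sub>m Z \<omega>) (mat_ran Vh)" and U: "solves_procrustes r Vh V1 U"
    for \<omega> Vh U
  proof -
    let ?E = "\<lambda>i k. \<sigma> * Z \<omega> $$ (i, k)"
    have E: "mul_n n ?E x = (\<lambda>i. \<sigma> * mul_n n (\<zeta> \<omega>) x i)" for x
      by (simp add: mul_n_def \<zeta>_def sum_distrib_left mult.assoc)
    define e where "e = 26 * (\<sigma> * sqrt ?N)"
    define \<eta> where "\<eta> = 2 * e * sqrt (real r) / g"
    define \<kappa> where "\<kappa> = K1 / sqrt ?N"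
    define l where "l = \<sigma> * (4 * ?L)"
    define q where "q = \<sigma>\<^sup>2 * (26 * sqrt ?N / g * (8 * ?L + 26 * sqrt ?N * \<kappa>))"
    have \<eta>: "\<eta> \<le> 1 / 2"
    proof -
      have "sqrt (real r) \<le> K1" using rK1 K1 by (auto intro: real_le_lsqrt)
      then have "(\<sigma> * sqrt ?N) * sqrt (real r) \<le> c0 * K1" using c c0 by (intro mult_mono) auto
      then show ?thesis using gap0 K1 by (simp add: \<eta>_def e_def c0_def field_simps)
    qed
    have "two_inf_norm (Vh * U - V1) \<le> \<eta>\<^sup>2 * \<kappa> + sqrt (real r) *
      (l + q + e * ((2 * e * \<eta> + 4 * real r * e * \<eta>) / g) + \<kappa> * (2 * e)
        + real r * ((l + 2 * e * \<eta>) * (2 * \<eta>))) / g"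
    proof (rule perturbed_rows[OF Zmat[OF good(1)[OF \<omega>]] _ _ gap0 gap_le gap_sep \<eta>_def \<eta> _ _ _ _ Vh dom U])
      show "0 \<le> e" using K2 by (simp add: e_def)
      show "norm_n n (mul_n n ?E x) \<le> e * norm_n n x" for x
        unfolding E norm_n_scale using mult_left_mono[OF good(2)[OF \<omega>, of x], of \<sigma>] K2(2)
        by (simp add: e_def mult.assoc mult.left_commute)
      show "\<bar>mul_n n ?E (v j) i\<bar> \<le> l" if "i < n" "j < r" for i j
        unfolding E l_def abs_mult using good(3)[OF \<omega> that] K2(2) by simp
      show "\<bar>inner_n n (v k) (mul_n n ?E (v j))\<bar> \<le> l" if "k < r" "j < r" for k j
        unfolding E l_def inner_n_scale_right abs_mult using good(4)[OF \<omega> that] K2(2) by simp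
      show "\<bar>mul_n n ?E (mul_n n (R j) (mul_n n ?E (v j))) i\<bar> \<le> q" if ij: "i < n" "j < r" for i j
      proof -
        have "\<bar>v j i\<bar> \<le> \<kappa>"
          unfolding \<kappa>_def using norm_n_component[OF ij(2), of "\<lambda>k. v k i"] row_norm[OF ij(1)]
          by linarith
        then have "26 * sqrt ?N / g * (8 * ?L + 26 * sqrt ?N * \<bar>v j i\<bar>) \<le> 26 * sqrt ?N / g * (8 * ?L + 26 * sqrt ?N * \<kappa>)"
          using gap0 by (intro mult_left_mono add_left_mono) auto
        then have "\<sigma>\<^sup>2 * \<bar>mul_n n (\<zeta> \<omega>) (mul_n n (R j) (mul_n n (\<zeta> \<omega>) (v j))) i\<bar> \<le> q"
          unfolding q_def using good(5)[OF \<omega> ij] by (intro mult_left_mono) auto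
        moreover have "mul_n n ?E (mul_n n (R j) (mul_n n ?E (v j))) i
            = \<sigma>\<^sup>2 * mul_n n (\<zeta> \<omega>) (mul_n n (R j) (mul_n n (\<zeta> \<omega>) (v j))) i"
          unfolding E mul_n_scale[abs_def] by (simp add: power2_eq_square mul_n_scale)
        ultimately show ?thesis by (simp add: abs_mult)
      qed
      show "norm_n r (\<lambda>k. v k i) \<le> \<kappa>" if "i < n" for i
        unfolding \<kappa>_def by (rule row_norm[OF that])
    qed
    also have "\<dots> \<le> C0 * ?T"
    proof -
      have \<epsilon>: "\<sigma> * sqrt ?N \<le> K2" using K2(3) n by (simp add: field_simps)
      have N: "0 < ?N" using n by simp
      show ?thesis
        using rate_arithmetic[OF gap0 K1(1) K2(1) N L K2(2) \<epsilon> of_nat_0_le_iff rK1 e_def \<eta>_def \<eta> \<kappa>_def l_def q_def]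
        by (simp add: C0_def rate_constant_def c0_def)
    qed
    finally show ?thesis .
  qed
  have large: "two_inf_norm (Vh * U - V1) \<le> 2 / c0 ^ 3 * ?T"
    if c: "\<not> \<sigma> * sqrt ?N \<le> c0" and Vh: "Vh \<in> carrier_mat n r" "orthonormal_columns Vh" "solves_procrustes r Vh V1 U"
    for Vh U
  proof -
    have "c0 ^ 3 \<le> (\<sigma> * sqrt ?N) ^ 3" using c c0 by (intro power_mono) auto
    also have "\<dots> \<le> ?T" using K2 L by (simp add: add_nonneg_nonneg)
    finally have "2 / c0 ^ 3 * c0 ^ 3 \<le> 2 / c0 ^ 3 * ?T" using c0 by (intro mult_left_mono) auto
    then show ?thesis using trivial_bound[OF Vh] c0 by simp
  qed
  have combine: "two_inf_norm (Vh * U - V1) \<le> rate_constant g K1 K2 * ?T"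
    if "\<omega> \<in> G" "Vh \<in> carrier_mat n r" "orthonormal_columns Vh"
      "dominant_invariant_subspace r (A + \<sigma> \<cdot>\<^sub>m Z \<omega>) (mat_ran Vh)" "solves_procrustes r Vh V1 U" for \<omega> Vh U
  proof -
    have eq: "rate_constant g K1 K2 * ?T = C0 * ?T + 2 / c0 ^ 3 * ?T"
      unfolding C0_def by (simp only: distrib_right[symmetric] diff_add_cancel)
    have "0 \<le> C0 * ?T" "0 \<le> 2 / c0 ^ 3 * ?T" using C0 c0 T0 by (intro mult_nonneg_nonneg; simp)+
    then show ?thesis
      unfolding eq using small[OF that(1) _ that(2-5)] large[OF _ that(2,3,5)] by (cases "\<sigma> * sqrt ?N \<le> c0") force+
  qed
  show ?thesis using G combine prob_le_1 by blast
qed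

theorem theorem3p6:
  fixes N :: nat and r :: "nat \<Rightarrow> nat"
    and A V1 V2 L1 L2 :: "nat \<Rightarrow> real mat" and lam :: "nat \<Rightarrow> nat \<Rightarrow> real"
    and gap K1 K2 :: real and \<sigma> :: "nat \<Rightarrow> real"
    and M :: "nat \<Rightarrow> 'a measure" and Z :: "nat \<Rightarrow> 'a \<Rightarrow> real mat"
  assumes r: "\<And>n. n \<ge> N \<Longrightarrow> 1 \<le> r n \<and> r n < n"
    and A: "\<And>n. n \<ge> N \<Longrightarrow> A n \<in> carrier_mat n n \<and> transpose_mat (A n) = A n"
    and eigenvalues: "\<And>n. n \<ge> N \<Longrightarrow> ordered_eigenvalues (A n) (lam n)"
    and eigengap: "\<And>n. n \<ge> N \<Longrightarrow> lam n (r n) > lam n (r n + 1)"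
    and L1: "\<And>n. n \<ge> N \<Longrightarrow> L1 n = mat_diag (r n) (\<lambda>i. lam n (i + 1))"
    and L2: "\<And>n. n \<ge> N \<Longrightarrow> L2 n = mat_diag (n - r n) (\<lambda>i. lam n (r n + i + 1))"
    and V1: "\<And>n. n \<ge> N \<Longrightarrow> V1 n \<in> carrier_mat n (r n) \<and> orthonormal_columns (V1 n) \<and>
               (\<forall>j < r n. eigenvector (A n) (Matrix.col (V1 n) j) (lam n (j + 1)))"
    and V2: "\<And>n. n \<ge> N \<Longrightarrow> V2 n \<in> carrier_mat n (n - r n) \<and> orthonormal_columns (V2 n) \<and>
               (\<forall>j < n - r n. eigenvector (A n) (Matrix.col (V2 n) j) (lam n (r n + j + 1)))"
    and decomposition: "\<And>n. n \<ge> N \<Longrightarrow>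
               A n = V1 n * L1 n * transpose_mat (V1 n) + V2 n * L2 n * transpose_mat (V2 n)"
    and gap: "\<And>n. n \<ge> N \<Longrightarrow>
               min (sep spectral_norm (L1 n) (L2 n))
                   (sep_on two_inf_norm (V2 n) (L1 n) (V2 n * L2 n * transpose_mat (V2 n))) = gap"
    and incoherence: "K1 > 0" "\<And>n. n \<ge> N \<Longrightarrow> two_inf_norm (V1 n) \<le> K1 * (1 / sqrt (real n))"
    and noise: "K2 > 0" "\<And>n. n \<ge> N \<Longrightarrow> 0 < \<sigma> n \<and> \<sigma> n \<le> K2 * (1 / sqrt (real n))"
    and prob: "\<And>n. n \<ge> N \<Longrightarrow> prob_space (M n)"
    and Z: "\<And>n. n \<ge> N \<Longrightarrow> gaussian_symmetric (M n) n (Z n)"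
  shows "\<exists>C>0. with_high_probability M (\<lambda>n \<omega>.
           \<forall>Vh U. Vh \<in> carrier_mat n (r n) \<and> orthonormal_columns Vh \<and>
             dominant_invariant_subspace (r n) (A n + \<sigma> n \<cdot>\<^sub>m Z n \<omega>) (mat_ran Vh) \<and>
             solves_procrustes (r n) Vh (V1 n) U \<longrightarrow>
             two_inf_norm (Vh * U - V1 n)
               \<le> C * ((\<sigma> n)\<^sup>2 * sqrt (real n) + \<sigma> n * sqrt (ln (real n)) + (\<sigma> n * sqrt (real n)) ^ 3))"
proof -
  let ?P = "\<lambda>n \<omega>. \<forall>Vh U. Vh \<in> carrier_mat n (r n) \<and> orthonormal_columns Vh \<and>
             dominant_invariant_subspace (r n) (A n + \<sigma> n \<cdot>\<^sub>m Z n \<omega>) (mat_ran Vh) \<and>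
             solves_procrustes (r n) Vh (V1 n) U \<longrightarrow>
             two_inf_norm (Vh * U - V1 n)
               \<le> rate_constant gap K1 K2 * ((\<sigma> n)\<^sup>2 * sqrt (real n) + \<sigma> n * sqrt (ln (real n)) + (\<sigma> n * sqrt (real n)) ^ 3)"
  let ?p = "\<lambda>n. 1 - (2 * exp (- real n) + 6 / (real n)\<^sup>2)"
  have data: "eigen_data n (r n) (A n) (V1 n) (V2 n) (lam n)" if "n \<ge> N" for n
    using r[OF that] A[OF that] eigenvalues[OF that] eigengap[OF that] V1[OF that] V2[OF that]
    by unfold_locales auto
  \<comment> \<open>Positivity at the single index n = N suffices, since \<open>gap\<close> is the
    same number for every n >= N.\<close>
  have gap_pos: "0 < gap"
    using gap[OF order_refl] eigen_data.sep_spectral_bounds(1)[OF data[OF order_refl]]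
      eigen_data.sep_on_pos[OF data[OF order_refl]] L1[OF order_refl] L2[OF order_refl] by auto
  \<comment> \<open>For the finitely many n below max N 3 the empty event serves: it is measurable
    in any measure space and carries no claim.\<close>
  have "\<exists>G. G \<in> sets (M n) \<and> (\<forall>\<omega>\<in>G. ?P n \<omega>) \<and> (n \<ge> max N 3 \<longrightarrow> ?p n \<le> measure (M n) G \<and> measure (M n) G \<le> 1)" for n
  proof (cases "n \<ge> max N 3")
    case True
    then have n: "n \<ge> N" "3 \<le> n" by auto
    show ?thesis
      using eigen_data.high_probability_bound[OF data[OF n(1)] prob[OF n(1)] Z[OF n(1)] n(2)
          gap[OF n(1), unfolded L1[OF n(1)] L2[OF n(1)]] incoherence(1) incoherence(2)[OF n(1)]
          noise(1) conjunct1[OF noise(2)[OF n(1)]] conjunct2[OF noise(2)[OF n(1)]]] by blast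
  qed (auto intro!: exI[of _ "{}"])
  then obtain G where G: "\<And>n. G n \<in> sets (M n)" "\<And>n \<omega>. \<omega> \<in> G n \<Longrightarrow> ?P n \<omega>"
    "\<And>n. n \<ge> max N 3 \<Longrightarrow> ?p n \<le> measure (M n) (G n) \<and> measure (M n) (G n) \<le> 1"
    by metis
  have "(\<lambda>n. measure (M n) (G n)) \<longlonglongrightarrow> 1"
  proof (rule tendsto_sandwich)
    show "\<forall>\<^sub>F n in sequentially. ?p n \<le> measure (M n) (G n)" "\<forall>\<^sub>F n in sequentially. measure (M n) (G n) \<le> 1"
      using G(3) by (auto simp: eventually_sequentially intro!: exI[of _ "max N 3"])
    show "?p \<longlonglongrightarrow> 1" by real_asymp
  qed simp
  then have "with_high_probability M ?P"
    unfolding with_high_probability_def using G(1,2) by blast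
  moreover have "0 < rate_constant gap K1 K2"
    unfolding rate_constant_def using gap_pos incoherence(1) noise(1)
    by (intro add_pos_pos mult_pos_pos divide_pos_pos) (auto intro!: add_pos_pos add_pos_nonneg mult_pos_pos)
  ultimately show ?thesis by blast
qed

end
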